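(* Let $n\in\mathbb{N}$ and $r\in(0,+\infty]$. For each $q\in\mathbb{C}^\times$ there are topological algebra isomorphisms $$\mathcal{O}_{\mathrm{def}}(\mathbb{D}^n_r)_q\cong\mathsf{E}(\mathbb{D}^n_r)_q\cong\mathcal{O}_q(\mathbb{D}^n_r),$$ $$\mathcal{O}^{\mathrm T}_{\mathrm{def}}(\mathbb{D}^n_r)_q\cong\mathsf{E}^{\mathrm T}(\mathbb{D}^n_r)_q\cong\mathcal{O}_q(\mathbb{D}^n_r),$$ $$\mathcal{O}_{\mathrm{def}}(\mathbb{B}^n_r)_q\cong\mathsf{E}(\mathbb{B}^n_r)_q\cong\mathcal{O}_q(\mathbb{B}^n_r).$$
   Context: All algebras are complex, associative and unital; a Fréchet algebra is a complete metrizable locally convex algebra. $\mathbb{C}^\times=\mathbb{C}\setminus\{0\}$, $\mathbb{Z}_+=\{0,1,\dots\}$. Free algebras. $W_{n,d}=\{1,\dots,n\}^d$, $W_n=\bigsqcup_{d\ge0}W_{n,d}$, $|\alpha|=d$ for $\alpha\in W_{n,d}$, $\zeta_\alpha=\zeta_{\alpha_1}\cdots\zeta_{\alpha_d}$. $\mathfrak{F}_n$ is the algebra of formal series $\sum_\alpha c_\alpha\zeta_\alpha$ in free variables $\zeta_1,\dots,\zeta_n$. $\mathrm{s}(\alpha)=\mathrm{card}\{i<d:\alpha_i\ne\alpha_{i+1}\}$ if $d=|\alpha|\ge2$, and $\mathrm{s}(\alpha)=|\alpha|-1$ if $|\alpha|\le1$. The following are Fréchet algebras with multiplication from $\mathfrak{F}_n$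 and topology given by the indicated norms: - $\mathcal{F}(\mathbb{D}^n_r)$: all $a$ with $\|a\|_{\rho,\tau}=\sum_\alpha|c_\alpha|\rho^{|\alpha|}\tau^{\mathrm{s}(\alpha)+1}<\infty$ for all $\rho\in(0,r)$, $\tau\ge1$ (this is a concrete form of the Arens-Michael free product of $n$ copies of the algebra of holomorphic functions on the disk of radius $r$); - $\mathcal{F}^{\mathrm T}(\mathbb{D}^n_r)$: all $a$ with $\|a\|_\rho=\sum_\alpha|c_\alpha|\rho^{|\alpha|}<\infty$ for all $\rho\in(0,r)$; - $\mathcal{F}(\mathbb{B}^n_r)$: all $a$ with $\|a\|_\rho^\bullet=\sum_{d\ge0}(\sum_{|\alpha|=d}|c_\alpha|^2)^{1/2}\rho^d<\infty$ for all $\rho\in(0,r)$. Deformation algebras. For a Fréchet algebra $F$, $\mathcal{O}(\mathbb{C}^\times,F)$ is the Fréchet algebra of holomorphic $F$-valued functions on $\mathbb{C}^\times$ (compact-open topology), an algebra over $\mathcal{O}(\mathbb{C}^\times)$; elements of $F$ are regarded as constant functions and $z\in\mathcal{O}(\mathbb{C}^\times)$ is the coordinate. Let $I_{\mathbb{D}}$, $I^{\mathrm T}_{\mathbb{D}}$, $I_{\mathbb{B}}$ be the closed two-sided ideals of $\mathcal{O}(\mathbb{C}^\times,F)$ for $F=\mathcal{F}(\mathbb{D}^n_r)$, $\mathcal{F}^{\mathrm T}(\mathbb{D}^n_r)$, $\mathcal{F}(\mathbb{B}^n_r)$ respectively, generated by $\zeta_i\zeta_j-z\zeta_j\zeta_i$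 ($i<j$). Put $\mathcal{O}_{\mathrm{def}}(\mathbb{D}^n_r)=\mathcal{O}(\mathbb{C}^\times,\mathcal{F}(\mathbb{D}^n_r))/I_{\mathbb{D}}$, $\mathcal{O}^{\mathrm T}_{\mathrm{def}}(\mathbb{D}^n_r)=\mathcal{O}(\mathbb{C}^\times,\mathcal{F}^{\mathrm T}(\mathbb{D}^n_r))/I^{\mathrm T}_{\mathbb{D}}$, $\mathcal{O}_{\mathrm{def}}(\mathbb{B}^n_r)=\mathcal{O}(\mathbb{C}^\times,\mathcal{F}(\mathbb{B}^n_r))/I_{\mathbb{B}}$. Fibers and bundles. For a Fréchet $\mathcal{O}(\mathbb{C}^\times)$-algebra $A$ and $q\in\mathbb{C}^\times$ let $\mathfrak{m}_q=\{f\in\mathcal{O}(\mathbb{C}^\times):f(q)=0\}$, $A_q=A/\overline{\mathfrak{m}_qA}$ (quotient topology), and $u_q$ the class of $u\in A$ in $A_q$. The bundle $\mathsf{E}(A)$ has total space $\bigsqcup_{q}A_q$ with projection $p$ onto $\mathbb{C}^\times$, and topology with base $\{v:p(v)\in V,\ \|v-u_{p(v)}\|<\varepsilon\}$, where $V\subset\mathbb{C}^\times$ is open, $u\in A$, $\varepsilon>0$, and $\|\cdot\|$ is a continuous seminorm on $A$ (the same symbol denoting its quotient seminorm on each $A_q$). The fiber $\mathsf{E}(A)_q=p^{-1}(q)$ carries the algebra structure of $A_q$ and the topology inherited from $\mathsf{E}(A)$. Put $\mathsf{E}(\mathbb{D}^n_r)=\mathsf{E}(\mathcal{O}_{\mathrm{def}}(\mathbb{D}^n_r))$,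 $\mathsf{E}^{\mathrm T}(\mathbb{D}^n_r)=\mathsf{E}(\mathcal{O}^{\mathrm T}_{\mathrm{def}}(\mathbb{D}^n_r))$, $\mathsf{E}(\mathbb{B}^n_r)=\mathsf{E}(\mathcal{O}_{\mathrm{def}}(\mathbb{B}^n_r))$. Quantum algebras. For $k\in\mathbb{Z}_+^n$: $|k|=\sum k_i$, $u_q(k)=|q|^{\sum_{i<j}k_ik_j}$, $w_q(k)=\min\{u_q(k),1\}$. For $t>0$: $[m]_t=1+t+\cdots+t^{m-1}$, $[m]_t!=[1]_t\cdots[m]_t$, $[0]_t!=1$, $[k]_t!=\prod_i[k_i]_t!$. $\mathcal{O}_q(\mathbb{D}^n_r)$ (resp. $\mathcal{O}_q(\mathbb{B}^n_r)$) is the Fréchet algebra of all formal series $f=\sum_{k\in\mathbb{Z}_+^n}c_kx^k$, $x^k=x_1^{k_1}\cdots x_n^{k_n}$, such that for all $\rho\in(0,r)$ one has $\|f\|_{\mathbb{D},\rho}=\sum_k|c_k|w_q(k)\rho^{|k|}<\infty$ (resp. $\|f\|_{\mathbb{B},\rho}=\sum_k|c_k|([k]_{|q|^2}!/[|k|]_{|q|^2}!)^{1/2}u_q(k)\rho^{|k|}<\infty$), with topology given by these norms and continuous multiplication determined by $x_ix_j=qx_jx_i$ ($i<j$). *)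

theory Defs
  imports "HOL-Analysis.Analysis" "HOL-Algebra.QuotRing" "HOL-Algebra.Module"
    "HOL-Algebra.Generated_Groups"
begin

section \<open>Topological algebras\<close>

text \<open>The first type parameter is the type of scalars: complex numbers for plain algebras,
  functions \<open>complex \<Rightarrow> complex\<close> for algebras over the holomorphic functions on \<open>\<complex>\<^sup>\<times>\<close>.\<close>

record ('s, 'a) top_alg = "('s, 'a) module" +
  topol :: "'a topology"

definition top_alg_iso :: "(complex, 'a) top_alg \<Rightarrow> (complex, 'b) top_alg \<Rightarrow> bool"
    (infix "\<cong>\<^sub>t\<^sub>a" 50) where
  "A \<cong>\<^sub>t\<^sub>a B \<longleftrightarrow> (\<exists>\<phi>. \<phi> \<in> ring_iso A B
      \<and> (\<forall>c. \<forall>a\<in>carrier A. \<phi> (c \<odot>\<^bsub>A\<^esub> a) = c \<odot>\<^bsub>B\<^esub> \<phi> a)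
      \<and> homeomorphic_map (topol A) (topol B) \<phi>)"

definition quotient_alg :: "('s, 'a) top_alg \<Rightarrow> 'a set \<Rightarrow> ('s, 'a set) top_alg" where
  "quotient_alg A J =
    \<lparr>carrier = carrier (A Quot J), mult = mult (A Quot J), one = one (A Quot J),
     zero = zero (A Quot J), add = add (A Quot J),
     smult = (\<lambda>c X. \<Union>a\<in>X. J +>\<^bsub>A\<^esub> (c \<odot>\<^bsub>A\<^esub> a)),
     topol = topology (\<lambda>U. U \<subseteq> carrier (A Quot J)
               \<and> openin (topol A) {a \<in> carrier A. J +>\<^bsub>A\<^esub> a \<in> U})\<rparr>"

definition closed_ideal_gen :: "('s, 'a) top_alg \<Rightarrow> 'a set \<Rightarrow> 'a set" where
  "closed_ideal_gen A S = \<Inter>{J. ideal J A \<and> closedin (topol A) J \<and> S \<subseteq> J}"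


section \<open>Algebras of formal series\<close>

definition seminorm_topology ::
    "('k \<Rightarrow> complex) set \<Rightarrow> (('k \<Rightarrow> complex) \<Rightarrow> real) set \<Rightarrow> ('k \<Rightarrow> complex) topology" where
  "seminorm_topology S P = topology_generated_by
     {{y \<in> S. p (\<lambda>k. y k - x k) < \<epsilon>} | p x \<epsilon>. p \<in> P \<and> x \<in> S \<and> \<epsilon> > 0}"

definition radii :: "ereal \<Rightarrow> real set" where
  "radii r = {\<rho>. 0 < \<rho> \<and> ereal \<rho> < r}"

subsection \<open>Free variables\<close>

text \<open>A series \<open>\<Sum>\<^sub>\<alpha> c\<^sub>\<alpha> \<zeta>\<^sub>\<alpha>\<close> in \<open>n\<close> free variables is its coefficient function \<open>c\<close> on all lists,
  vanishing off the words over \<open>{1..n}\<close>.\<close>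

definition words :: "nat \<Rightarrow> nat list set" where
  "words n = lists {1..n}"

definition words_len :: "nat \<Rightarrow> nat \<Rightarrow> nat list set" where
  "words_len n d = {\<alpha> \<in> words n. length \<alpha> = d}"

definition free_series :: "nat \<Rightarrow> (nat list \<Rightarrow> complex) set" where
  "free_series n = {c. \<forall>\<alpha>. \<alpha> \<notin> words n \<longrightarrow> c \<alpha> = 0}"

definition zeta :: "nat \<Rightarrow> nat list \<Rightarrow> complex" where
  "zeta i = (\<lambda>\<alpha>. if \<alpha> = [i] then 1 else 0)"

definition free_alg ::
    "(nat list \<Rightarrow> complex) set \<Rightarrow> ((nat list \<Rightarrow> complex) \<Rightarrow> real) set
      \<Rightarrow> (complex, nat list \<Rightarrow> complex) top_alg" where
  "free_alg S P =
    \<lparr>carrier = S,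
     mult = (\<lambda>a b \<alpha>. \<Sum>m\<le>length \<alpha>. a (take m \<alpha>) * b (drop m \<alpha>)),
     one = (\<lambda>\<alpha>. if \<alpha> = [] then 1 else 0),
     zero = (\<lambda>\<alpha>. 0),
     add = (\<lambda>a b \<alpha>. a \<alpha> + b \<alpha>),
     smult = (\<lambda>c a \<alpha>. c * a \<alpha>),
     topol = seminorm_topology S P\<rparr>"

definition switches :: "nat list \<Rightarrow> int" where
  "switches \<alpha> =
    (if length \<alpha> \<le> 1 then int (length \<alpha>) - 1
     else int (card {i. Suc i < length \<alpha> \<and> \<alpha> ! i \<noteq> \<alpha> ! Suc i}))"

definition free_polydisk_term :: "real \<Rightarrow> real \<Rightarrow> (nat list \<Rightarrow> complex) \<Rightarrow> nat list \<Rightarrow> real" where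
  "free_polydisk_term \<rho> \<tau> a = (\<lambda>\<alpha>. cmod (a \<alpha>) * \<rho> ^ length \<alpha> * \<tau> powi (switches \<alpha> + 1))"

text \<open>\<open>\<F>(\<D>\<^sup>n\<^sub>r)\<close>\<close>
definition F_D :: "nat \<Rightarrow> ereal \<Rightarrow> (complex, nat list \<Rightarrow> complex) top_alg" where
  "F_D n r = free_alg
     {a \<in> free_series n. \<forall>\<rho>\<in>radii r. \<forall>\<tau>\<ge>1. free_polydisk_term \<rho> \<tau> a summable_on words n}
     {(\<lambda>a. infsum (free_polydisk_term \<rho> \<tau> a) (words n)) | \<rho> \<tau>. \<rho> \<in> radii r \<and> \<tau> \<ge> 1}"

definition free_taylor_term :: "real \<Rightarrow> (nat list \<Rightarrow> complex) \<Rightarrow> nat list \<Rightarrow> real" where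
  "free_taylor_term \<rho> a = (\<lambda>\<alpha>. cmod (a \<alpha>) * \<rho> ^ length \<alpha>)"

text \<open>\<open>\<F>\<^sup>T(\<D>\<^sup>n\<^sub>r)\<close>\<close>
definition FT_D :: "nat \<Rightarrow> ereal \<Rightarrow> (complex, nat list \<Rightarrow> complex) top_alg" where
  "FT_D n r = free_alg
     {a \<in> free_series n. \<forall>\<rho>\<in>radii r. free_taylor_term \<rho> a summable_on words n}
     {(\<lambda>a. infsum (free_taylor_term \<rho> a) (words n)) | \<rho>. \<rho> \<in> radii r}"

definition free_ball_term :: "nat \<Rightarrow> real \<Rightarrow> (nat list \<Rightarrow> complex) \<Rightarrow> nat \<Rightarrow> real" where
  "free_ball_term n \<rho> a = (\<lambda>d. sqrt (\<Sum>\<alpha>\<in>words_len n d. (cmod (a \<alpha>))\<^sup>2) * \<rho> ^ d)"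

text \<open>\<open>\<F>(\<B>\<^sup>n\<^sub>r)\<close>\<close>
definition F_B :: "nat \<Rightarrow> ereal \<Rightarrow> (complex, nat list \<Rightarrow> complex) top_alg" where
  "F_B n r = free_alg
     {a \<in> free_series n. \<forall>\<rho>\<in>radii r. summable (free_ball_term n \<rho> a)}
     {(\<lambda>a. suminf (free_ball_term n \<rho> a)) | \<rho>. \<rho> \<in> radii r}"

subsection \<open>Variables commuting up to a scalar\<close>

text \<open>A multi-index in \<open>\<int>\<^sub>+\<^sup>n\<close> is a function vanishing off \<open>{1..n}\<close>, and a series \<open>\<Sum>\<^sub>k c\<^sub>k x\<^sup>k\<close> is
  its coefficient function, vanishing off the multi-indices.\<close>

definition multi_indices :: "nat \<Rightarrow> (nat \<Rightarrow> nat) set" where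
  "multi_indices n = {k. \<forall>i. i \<notin> {1..n} \<longrightarrow> k i = 0}"

definition quantum_series :: "nat \<Rightarrow> ((nat \<Rightarrow> nat) \<Rightarrow> complex) set" where
  "quantum_series n = {c. \<forall>k. k \<notin> multi_indices n \<longrightarrow> c k = 0}"

text \<open>From \<open>x\<^sub>i x\<^sub>j = q x\<^sub>j x\<^sub>i\<close> (\<open>i < j\<close>), moving each \<open>x\<^sub>i\<close> of \<open>x\<^sup>l\<close> to the left past every \<open>x\<^sub>j\<close>, \<open>j > i\<close>,
  of \<open>x\<^sup>k\<close> costs one factor \<open>q\<^sup>-\<^sup>1\<close>; hence \<open>x\<^sup>k x\<^sup>l = q\<^sup>-\<^sup>e x\<^sup>k\<^sup>+\<^sup>l\<close> with \<open>e = \<Sum>\<^sub>i\<^sub><\<^sub>j l\<^sub>i k\<^sub>j\<close>.\<close>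
definition quantum_alg ::
    "nat \<Rightarrow> complex \<Rightarrow> ((nat \<Rightarrow> nat) \<Rightarrow> complex) set \<Rightarrow> (((nat \<Rightarrow> nat) \<Rightarrow> complex) \<Rightarrow> real) set
      \<Rightarrow> (complex, (nat \<Rightarrow> nat) \<Rightarrow> complex) top_alg" where
  "quantum_alg n q S P =
    \<lparr>carrier = S,
     mult = (\<lambda>a b m. \<Sum>(k, l)\<in>{(k, l). k \<in> multi_indices n \<and> l \<in> multi_indices n
                                  \<and> (\<lambda>i. k i + l i) = m}.
               inverse q ^ (\<Sum>j=1..n. \<Sum>i=1..<j. l i * k j) * a k * b l),
     one = (\<lambda>k. if k = (\<lambda>_. 0) then 1 else 0),
     zero = (\<lambda>k. 0),
     add = (\<lambda>a b k. a k + b k),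
     smult = (\<lambda>c a k. c * a k),
     topol = seminorm_topology S P\<rparr>"

definition mi_deg :: "nat \<Rightarrow> (nat \<Rightarrow> nat) \<Rightarrow> nat" where
  "mi_deg n k = (\<Sum>i=1..n. k i)"

definition u_weight :: "nat \<Rightarrow> complex \<Rightarrow> (nat \<Rightarrow> nat) \<Rightarrow> real" where
  "u_weight n q k = cmod q ^ (\<Sum>j=1..n. \<Sum>i=1..<j. k i * k j)"

definition w_weight :: "nat \<Rightarrow> complex \<Rightarrow> (nat \<Rightarrow> nat) \<Rightarrow> real" where
  "w_weight n q k = min (u_weight n q k) 1"

definition q_int :: "real \<Rightarrow> nat \<Rightarrow> real" where
  "q_int t m = (\<Sum>i<m. t ^ i)"

definition q_fact :: "real \<Rightarrow> nat \<Rightarrow> real" where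
  "q_fact t m = (\<Prod>i=1..m. q_int t i)"

definition q_fact_mi :: "nat \<Rightarrow> real \<Rightarrow> (nat \<Rightarrow> nat) \<Rightarrow> real" where
  "q_fact_mi n t k = (\<Prod>i=1..n. q_fact t (k i))"

definition q_polydisk_term ::
    "nat \<Rightarrow> complex \<Rightarrow> real \<Rightarrow> ((nat \<Rightarrow> nat) \<Rightarrow> complex) \<Rightarrow> (nat \<Rightarrow> nat) \<Rightarrow> real" where
  "q_polydisk_term n q \<rho> f = (\<lambda>k. cmod (f k) * w_weight n q k * \<rho> ^ mi_deg n k)"

text \<open>\<open>\<O>\<^sub>q(\<D>\<^sup>n\<^sub>r)\<close>\<close>
definition O_q_D :: "complex \<Rightarrow> nat \<Rightarrow> ereal \<Rightarrow> (complex, (nat \<Rightarrow> nat) \<Rightarrow> complex) top_alg" where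
  "O_q_D q n r = quantum_alg n q
     {f \<in> quantum_series n. \<forall>\<rho>\<in>radii r. q_polydisk_term n q \<rho> f summable_on multi_indices n}
     {(\<lambda>f. infsum (q_polydisk_term n q \<rho> f) (multi_indices n)) | \<rho>. \<rho> \<in> radii r}"

definition q_ball_term ::
    "nat \<Rightarrow> complex \<Rightarrow> real \<Rightarrow> ((nat \<Rightarrow> nat) \<Rightarrow> complex) \<Rightarrow> (nat \<Rightarrow> nat) \<Rightarrow> real" where
  "q_ball_term n q \<rho> f = (\<lambda>k. cmod (f k)
     * sqrt (q_fact_mi n ((cmod q)\<^sup>2) k / q_fact ((cmod q)\<^sup>2) (mi_deg n k))
     * u_weight n q k * \<rho> ^ mi_deg n k)"

text \<open>\<open>\<O>\<^sub>q(\<B>\<^sup>n\<^sub>r)\<close>\<close>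
definition O_q_B :: "complex \<Rightarrow> nat \<Rightarrow> ereal \<Rightarrow> (complex, (nat \<Rightarrow> nat) \<Rightarrow> complex) top_alg" where
  "O_q_B q n r = quantum_alg n q
     {f \<in> quantum_series n. \<forall>\<rho>\<in>radii r. q_ball_term n q \<rho> f summable_on multi_indices n}
     {(\<lambda>f. infsum (q_ball_term n q \<rho> f) (multi_indices n)) | \<rho>. \<rho> \<in> radii r}"


section \<open>Holomorphic functions on the punctured plane and deformation algebras\<close>

definition Cx :: "complex set" where
  "Cx = UNIV - {0}"

text \<open>\<open>\<O>(\<complex>\<^sup>\<times>, F)\<close> with the compact-open topology, as an algebra over \<open>\<O>(\<complex>\<^sup>\<times>)\<close>.
  Its elements are extensional functions; of a scalar function only the values on \<open>\<complex>\<^sup>\<times>\<close> matter.\<close>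
definition hol_alg ::
    "(complex, 'a) top_alg \<Rightarrow> (complex \<Rightarrow> complex, complex \<Rightarrow> 'a) top_alg" where
  "hol_alg F =
    (let H = {f \<in> Cx \<rightarrow>\<^sub>E carrier F. \<forall>z\<in>Cx. \<exists>D\<in>carrier F.
                limitin (topol F) (\<lambda>w. inverse (w - z) \<odot>\<^bsub>F\<^esub> (f w \<ominus>\<^bsub>F\<^esub> f z)) D (at z)}
     in \<lparr>carrier = H,
         mult = (\<lambda>f g. \<lambda>z\<in>Cx. f z \<otimes>\<^bsub>F\<^esub> g z),
         one = (\<lambda>z\<in>Cx. \<one>\<^bsub>F\<^esub>),
         zero = (\<lambda>z\<in>Cx. \<zero>\<^bsub>F\<^esub>),
         add = (\<lambda>f g. \<lambda>z\<in>Cx. f z \<oplus>\<^bsub>F\<^esub> g z),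
         smult = (\<lambda>h f. \<lambda>z\<in>Cx. h z \<odot>\<^bsub>F\<^esub> f z),
         topol = topology_generated_by
           {{f \<in> H. f ` K \<subseteq> U} | K U. compact K \<and> K \<subseteq> Cx \<and> openin (topol F) U}\<rparr>)"

definition zeta_const :: "nat \<Rightarrow> complex \<Rightarrow> nat list \<Rightarrow> complex" where
  "zeta_const i = (\<lambda>z\<in>Cx. zeta i)"

text \<open>The scalar \<open>\<lambda>z. z\<close> is the coordinate function on \<open>\<complex>\<^sup>\<times>\<close>.\<close>
definition def_relations :: "nat \<Rightarrow> (complex, nat list \<Rightarrow> complex) top_alg
    \<Rightarrow> (complex \<Rightarrow> nat list \<Rightarrow> complex) set" where
  "def_relations n F =
    {(zeta_const i \<otimes>\<^bsub>hol_alg F\<^esub> zeta_const j)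
       \<ominus>\<^bsub>hol_alg F\<^esub> ((\<lambda>z. z) \<odot>\<^bsub>hol_alg F\<^esub> (zeta_const j \<otimes>\<^bsub>hol_alg F\<^esub> zeta_const i))
     | i j. 1 \<le> i \<and> i < j \<and> j \<le> n}"

definition deformation :: "nat \<Rightarrow> (complex, nat list \<Rightarrow> complex) top_alg
    \<Rightarrow> (complex \<Rightarrow> complex, (complex \<Rightarrow> nat list \<Rightarrow> complex) set) top_alg" where
  "deformation n F = quotient_alg (hol_alg F) (closed_ideal_gen (hol_alg F) (def_relations n F))"

definition O_def_D :: "nat \<Rightarrow> ereal
    \<Rightarrow> (complex \<Rightarrow> complex, (complex \<Rightarrow> nat list \<Rightarrow> complex) set) top_alg" where
  "O_def_D n r = deformation n (F_D n r)"

definition OT_def_D :: "nat \<Rightarrow> ereal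
    \<Rightarrow> (complex \<Rightarrow> complex, (complex \<Rightarrow> nat list \<Rightarrow> complex) set) top_alg" where
  "OT_def_D n r = deformation n (FT_D n r)"

definition O_def_B :: "nat \<Rightarrow> ereal
    \<Rightarrow> (complex \<Rightarrow> complex, (complex \<Rightarrow> nat list \<Rightarrow> complex) set) top_alg" where
  "O_def_B n r = deformation n (F_B n r)"


section \<open>Fibers and bundles\<close>

text \<open>Complex numbers act on an \<open>\<O>(\<complex>\<^sup>\<times>)\<close>-algebra as constant functions.\<close>
definition complex_alg :: "(complex \<Rightarrow> complex, 'a) top_alg \<Rightarrow> (complex, 'a) top_alg" where
  "complex_alg A =
    \<lparr>carrier = carrier A, mult = mult A, one = one A, zero = zero A, add = add A,
     smult = (\<lambda>c. smult A (\<lambda>_. c)), topol = topol A\<rparr>"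

definition max_ideal :: "complex \<Rightarrow> (complex \<Rightarrow> complex) set" where
  "max_ideal q = {f. f holomorphic_on Cx \<and> f q = 0}"

text \<open>The closure of \<open>\<mm>\<^sub>q A\<close>, the set of finite sums of products \<open>f a\<close> with \<open>f \<in> \<mm>\<^sub>q\<close>, \<open>a \<in> A\<close>.\<close>
definition fiber_ideal :: "(complex \<Rightarrow> complex, 'a) top_alg \<Rightarrow> complex \<Rightarrow> 'a set" where
  "fiber_ideal A q = topol A closure_of
     generate (add_monoid A) {f \<odot>\<^bsub>A\<^esub> a | f a. f \<in> max_ideal q \<and> a \<in> carrier A}"

definition fiber :: "(complex \<Rightarrow> complex, 'a) top_alg \<Rightarrow> complex \<Rightarrow> (complex, 'a set) top_alg" where
  "fiber A q = complex_alg (quotient_alg A (fiber_ideal A q))"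

definition fiber_class :: "(complex \<Rightarrow> complex, 'a) top_alg \<Rightarrow> complex \<Rightarrow> 'a \<Rightarrow> 'a set" where
  "fiber_class A q u = fiber_ideal A q +>\<^bsub>A\<^esub> u"

definition continuous_seminorm :: "(complex, 'a) top_alg \<Rightarrow> ('a \<Rightarrow> real) \<Rightarrow> bool" where
  "continuous_seminorm A p \<longleftrightarrow>
     (\<forall>a\<in>carrier A. \<forall>b\<in>carrier A. p (a \<oplus>\<^bsub>A\<^esub> b) \<le> p a + p b)
   \<and> (\<forall>c. \<forall>a\<in>carrier A. p (c \<odot>\<^bsub>A\<^esub> a) = cmod c * p a)
   \<and> continuous_map (topol A) euclideanreal p"

text \<open>The value of the quotient seminorm of \<open>p\<close> on a coset \<open>v\<close>.\<close>
definition quotient_seminorm :: "('a \<Rightarrow> real) \<Rightarrow> 'a set \<Rightarrow> real" where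
  "quotient_seminorm p v = (INF a\<in>v. p a)"

text \<open>A point of the total space \<open>\<Squnion>\<^sub>q A\<^sub>q\<close> is a pair \<open>(q, v)\<close> with \<open>v \<in> A\<^sub>q\<close>; the projection is \<open>fst\<close>.\<close>
definition bundle_space :: "(complex \<Rightarrow> complex, 'a) top_alg \<Rightarrow> (complex \<times> 'a set) set" where
  "bundle_space A = (SIGMA q:Cx. carrier (fiber A q))"

text \<open>The sets below form a base, so the topology generated by them consists of their unions.\<close>
definition bundle_topology :: "(complex \<Rightarrow> complex, 'a) top_alg \<Rightarrow> (complex \<times> 'a set) topology" where
  "bundle_topology A = topology_generated_by
     {{(q, v) \<in> bundle_space A. q \<in> V
          \<and> quotient_seminorm p (v \<ominus>\<^bsub>fiber A q\<^esub> fiber_class A q u) < \<epsilon>}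
      | V u \<epsilon> p. open V \<and> V \<subseteq> Cx \<and> u \<in> carrier A \<and> \<epsilon> > 0
                 \<and> continuous_seminorm (complex_alg A) p}"

definition bundle_fiber ::
    "(complex \<Rightarrow> complex, 'a) top_alg \<Rightarrow> complex \<Rightarrow> (complex, complex \<times> 'a set) top_alg" where
  "bundle_fiber A q =
    (let E = {e \<in> bundle_space A. fst e = q} in
     \<lparr>carrier = E,
      mult = (\<lambda>x y. (q, snd x \<otimes>\<^bsub>fiber A q\<^esub> snd y)),
      one = (q, \<one>\<^bsub>fiber A q\<^esub>),
      zero = (q, \<zero>\<^bsub>fiber A q\<^esub>),
      add = (\<lambda>x y. (q, snd x \<oplus>\<^bsub>fiber A q\<^esub> snd y)),
      smult = (\<lambda>c x. (q, c \<odot>\<^bsub>fiber A q\<^esub> snd x)),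
      topol = subtopology (bundle_topology A) E\<rparr>)"

end

theory Submission
  imports Defs "HOL-Library.Function_Algebras"
begin

text \<open>Evaluating an \<open>F\<close>-valued holomorphic function at \<open>q\<close> and then reordering words,
  \<open>\<zeta>\<^sub>\<alpha> \<mapsto> q\<^sup>-\<^sup>e x\<^sup>k\<close> with \<open>e\<close> the number of inversions of \<open>\<alpha>\<close> and \<open>k\<close> its letter count, is a continuous
  homomorphism onto the quantum algebra that kills the defining relations and \<open>\<mm>\<^sub>q\<close>.
  Conversely, modulo the relations, a truncation of \<open>f = \<Sum>\<^sub>\<alpha> f\<^sub>\<alpha> \<zeta>\<^sub>\<alpha>\<close> equals \<open>\<Sum>\<^sub>k h\<^sub>k \<zeta>\<^sup>k\<close> with holomorphic \<open>h\<^sub>k\<close>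
  whose value at \<open>q\<close> is the \<open>k\<close>-th coefficient of the image of \<open>f\<close>; as truncations converge uniformly on
  compact sets, the kernel is exactly the closure of \<open>\<mm>\<^sub>q A\<close>.
  The induced bijection is a homeomorphism because the evaluation has a continuous linear section:
  send \<open>x\<^sup>k\<close> to a multiple of the sorted word or of its reversal (polydisks), or to the
  \<open>\<ell>\<^sup>2\<close>-minimal preimage (ball), whose norm is given by MacMahon's inversion generating function.
  Finally, the norms of the quantum algebra pulled back to \<open>A\<close> show that the bundle topology
  on the fiber is the quotient topology.\<close>

section \<open>Graded families of seminorms\<close>

text \<open>No open mapping theorem and no explicit description of the closed ideal of relations
  enter. Of that ideal only two facts are used: it is an ideal containing the relations, and it lies
  in the kernel of evaluation. Openness comes from the section, so each of the three cases reduces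
  to two estimates, one for the reordering map and one for the section. Both maps preserve degree;
  hence norms are organised as sums over \<open>d\<close> of seminorms that see only the
  coefficients of degree \<open>d\<close>, which covers weighted l1 norms and the l2-type norm of
  the ball alike. The two free polydisk algebras have the same fibers because every monomial has a
  monotone representative word: it has at most \<open>n\<close> blocks, so the factor involving
  \<tau> is at most \<tau>^n. On the ball the quantum norm adds over all \<open>k\<close> of degree
  \<open>d\<close>, while Cauchy-Schwarz controls one \<open>k\<close> at a time; the polynomially
  many \<open>k\<close> are paid for by a slightly larger radius.\<close>

definition scal :: "complex \<Rightarrow> ('k \<Rightarrow> complex) \<Rightarrow> 'k \<Rightarrow> complex" where
  "scal c a = (\<lambda>k. c * a k)"

lemma scal_apply [simp]: "scal c a k = c * a k"
  by (simp add: scal_def)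

text \<open>The norms of the series algebras are given by \<open>infsum\<close> and
  \<open>suminf\<close>, whose values mean what is intended only on \<open>S\<close>. A subbasic
  neighbourhood evaluates its seminorm only at differences of elements of \<open>S\<close>, so
  agreement on \<open>S\<close> is enough.\<close>

lemma seminorm_topology_cong:
  assumes "\<And>p. p \<in> P \<Longrightarrow> \<exists>p'\<in>P'. \<forall>a\<in>S. p a = p' a"
    and "\<And>p. p \<in> P' \<Longrightarrow> \<exists>p'\<in>P. \<forall>a\<in>S. p a = p' a"
    and diff: "\<And>x y. x \<in> S \<Longrightarrow> y \<in> S \<Longrightarrow> x - y \<in> S"
  shows "seminorm_topology S P = seminorm_topology S P'"
proof -
  have *: "{{y \<in> S. p (\<lambda>k. y k - x k) < \<epsilon>} | p x \<epsilon>. p \<in> P \<and> x \<in> S \<and> \<epsilon> > 0}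
      \<subseteq> {{y \<in> S. p (\<lambda>k. y k - x k) < \<epsilon>} | p x \<epsilon>. p \<in> P' \<and> x \<in> S \<and> \<epsilon> > 0}"
    if PP: "\<And>p. p \<in> P \<Longrightarrow> \<exists>p'\<in>P'. \<forall>a\<in>S. p a = p' a"
    for P P' :: "(('a \<Rightarrow> complex) \<Rightarrow> real) set"
  proof clarify
    fix p x and \<epsilon> :: real assume p: "p \<in> P" "x \<in> S" "\<epsilon> > 0"
    obtain p' where p': "p' \<in> P'" "\<forall>a\<in>S. p a = p' a" using PP p(1) by blast
    have "{y \<in> S. p (\<lambda>k. y k - x k) < \<epsilon>} = {y \<in> S. p' (\<lambda>k. y k - x k) < \<epsilon>}"
      using p' p(2) diff[of _ x] by (auto simp: fun_diff_def)
    then show "\<exists>p' x' \<epsilon>'. {y \<in> S. p (\<lambda>k. y k - x k) < \<epsilon>} = {y \<in> S. p' (\<lambda>k. y k - x' k) < \<epsilon>'}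
        \<and> p' \<in> P' \<and> x' \<in> S \<and> \<epsilon>' > 0"
      using p p' by blast
  qed
  have "{{y \<in> S. p (\<lambda>k. y k - x k) < \<epsilon>} | p x \<epsilon>. p \<in> P \<and> x \<in> S \<and> \<epsilon> > 0}
      = {{y \<in> S. p (\<lambda>k. y k - x k) < \<epsilon>} | p x \<epsilon>. p \<in> P' \<and> x \<in> S \<and> \<epsilon> > 0}"
    by (rule subset_antisym; rule *) (use assms(1,2) in auto)
  then show ?thesis by (simp add: seminorm_topology_def)
qed

text \<open>The common shape of all the series algebras: the norm with index \<open>i\<close> is the
  sum over degrees \<open>d\<close> of \<open>N i d\<close>, which by \<open>N_local\<close> sees
  only the coefficients of degree \<open>d\<close>. With \<open>finite_deg\<close>, truncation by
  degree gives finitely supported approximants. \<open>N_directed\<close> makes the balls of single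
  norms a base of neighbourhoods, and \<open>N_coeff\<close> makes coefficients continuous, hence
  the topology Hausdorff.\<close>

locale graded_seminorms =
  fixes W :: "'k set" and deg :: "'k \<Rightarrow> nat" and Idx :: "'i set"
    and N :: "'i \<Rightarrow> nat \<Rightarrow> ('k \<Rightarrow> complex) \<Rightarrow> real"
  assumes finite_deg: "finite {k \<in> W. deg k = d}"
    and Idx_nonempty: "Idx \<noteq> {}"
    and N_nonneg: "i \<in> Idx \<Longrightarrow> 0 \<le> N i d a"
    and N_add: "i \<in> Idx \<Longrightarrow> N i d (a + b) \<le> N i d a + N i d b"
    and N_scal: "i \<in> Idx \<Longrightarrow> N i d (scal c a) = cmod c * N i d a"
    and N_local: "i \<in> Idx \<Longrightarrow> (\<And>k. k \<in> W \<Longrightarrow> deg k = d \<Longrightarrow> a k = b k) \<Longrightarrow> N i d a = N i d b"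
    and N_directed: "i \<in> Idx \<Longrightarrow> j \<in> Idx \<Longrightarrow>
          \<exists>l\<in>Idx. \<forall>d a. N i d a \<le> N l d a \<and> N j d a \<le> N l d a"
    and N_coeff: "k \<in> W \<Longrightarrow> \<exists>i\<in>Idx. \<exists>C. \<forall>a. cmod (a k) \<le> C * N i (deg k) a"
begin

definition S :: "('k \<Rightarrow> complex) set" where
  "S = {a. (\<forall>k. k \<notin> W \<longrightarrow> a k = 0) \<and> (\<forall>i\<in>Idx. summable (\<lambda>d. N i d a))}"

definition nrm :: "'i \<Rightarrow> ('k \<Rightarrow> complex) \<Rightarrow> real" where
  "nrm i a = (\<Sum>d. N i d a)"

definition P :: "(('k \<Rightarrow> complex) \<Rightarrow> real) set" where
  "P = nrm ` Idx"

definition T :: "('k \<Rightarrow> complex) topology" where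
  "T = seminorm_topology S P"

lemma S_supp: "a \<in> S \<Longrightarrow> k \<notin> W \<Longrightarrow> a k = 0"
  by (simp add: S_def)

lemma S_summable: "a \<in> S \<Longrightarrow> i \<in> Idx \<Longrightarrow> summable (\<lambda>d. N i d a)"
  by (simp add: S_def)

lemma N_zero: "i \<in> Idx \<Longrightarrow> N i d 0 = 0"
  using N_scal[of i d 0 0] by (simp add: scal_def zero_fun_def)

lemma S_zero: "0 \<in> S"
  by (simp add: S_def N_zero)

lemma nrm_zero: "i \<in> Idx \<Longrightarrow> nrm i 0 = 0"
  by (simp add: nrm_def N_zero)

lemma S_add: assumes "a \<in> S" "b \<in> S" shows "a + b \<in> S"
  unfolding S_def
proof (clarsimp simp: assms[THEN S_supp])
  fix i assume i: "i \<in> Idx"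
  show "summable (\<lambda>d. N i d (a + b))"
    by (rule summable_comparison_test'[of "\<lambda>d. N i d a + N i d b" 0])
      (use i assms in \<open>auto intro!: summable_add S_summable simp: N_nonneg N_add\<close>)
qed

lemma S_scal: "a \<in> S \<Longrightarrow> scal c a \<in> S"
  by (auto simp: S_def N_scal intro: summable_mult)

lemma uminus_scal: "- a = scal (-1) (a :: 'k \<Rightarrow> complex)"
  by (simp add: fun_eq_iff)

lemma S_uminus: "a \<in> S \<Longrightarrow> - a \<in> S"
  by (simp add: uminus_scal S_scal)

lemma S_diff: "a \<in> S \<Longrightarrow> b \<in> S \<Longrightarrow> a - b \<in> S"
  using S_add[of a "- b"] S_uminus by simp

lemma nrm_nonneg: "i \<in> Idx \<Longrightarrow> a \<in> S \<Longrightarrow> 0 \<le> nrm i a"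
  by (auto simp: nrm_def intro: suminf_nonneg S_summable N_nonneg)

lemma nrm_add: "i \<in> Idx \<Longrightarrow> a \<in> S \<Longrightarrow> b \<in> S \<Longrightarrow> nrm i (a + b) \<le> nrm i a + nrm i b"
  unfolding nrm_def by (subst suminf_add) (auto intro!: suminf_le summable_add S_summable S_add N_add)

lemma nrm_scal: "i \<in> Idx \<Longrightarrow> a \<in> S \<Longrightarrow> nrm i (scal c a) = cmod c * nrm i a"
  unfolding nrm_def by (simp add: N_scal suminf_mult S_summable)

lemma nrm_uminus: "i \<in> Idx \<Longrightarrow> a \<in> S \<Longrightarrow> nrm i (- a) = nrm i a"
  by (simp add: uminus_scal nrm_scal)

lemma nrm_diff_commute: "i \<in> Idx \<Longrightarrow> a \<in> S \<Longrightarrow> b \<in> S \<Longrightarrow> nrm i (a - b) = nrm i (b - a)"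
  using nrm_uminus[of i "b - a"] by (simp add: S_diff)

lemma nrm_diff_triangle:
  assumes "i \<in> Idx" "a \<in> S" "b \<in> S" "c \<in> S"
  shows "nrm i (a - c) \<le> nrm i (a - b) + nrm i (b - c)"
  using nrm_add[of i "a - b" "b - c"] assms by (simp add: S_diff)

lemma nrm_mono:
  assumes "i \<in> Idx" "l \<in> Idx" "\<And>d. N i d a \<le> N l d a" "a \<in> S"
  shows "nrm i a \<le> nrm l a"
  unfolding nrm_def by (rule suminf_le) (use assms S_summable in auto)

lemma nrm_directed:
  assumes "i \<in> Idx" "j \<in> Idx"
  obtains l where "l \<in> Idx" "\<And>a. a \<in> S \<Longrightarrow> nrm i a \<le> nrm l a" "\<And>a. a \<in> S \<Longrightarrow> nrm j a \<le> nrm l a"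
proof -
  obtain l where "l \<in> Idx" "\<forall>d a. N i d a \<le> N l d a \<and> N j d a \<le> N l d a"
    using N_directed[OF assms] by blast
  with that show ?thesis using assms by (meson nrm_mono)
qed

lemma nrm_directed_finite:
  assumes "finite J" "J \<subseteq> Idx"
  shows "\<exists>l\<in>Idx. \<forall>i\<in>J. \<forall>a\<in>S. nrm i a \<le> nrm l a"
  using assms
proof (induction J)
  case empty
  then show ?case using Idx_nonempty by auto
next
  case (insert j J)
  then obtain l where l: "l \<in> Idx" "\<forall>i\<in>J. \<forall>a\<in>S. nrm i a \<le> nrm l a" by auto
  obtain m where "m \<in> Idx" "\<And>a. a \<in> S \<Longrightarrow> nrm j a \<le> nrm m a" "\<And>a. a \<in> S \<Longrightarrow> nrm l a \<le> nrm m a"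
    using nrm_directed[of j l] insert l by auto
  then show ?case using l by (intro bexI[of _ m]) force+
qed

lemma N_le_nrm: "i \<in> Idx \<Longrightarrow> a \<in> S \<Longrightarrow> N i d a \<le> nrm i a"
  unfolding nrm_def using sum_le_suminf[of "\<lambda>d. N i d a" "{d}"] N_nonneg S_summable by simp

lemma coeff_bound:
  assumes "k \<in> W"
  obtains i C where "i \<in> Idx" "C > 0" "\<And>a. a \<in> S \<Longrightarrow> cmod (a k) \<le> C * nrm i a"
proof -
  obtain i C where i: "i \<in> Idx" "\<And>a. cmod (a k) \<le> C * N i (deg k) a"
    using N_coeff[OF assms] by auto
  \<comment> \<open>\<open>N_coeff\<close> says nothing about the sign of \<open>C\<close>; the
    constant \<open>\<bar>C\<bar> + 1\<close> is positive and can be divided by later.\<close>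
  have "cmod (a k) \<le> (\<bar>C\<bar> + 1) * nrm i a" if "a \<in> S" for a
    by (rule order.trans[OF i(2)[of a]])
      (use i that in \<open>auto intro!: mult_mono N_le_nrm N_nonneg\<close>)
  then show ?thesis using that[of i "\<bar>C\<bar> + 1"] i by auto
qed

lemma topspace_T [simp]: "topspace T = S"
proof
  show "topspace T \<subseteq> S"
    by (auto simp: T_def seminorm_topology_def)
  show "S \<subseteq> topspace T"
  proof
    fix a assume a: "a \<in> S"
    obtain i where i: "i \<in> Idx" using Idx_nonempty by auto
    have "a \<in> {y \<in> S. nrm i (\<lambda>k. y k - a k) < 1}"
      using a i nrm_zero[OF i] by (simp add: zero_fun_def)
    then show "a \<in> topspace T"
      using a i unfolding T_def seminorm_topology_def topology_generated_by_topspace P_def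
      by (intro UnionI[of "{y \<in> S. nrm i (\<lambda>k. y k - a k) < 1}"])
        (auto intro!: exI[of _ "nrm i"] exI[of _ a] exI[of _ "1::real"])
  qed
qed

lemma ball_open:
  assumes "i \<in> Idx" "x \<in> S" "\<epsilon> > 0"
  shows "openin T {y \<in> S. nrm i (y - x) < \<epsilon>}"
  unfolding T_def seminorm_topology_def
  by (rule topology_generated_by_Basis)
    (use assms in \<open>auto simp: P_def fun_diff_def intro!: exI[of _ "nrm i"] exI[of _ x] exI[of _ \<epsilon>]\<close>)

text \<open>The topology is given only by a subbase of balls with arbitrary centres. The triangle
  inequality recentres a ball at each of its points, and directedness replaces the intersection of
  two balls by a ball for one index.\<close>

lemma openin_T:
  "openin T U \<longleftrightarrow> U \<subseteq> S \<and> (\<forall>x\<in>U. \<exists>i\<in>Idx. \<exists>\<epsilon>>0. \<forall>y\<in>S. nrm i (y - x) < \<epsilon> \<longrightarrow> y \<in> U)"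
proof
  assume U: "openin T U"
  then have "generate_topology_on {{y \<in> S. p (\<lambda>k. y k - x k) < \<epsilon>} | p x \<epsilon>. p \<in> P \<and> x \<in> S \<and> \<epsilon> > 0} U"
    by (simp add: T_def seminorm_topology_def openin_topology_generated_by_iff)
  then have "\<forall>x\<in>U. \<exists>i\<in>Idx. \<exists>\<epsilon>>0. \<forall>y\<in>S. nrm i (y - x) < \<epsilon> \<longrightarrow> y \<in> U"
  proof (induction)
    case Empty
    show ?case by simp
  next
    case (Int A B)
    show ?case
    proof
      fix x assume x: "x \<in> A \<inter> B"
      obtain i \<epsilon> where i: "i \<in> Idx" "\<epsilon> > 0" "\<And>y. y \<in> S \<Longrightarrow> nrm i (y - x) < \<epsilon> \<Longrightarrow> y \<in> A"
        using Int x by blast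
      obtain j \<delta> where j: "j \<in> Idx" "\<delta> > 0" "\<And>y. y \<in> S \<Longrightarrow> nrm j (y - x) < \<delta> \<Longrightarrow> y \<in> B"
        using Int x by blast
      obtain l where l: "l \<in> Idx" "\<And>a. a \<in> S \<Longrightarrow> nrm i a \<le> nrm l a" "\<And>a. a \<in> S \<Longrightarrow> nrm j a \<le> nrm l a"
        using nrm_directed i(1) j(1) by blast
      have "x \<in> S"
        using Int(1) x openin_subset[of T A]
        by (auto simp: T_def[symmetric] seminorm_topology_def[symmetric] openin_topology_generated_by_iff[symmetric])
      then have "y \<in> A \<inter> B" if "y \<in> S" "nrm l (y - x) < min \<epsilon> \<delta>" for y
        using that i j l(2,3)[of "y - x"] by (simp add: S_diff)
      then show "\<exists>i\<in>Idx. \<exists>\<epsilon>>0. \<forall>y\<in>S. nrm i (y - x) < \<epsilon> \<longrightarrow> y \<in> A \<inter> B"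
        using l(1) i(2) j(2) by (intro bexI[of _ l] exI[of _ "min \<epsilon> \<delta>"]) auto
    qed
  next
    case (UN K)
    then show ?case by (meson UnionE UnionI)
  next
    case (Basis A)
    then obtain i z \<epsilon> where A: "i \<in> Idx" "z \<in> S" "\<epsilon> > 0" "A = {y \<in> S. nrm i (y - z) < \<epsilon>}"
      by (auto simp: P_def fun_diff_def)
    show ?case
    proof
      fix x assume x: "x \<in> A"
      have "y \<in> A" if "y \<in> S" "nrm i (y - x) < \<epsilon> - nrm i (x - z)" for y
        using that x A nrm_diff_triangle[of i y x z] by auto
      then show "\<exists>i\<in>Idx. \<exists>\<epsilon>>0. \<forall>y\<in>S. nrm i (y - x) < \<epsilon> \<longrightarrow> y \<in> A"
        using A x by (intro bexI[of _ i] exI[of _ "\<epsilon> - nrm i (x - z)"]) auto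
    qed
  qed
  moreover have "U \<subseteq> S" using openin_subset[OF U] by simp
  ultimately show "U \<subseteq> S \<and> (\<forall>x\<in>U. \<exists>i\<in>Idx. \<exists>\<epsilon>>0. \<forall>y\<in>S. nrm i (y - x) < \<epsilon> \<longrightarrow> y \<in> U)"
    by blast
next
  assume U: "U \<subseteq> S \<and> (\<forall>x\<in>U. \<exists>i\<in>Idx. \<exists>\<epsilon>>0. \<forall>y\<in>S. nrm i (y - x) < \<epsilon> \<longrightarrow> y \<in> U)"
  show "openin T U"
  proof (subst openin_subopen, intro ballI)
    fix x assume x: "x \<in> U"
    then obtain i \<epsilon> where i: "i \<in> Idx" "\<epsilon> > 0" "\<And>y. y \<in> S \<Longrightarrow> nrm i (y - x) < \<epsilon> \<Longrightarrow> y \<in> U"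
      using U by blast
    have "x \<in> S" using x U by auto
    then show "\<exists>V. openin T V \<and> x \<in> V \<and> V \<subseteq> U"
      using i ball_open[of i x \<epsilon>] nrm_zero[of i] by (intro exI[of _ "{y \<in> S. nrm i (y - x) < \<epsilon>}"]) auto
  qed
qed

lemma limitin_T:
  "limitin T f l F \<longleftrightarrow> l \<in> S \<and> eventually (\<lambda>w. f w \<in> S) F \<and> (\<forall>i\<in>Idx. ((\<lambda>w. nrm i (f w - l)) \<longlongrightarrow> 0) F)"
proof
  assume L: "limitin T f l F"
  then have l: "l \<in> S" by (auto simp: limitin_def)
  have ev: "eventually (\<lambda>w. f w \<in> S) F"
    using L openin_topspace[of T] by (auto simp: limitin_def)
  moreover have "((\<lambda>w. nrm i (f w - l)) \<longlongrightarrow> 0) F" if i: "i \<in> Idx" for i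
  proof (rule tendstoI)
    fix e :: real assume e: "e > 0"
    have "eventually (\<lambda>w. f w \<in> {y \<in> S. nrm i (y - l) < e}) F"
      using L ball_open[OF i l e] e l i nrm_zero[OF i] by (auto simp: limitin_def)
    then show "eventually (\<lambda>w. dist (nrm i (f w - l)) 0 < e) F"
      by eventually_elim (use l i in \<open>auto simp: nrm_nonneg S_diff\<close>)
  qed
  ultimately show "l \<in> S \<and> eventually (\<lambda>w. f w \<in> S) F \<and> (\<forall>i\<in>Idx. ((\<lambda>w. nrm i (f w - l)) \<longlongrightarrow> 0) F)"
    using l by blast
next
  assume R: "l \<in> S \<and> eventually (\<lambda>w. f w \<in> S) F \<and> (\<forall>i\<in>Idx. ((\<lambda>w. nrm i (f w - l)) \<longlongrightarrow> 0) F)"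
  show "limitin T f l F"
    unfolding limitin_def topspace_T
  proof (intro conjI allI impI)
    fix U assume U: "openin T U \<and> l \<in> U"
    then obtain i \<epsilon> where i: "i \<in> Idx" "\<epsilon> > 0" "\<And>y. y \<in> S \<Longrightarrow> nrm i (y - l) < \<epsilon> \<Longrightarrow> y \<in> U"
      unfolding openin_T by blast
    have "eventually (\<lambda>w. nrm i (f w - l) < \<epsilon>) F"
      using R i order_tendstoD(2)[of "\<lambda>w. nrm i (f w - l)" 0 F \<epsilon>] by auto
    moreover have "eventually (\<lambda>w. f w \<in> S) F" using R by blast
    ultimately show "eventually (\<lambda>w. f w \<in> U) F"
      by eventually_elim (use i in auto)
  qed (use R in auto)
qed

section \<open>Truncation by degree\<close>

definition trunc :: "nat \<Rightarrow> ('k \<Rightarrow> complex) \<Rightarrow> 'k \<Rightarrow> complex" where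
  "trunc m a = (\<lambda>k. if k \<in> W \<and> deg k \<le> m then a k else 0)"

lemma finite_deg_le: "finite {k \<in> W. deg k \<le> m}"
proof -
  have "{k \<in> W. deg k \<le> m} = (\<Union>d\<le>m. {k \<in> W. deg k = d})" by auto
  then show ?thesis using finite_deg by simp
qed

lemma finite_support_S:
  assumes "finite {k. a k \<noteq> 0}" "{k. a k \<noteq> 0} \<subseteq> W"
  shows "a \<in> S"
  unfolding S_def
proof (clarsimp, intro conjI allI impI ballI)
  show "a k = 0" if "k \<notin> W" for k using assms that by blast
  fix i assume i: "i \<in> Idx"
  have "N i d a = 0" if "d \<notin> deg ` {k. a k \<noteq> 0}" for d
    using N_local[OF i, of d a 0] N_zero[OF i] that by force
  then show "summable (\<lambda>d. N i d a)"
    using assms by (intro summable_finite[of "deg ` {k. a k \<noteq> 0}"]) auto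
qed

lemma trunc_in_S: "trunc m a \<in> S"
  by (rule finite_support_S) (auto simp: trunc_def intro: finite_subset[OF _ finite_deg_le[of m]] split: if_splits)

lemma N_trunc: "i \<in> Idx \<Longrightarrow> N i d (trunc m a) = (if d \<le> m then N i d a else 0)"
  using N_local[of i d "trunc m a" a] N_local[of i d "trunc m a" 0] N_zero[of i d]
  by (auto simp: trunc_def)

lemma N_diff_trunc: "i \<in> Idx \<Longrightarrow> N i d (trunc m a - a) = (if d \<le> m then 0 else N i d a)"
proof -
  assume i: "i \<in> Idx"
  have "N i d (trunc m a - a) = N i d (scal (-1) a)" if "\<not> d \<le> m"
    by (rule N_local) (use i that in \<open>auto simp: trunc_def\<close>)
  moreover have "N i d (trunc m a - a) = N i d 0" if "d \<le> m"
    by (rule N_local) (use i that in \<open>auto simp: trunc_def\<close>)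
  ultimately show ?thesis using i by (simp add: N_scal N_zero)
qed

lemma nrm_trunc_le: "i \<in> Idx \<Longrightarrow> a \<in> S \<Longrightarrow> nrm i (trunc m a) \<le> nrm i a"
  unfolding nrm_def by (rule suminf_le) (auto simp: N_trunc N_nonneg S_summable trunc_in_S)

text \<open>By \<open>N_local\<close> the difference has no part of degree at most \<open>m\<close>
  and otherwise the parts of \<open>a\<close> up to sign, so its norm is a tail of a convergent
  series.\<close>

lemma nrm_trunc_tendsto:
  assumes i: "i \<in> Idx" and a: "a \<in> S"
  shows "(\<lambda>m. nrm i (trunc m a - a)) \<longlonglongrightarrow> 0"
proof -
  have s: "summable (\<lambda>d. N i d a)" using S_summable i a by blast
  have "nrm i (trunc m a - a) = (\<Sum>d. N i (d + Suc m) a)" for m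
  proof -
    have "summable (\<lambda>d. N i d (trunc m a - a))"
      using S_summable[OF S_diff[OF trunc_in_S a] i] .
    from suminf_split_initial_segment[OF this, of "Suc m"]
    have "nrm i (trunc m a - a) = (\<Sum>d. N i (d + Suc m) (trunc m a - a)) + (\<Sum>d<Suc m. N i d (trunc m a - a))"
      by (simp add: nrm_def)
    also have "\<dots> = (\<Sum>d. N i (d + Suc m) a)" by (simp add: N_diff_trunc i del: sum.lessThan_Suc)
    finally show ?thesis .
  qed
  then show ?thesis
    using LIMSEQ_Suc[OF suminf_exist_split2[OF s]] by simp
qed

lemma trunc_diff: "trunc m (a - b) = trunc m a - trunc m b"
  by (auto simp: trunc_def fun_eq_iff)

end

section \<open>Free algebras and holomorphic functions with values in them\<close>

definition conv :: "(nat list \<Rightarrow> complex) \<Rightarrow> (nat list \<Rightarrow> complex) \<Rightarrow> nat list \<Rightarrow> complex" where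
  "conv a b = (\<lambda>\<alpha>. \<Sum>m\<le>length \<alpha>. a (take m \<alpha>) * b (drop m \<alpha>))"

definition word_ind :: "nat list \<Rightarrow> nat list \<Rightarrow> complex" where
  "word_ind \<alpha> = (\<lambda>\<beta>. if \<beta> = \<alpha> then 1 else 0)"

lemma conv_add_left: "conv (a + b) c = conv a c + conv b c"
  by (simp add: conv_def fun_eq_iff algebra_simps sum.distrib)

lemma conv_add_right: "conv a (b + c) = conv a b + conv a c"
  by (simp add: conv_def fun_eq_iff algebra_simps sum.distrib)

lemma conv_scal_left: "conv (scal c a) b = scal c (conv a b)"
  by (simp add: conv_def fun_eq_iff sum_distrib_left mult_ac)

lemma conv_scal_right: "conv a (scal c b) = scal c (conv a b)"
  by (simp add: conv_def fun_eq_iff sum_distrib_left mult_ac)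

lemma conv_diff_left: "conv (a - b) c = conv a c - conv b c"
  by (simp add: conv_def fun_eq_iff algebra_simps sum_subtractf)

lemma conv_diff_right: "conv a (b - c) = conv a b - conv a c"
  by (simp add: conv_def fun_eq_iff algebra_simps sum_subtractf)

lemma conv_word_ind: "conv (word_ind \<alpha>) (word_ind \<beta>) = word_ind (\<alpha> @ \<beta>)"
proof
  fix \<gamma>
  have *: "take m \<gamma> = \<alpha> \<and> drop m \<gamma> = \<beta> \<longleftrightarrow> m = length \<alpha> \<and> \<gamma> = \<alpha> @ \<beta>" if "m \<le> length \<gamma>" for m
    using that append_take_drop_id[of m \<gamma>] by auto
  have "conv (word_ind \<alpha>) (word_ind \<beta>) \<gamma>
      = (\<Sum>m\<le>length \<gamma>. if take m \<gamma> = \<alpha> \<and> drop m \<gamma> = \<beta> then 1 else 0)"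
    unfolding conv_def by (intro sum.cong) (auto simp: word_ind_def)
  also have "\<dots>
      = (\<Sum>m\<le>length \<gamma>. if m = length \<alpha> then (if \<gamma> = \<alpha> @ \<beta> then 1 else 0) else 0)"
    by (intro sum.cong) (auto simp: *)
  also have "\<dots> = word_ind (\<alpha> @ \<beta>) \<gamma>"
    by (auto simp: word_ind_def)
  finally show "conv (word_ind \<alpha>) (word_ind \<beta>) \<gamma> = word_ind (\<alpha> @ \<beta>) \<gamma>" .
qed

lemma conv_one_left: "conv (word_ind []) a = a"
proof
  fix \<gamma>
  have "conv (word_ind []) a \<gamma> = (\<Sum>m\<le>length \<gamma>. if m = 0 then a \<gamma> else 0)"
    unfolding conv_def by (intro sum.cong) (auto simp: word_ind_def)
  then show "conv (word_ind []) a \<gamma> = a \<gamma>" by simp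
qed

lemma conv_one_right: "conv a (word_ind []) = a"
proof
  fix \<gamma>
  have "conv a (word_ind []) \<gamma> = (\<Sum>m\<le>length \<gamma>. if m = length \<gamma> then a \<gamma> else 0)"
    unfolding conv_def by (intro sum.cong) (auto simp: word_ind_def)
  then show "conv a (word_ind []) \<gamma> = a \<gamma>" by simp
qed

text \<open>Both sides sum over the cuts of \<open>\<alpha>\<close> into three consecutive pieces;
  the change of summation order is the one behind associativity for power series in one
  variable.\<close>

lemma conv_assoc: "conv (conv a b) c = conv a (conv b c)"
proof
  fix \<alpha> :: "nat list"
  let ?L = "length \<alpha>"
  define f where "f = (\<lambda>i j (k::nat). a (take i \<alpha>) * b (take j (drop i \<alpha>)) * c (drop (i + j) \<alpha>))"
  have "conv (conv a b) c \<alpha> = (\<Sum>m=0..?L. \<Sum>i=0..m. f i (m - i) (?L - m))"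
    unfolding conv_def f_def atMost_atLeast0 sum_distrib_right
    by (intro sum.cong) (auto simp: drop_take min_def)
  also have "\<dots> = (\<Sum>i=0..?L. \<Sum>j=0..?L - i. f i j (?L - i - j))"
    by (rule fps_mult_assoc_lemma)
  also have "\<dots> = conv a (conv b c) \<alpha>"
    unfolding conv_def f_def atMost_atLeast0 sum_distrib_left
    by (intro sum.cong) (auto simp: mult_ac add.commute)
  finally show "conv (conv a b) c \<alpha> = conv a (conv b c) \<alpha>" .
qed

lemma words_take: "\<alpha> \<in> words n \<Longrightarrow> take m \<alpha> \<in> words n"
  by (auto simp: words_def dest: in_set_takeD)

lemma words_drop: "\<alpha> \<in> words n \<Longrightarrow> drop m \<alpha> \<in> words n"
  by (auto simp: words_def dest: in_set_dropD)

lemma words_Nil [simp]: "[] \<in> words n"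
  by (simp add: words_def)

lemma words_append [simp]: "\<alpha> @ \<beta> \<in> words n \<longleftrightarrow> \<alpha> \<in> words n \<and> \<beta> \<in> words n"
  by (auto simp: words_def)

text \<open>\<open>N_conv\<close> is submultiplicativity in graded form: its right side is a term of
  a Cauchy product, so summation over \<open>d\<close> makes each norm submultiplicative.\<close>

locale graded_free_alg = graded_seminorms "words n" length Idx N
  for n :: nat and Idx :: "'i set" and N +
  assumes N_conv: "i \<in> Idx \<Longrightarrow> N i d (conv a b) \<le> (\<Sum>m\<le>d. N i m a * N i (d - m) b)"
begin

definition F :: "(complex, nat list \<Rightarrow> complex) top_alg" where
  "F = free_alg S P"

lemma F_simps [simp]:
  "carrier F = S" "mult F = conv" "one F = word_ind []" "zero F = 0" "add F = (+)"
  "smult F = scal" "topol F = T"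
  by (simp_all add: F_def free_alg_def conv_def word_ind_def zero_fun_def plus_fun_def scal_def T_def fun_eq_iff)

lemma conv_in_S: assumes a: "a \<in> S" and b: "b \<in> S" shows "conv a b \<in> S"
  unfolding S_def
proof (clarsimp, intro conjI allI impI ballI)
  fix \<alpha> assume "\<alpha> \<notin> words n"
  then have "take m \<alpha> \<notin> words n \<or> drop m \<alpha> \<notin> words n" for m
    using words_append[of "take m \<alpha>" "drop m \<alpha>" n] by simp
  then show "conv a b \<alpha> = 0"
    unfolding conv_def by (intro sum.neutral ballI) (metis S_supp[OF a] S_supp[OF b] mult_eq_0_iff)
next
  fix i assume i: "i \<in> Idx"
  have "summable (\<lambda>d. \<Sum>m\<le>d. N i m a * N i (d - m) b)"
    by (rule summable_Cauchy_product) (use a b i N_nonneg S_summable in \<open>simp_all\<close>)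
  then show "summable (\<lambda>d. N i d (conv a b))"
    by (rule summable_comparison_test'[of _ 0]) (simp add: N_nonneg N_conv i)
qed

lemma nrm_conv:
  assumes i: "i \<in> Idx" and a: "a \<in> S" and b: "b \<in> S"
  shows "nrm i (conv a b) \<le> nrm i a * nrm i b"
proof -
  have s: "summable (\<lambda>d. \<Sum>m\<le>d. N i m a * N i (d - m) b)"
    by (rule summable_Cauchy_product) (use a b i N_nonneg S_summable in \<open>simp_all\<close>)
  have "nrm i (conv a b) \<le> (\<Sum>d. \<Sum>m\<le>d. N i m a * N i (d - m) b)"
    unfolding nrm_def by (rule suminf_le) (use N_conv i s conv_in_S a b S_summable in auto)
  also have "\<dots> = nrm i a * nrm i b"
    unfolding nrm_def by (rule Cauchy_product[symmetric]) (use a b i N_nonneg S_summable in \<open>simp_all\<close>)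
  finally show ?thesis .
qed

lemma word_ind_in_S: "\<alpha> \<in> words n \<Longrightarrow> word_ind \<alpha> \<in> S"
  by (rule finite_support_S) (auto simp: word_ind_def)

lemma ring_F: "ring F"
proof (rule ringI)
  show "abelian_group F"
  proof (rule abelian_groupI)
    fix x assume "x \<in> carrier F"
    then show "\<exists>y\<in>carrier F. y \<oplus>\<^bsub>F\<^esub> x = \<zero>\<^bsub>F\<^esub>"
      by (intro bexI[of _ "- x"]) (auto simp: S_uminus)
  qed (auto simp: S_add S_zero add_ac)
  show "Group.monoid F"
    by (rule monoidI) (auto simp: conv_in_S conv_assoc conv_one_left conv_one_right intro!: word_ind_in_S)
qed (auto simp: conv_add_left conv_add_right)

sublocale FR: ring F
  by (rule ring_F)

lemma F_uminus: "a \<in> S \<Longrightarrow> \<ominus>\<^bsub>F\<^esub> a = - a"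
  using FR.minus_equality[of "- a" a] by (simp add: S_uminus)

lemma F_minus: "a \<in> S \<Longrightarrow> b \<in> S \<Longrightarrow> a \<ominus>\<^bsub>F\<^esub> b = a - b"
  by (simp add: a_minus_def F_uminus)

section \<open>The ring of holomorphic functions with values in the free algebra\<close>

definition quot :: "(complex \<Rightarrow> nat list \<Rightarrow> complex) \<Rightarrow> complex \<Rightarrow> complex \<Rightarrow> nat list \<Rightarrow> complex" where
  "quot f z w = scal (inverse (w - z)) (f w - f z)"

definition hderiv :: "(complex \<Rightarrow> nat list \<Rightarrow> complex) \<Rightarrow> complex \<Rightarrow> (nat list \<Rightarrow> complex) \<Rightarrow> bool" where
  "hderiv f z D \<longleftrightarrow> D \<in> S \<and> (\<forall>i\<in>Idx. ((\<lambda>w. nrm i (quot f z w - D)) \<longlongrightarrow> 0) (at z))"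

definition H :: "(complex \<Rightarrow> nat list \<Rightarrow> complex) set" where
  "H = {f \<in> Cx \<rightarrow>\<^sub>E S. \<forall>z\<in>Cx. \<exists>D. hderiv f z D}"

abbreviation A0 :: "(complex \<Rightarrow> complex, complex \<Rightarrow> nat list \<Rightarrow> complex) top_alg" where
  "A0 \<equiv> hol_alg F"

lemma open_Cx: "open Cx"
  by (simp add: Cx_def open_Diff)

lemma eventually_Cx: "z \<in> Cx \<Longrightarrow> eventually (\<lambda>w. w \<in> Cx) (at z)"
  by (rule eventually_at_in_open') (auto simp: open_Cx)

text \<open>Near \<open>z\<close> only points of \<open>Cx\<close> matter, and there the ring
  operations of \<open>F\<close> are the pointwise ones on coefficient functions. From here on
  derivatives are handled by norms alone.\<close>

lemma limitin_quot_iff: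
  assumes f: "f \<in> Cx \<rightarrow>\<^sub>E S" and z: "z \<in> Cx"
  shows "limitin T (\<lambda>w. inverse (w - z) \<odot>\<^bsub>F\<^esub> (f w \<ominus>\<^bsub>F\<^esub> f z)) D (at z) \<longleftrightarrow> hderiv f z D"
proof -
  have eq: "eventually (\<lambda>w. inverse (w - z) \<odot>\<^bsub>F\<^esub> (f w \<ominus>\<^bsub>F\<^esub> f z) = quot f z w) (at z)"
    using eventually_Cx[OF z] by eventually_elim (simp add: quot_def F_minus PiE_mem[OF f] z)
  have "eventually (\<lambda>w. quot f z w \<in> S) (at z)"
    using eventually_Cx[OF z]
    by eventually_elim (auto simp: quot_def PiE_mem[OF f] z intro!: S_scal S_diff)
  moreover have "limitin T (\<lambda>w. inverse (w - z) \<odot>\<^bsub>F\<^esub> (f w \<ominus>\<^bsub>F\<^esub> f z)) D (at z) \<longleftrightarrow> limitin T (quot f z) D (at z)"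
    by (rule iffI; erule limitin_transform_eventually[rotated]) (use eq in \<open>simp_all add: eq_commute\<close>)
  ultimately show ?thesis by (simp add: limitin_T hderiv_def)
qed

lemma hol_alg_simps [simp]:
  "carrier A0 = H" "mult A0 = (\<lambda>f g. \<lambda>z\<in>Cx. conv (f z) (g z))" "one A0 = (\<lambda>z\<in>Cx. word_ind [])"
  "zero A0 = (\<lambda>z\<in>Cx. 0)" "add A0 = (\<lambda>f g. \<lambda>z\<in>Cx. f z + g z)"
  "smult A0 = (\<lambda>h f. \<lambda>z\<in>Cx. scal (h z) (f z))"
proof -
  have "(\<exists>D\<in>S. limitin T (\<lambda>w. inverse (w - z) \<odot>\<^bsub>F\<^esub> (f w \<ominus>\<^bsub>F\<^esub> f z)) D (at z)) \<longleftrightarrow> (\<exists>D. hderiv f z D)"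
    if "f \<in> Cx \<rightarrow>\<^sub>E S" "z \<in> Cx" for f z
    unfolding limitin_quot_iff[OF that] by (auto simp: hderiv_def)
  then show "carrier A0 = H" by (auto simp: hol_alg_def Let_def H_def)
qed (simp_all add: hol_alg_def Let_def)

lemma topol_A0: "topol A0 = topology_generated_by
           {{f \<in> H. f ` K \<subseteq> U} | K U. compact K \<and> K \<subseteq> Cx \<and> openin T U}"
  using hol_alg_simps(1) by (simp add: hol_alg_def Let_def)

lemma H_S: "f \<in> H \<Longrightarrow> z \<in> Cx \<Longrightarrow> f z \<in> S"
  by (auto simp: H_def)

lemma H_ext: "f \<in> H \<Longrightarrow> f \<in> extensional Cx"
  by (auto simp: H_def PiE_def)

lemma H_eqI: "f \<in> H \<Longrightarrow> g \<in> H \<Longrightarrow> (\<And>z. z \<in> Cx \<Longrightarrow> f z = g z) \<Longrightarrow> f = g"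
  by (meson H_ext extensionalityI)

lemma hderiv_cong: 
  assumes "hderiv f z D" "z \<in> Cx" "\<And>w. w \<in> Cx \<Longrightarrow> f w = g w"
  shows "hderiv g z D"
  unfolding hderiv_def
proof (intro conjI ballI)
  show "D \<in> S" using assms(1) by (simp add: hderiv_def)
  fix i assume "i \<in> Idx"
  then have "((\<lambda>w. nrm i (quot f z w - D)) \<longlongrightarrow> 0) (at z)" using assms(1) by (simp add: hderiv_def)
  moreover have "eventually (\<lambda>w. nrm i (quot f z w - D) = nrm i (quot g z w - D)) (at z)"
    using eventually_Cx[OF assms(2)] by eventually_elim (simp add: quot_def assms)
  ultimately show "((\<lambda>w. nrm i (quot g z w - D)) \<longlongrightarrow> 0) (at z)" by (rule Lim_transform_eventually)
qed

lemma H_I: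
  assumes "\<And>z. z \<in> Cx \<Longrightarrow> f z \<in> S" "\<And>z. z \<in> Cx \<Longrightarrow> \<exists>D. hderiv f z D"
  shows "restrict f Cx \<in> H"
proof -
  have "\<exists>D. hderiv (restrict f Cx) z D" if z: "z \<in> Cx" for z
  proof -
    obtain D where D: "hderiv f z D" using assms(2)[OF z] by blast
    have "hderiv (restrict f Cx) z D" by (rule hderiv_cong[OF D z]) simp
    then show ?thesis by blast
  qed
  then show ?thesis using assms(1) by (auto simp: H_def)
qed

lemma squeeze0:
  fixes g :: "'b \<Rightarrow> real"
  assumes "eventually (\<lambda>w. 0 \<le> f w) A" "eventually (\<lambda>w. f w \<le> g w) A" "(g \<longlongrightarrow> 0) A"
  shows "(f \<longlongrightarrow> 0) A"
  using assms tendsto_sandwich[of "\<lambda>_. 0" f A g 0] by simp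

lemma quot_in_S:
  assumes "\<And>w. w \<in> Cx \<Longrightarrow> f w \<in> S" "z \<in> Cx" "w \<in> Cx"
  shows "quot f z w \<in> S"
  using assms by (auto simp: quot_def intro!: S_scal S_diff)

lemma hderiv_continuous:
  assumes f: "\<And>w. w \<in> Cx \<Longrightarrow> f w \<in> S" and z: "z \<in> Cx" and D: "hderiv f z D" and i: "i \<in> Idx"
  shows "((\<lambda>w. nrm i (f w - f z)) \<longlongrightarrow> 0) (at z)"
proof (rule squeeze0)
  have DS: "D \<in> S" using D by (simp add: hderiv_def)
  show "eventually (\<lambda>w. 0 \<le> nrm i (f w - f z)) (at z)"
    using eventually_Cx[OF z] by eventually_elim (use f z i in \<open>auto intro!: nrm_nonneg S_diff\<close>)
  have "eventually (\<lambda>w. w \<noteq> z) (at z)" by (simp add: eventually_at_filter)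
  with eventually_Cx[OF z]
  show "eventually (\<lambda>w. nrm i (f w - f z) \<le> cmod (w - z) * (nrm i (quot f z w - D) + nrm i D)) (at z)"
  proof eventually_elim
    case (elim w)
    have q: "quot f z w \<in> S" by (rule quot_in_S) (use f z elim in auto)
    have "f w - f z = scal (w - z) (quot f z w)"
      using elim by (simp add: quot_def fun_eq_iff)
    then have "nrm i (f w - f z) = cmod (w - z) * nrm i (quot f z w)"
      using i q by (simp add: nrm_scal)
    also have "\<dots> \<le> cmod (w - z) * (nrm i (quot f z w - D) + nrm i D)"
      using nrm_add[of i "quot f z w - D" D] i q DS by (intro mult_left_mono) (auto simp: S_diff)
    finally show ?case .
  qed
  have "((\<lambda>w. nrm i (quot f z w - D)) \<longlongrightarrow> 0) (at z)" using D i by (simp add: hderiv_def)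
  then show "((\<lambda>w. cmod (w - z) * (nrm i (quot f z w - D) + nrm i D)) \<longlongrightarrow> 0) (at z)"
    by (auto intro!: tendsto_eq_intros)
qed

lemma hderiv_add:
  assumes f: "\<And>w. w \<in> Cx \<Longrightarrow> f w \<in> S" and g: "\<And>w. w \<in> Cx \<Longrightarrow> g w \<in> S" and z: "z \<in> Cx"
    and D: "hderiv f z D" and E: "hderiv g z E"
  shows "hderiv (\<lambda>w. f w + g w) z (D + E)"
  unfolding hderiv_def
proof (intro conjI ballI)
  have S: "D \<in> S" "E \<in> S" using D E by (auto simp: hderiv_def)
  then show "D + E \<in> S" by (rule S_add)
  fix i assume i: "i \<in> Idx"
  show "((\<lambda>w. nrm i (quot (\<lambda>w. f w + g w) z w - (D + E))) \<longlongrightarrow> 0) (at z)"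
  proof (rule squeeze0)
    have q: "quot (\<lambda>w. f w + g w) z w - (D + E) = (quot f z w - D) + (quot g z w - E)" for w
      by (simp add: quot_def fun_eq_iff algebra_simps)
    show "eventually (\<lambda>w. 0 \<le> nrm i (quot (\<lambda>w. f w + g w) z w - (D + E))) (at z)"
      using eventually_Cx[OF z] unfolding q
      by eventually_elim (use f g z i S in \<open>auto intro!: nrm_nonneg S_add S_diff quot_in_S\<close>)
    show "eventually (\<lambda>w. nrm i (quot (\<lambda>w. f w + g w) z w - (D + E))
        \<le> nrm i (quot f z w - D) + nrm i (quot g z w - E)) (at z)"
      using eventually_Cx[OF z] unfolding q
      by eventually_elim (use f g z i S in \<open>auto intro!: nrm_add S_diff quot_in_S\<close>)
    show "((\<lambda>w. nrm i (quot f z w - D) + nrm i (quot g z w - E)) \<longlongrightarrow> 0) (at z)"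
      using D E i by (auto simp: hderiv_def intro!: tendsto_eq_intros)
  qed
qed

lemma hderiv_mult:
  assumes f: "\<And>w. w \<in> Cx \<Longrightarrow> f w \<in> S" and g: "\<And>w. w \<in> Cx \<Longrightarrow> g w \<in> S" and z: "z \<in> Cx"
    and D: "hderiv f z D" and E: "hderiv g z E"
  shows "hderiv (\<lambda>w. conv (f w) (g w)) z (conv D (g z) + conv (f z) E)"
  unfolding hderiv_def
proof (intro conjI ballI)
  have S: "D \<in> S" "E \<in> S" using D E by (auto simp: hderiv_def)
  note Ss = S f[OF z] g[OF z]
  then show "conv D (g z) + conv (f z) E \<in> S" by (intro S_add conv_in_S)
  fix i assume i: "i \<in> Idx"
  let ?q = "\<lambda>w. quot (\<lambda>w. conv (f w) (g w)) z w - (conv D (g z) + conv (f z) E)"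
  \<comment> \<open>The norm of \<open>g w\<close> is bounded by that of \<open>g w - g z\<close>
    plus that of \<open>g z\<close>, so that every summand of the bound has a factor tending to
    0.\<close>
  let ?r = "\<lambda>w. nrm i (quot f z w - D) * (nrm i (g w - g z) + nrm i (g z))
      + nrm i D * nrm i (g w - g z) + nrm i (f z) * nrm i (quot g z w - E)"
  have q: "?q w = conv (quot f z w - D) (g w) + conv D (g w - g z) + conv (f z) (quot g z w - E)" for w
    by (simp add: quot_def conv_diff_left conv_diff_right conv_scal_left conv_scal_right fun_eq_iff algebra_simps)
  show "((\<lambda>w. nrm i (?q w)) \<longlongrightarrow> 0) (at z)"
  proof (rule squeeze0)
    show "eventually (\<lambda>w. 0 \<le> nrm i (?q w)) (at z)"
      using eventually_Cx[OF z] unfolding q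
      by eventually_elim (use f g z i S in \<open>auto intro!: nrm_nonneg S_add S_diff quot_in_S conv_in_S\<close>)
    show "eventually (\<lambda>w. nrm i (?q w) \<le> ?r w) (at z)"
      using eventually_Cx[OF z]
    proof eventually_elim
      case (elim w)
      have qf: "quot f z w - D \<in> S" and qg: "quot g z w - E \<in> S" and gd: "g w - g z \<in> S"
        using f g z elim S by (auto intro!: S_diff quot_in_S)
      have "nrm i (?q w) \<le> nrm i (conv (quot f z w - D) (g w)) + nrm i (conv D (g w - g z))
          + nrm i (conv (f z) (quot g z w - E))"
        unfolding q using qf qg gd g[OF elim] Ss i
        by (intro order.trans[OF nrm_add] add_right_mono nrm_add) (auto intro: conv_in_S S_add)
      moreover have "nrm i (conv (quot f z w - D) (g w)) \<le> nrm i (quot f z w - D) * (nrm i (g w - g z) + nrm i (g z))"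
        by (rule order.trans[OF nrm_conv[OF i qf g[OF elim]]], rule mult_left_mono)
          (use nrm_add[OF i gd g[OF z]] nrm_nonneg[OF i qf] in auto)
      moreover note nrm_conv[OF i S(1) gd] nrm_conv[OF i f[OF z] qg]
      ultimately show ?case by linarith
    qed
    show "(?r \<longlongrightarrow> 0) (at z)"
    proof -
      have "(?r \<longlongrightarrow> 0 * (0 + nrm i (g z)) + nrm i D * 0 + nrm i (f z) * 0) (at z)"
        using hderiv_continuous[OF g z E i] D E i
        by (intro tendsto_intros) (auto simp: hderiv_def)
      then show ?thesis by simp
    qed
  qed
qed

lemma hol_scalar_in_H:
  assumes h: "h holomorphic_on Cx" and e: "e \<in> S"
  shows "(\<lambda>z\<in>Cx. scal (h z) e) \<in> H"
proof (rule H_I)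
  show "scal (h z) e \<in> S" for z using e by (rule S_scal)
  fix z assume z: "z \<in> Cx"
  obtain h' where h': "(h has_field_derivative h') (at z)"
    using h open_Cx z by (meson holomorphic_on_open DERIV_deriv_iff_field_differentiable holomorphic_on_imp_differentiable_at)
  have "hderiv (\<lambda>z. scal (h z) e) z (scal h' e)"
    unfolding hderiv_def
  proof (intro conjI ballI)
    show "scal h' e \<in> S" using e by (rule S_scal)
    fix i assume i: "i \<in> Idx"
    have q: "quot (\<lambda>z. scal (h z) e) z w - scal h' e = scal ((h w - h z) / (w - z) - h') e" for w
      by (simp add: quot_def fun_eq_iff field_simps)
    have "((\<lambda>w. (h w - h z) / (w - z) - h') \<longlongrightarrow> 0) (at z)"
      using h'[unfolded has_field_derivative_iff] by (simp add: LIM_zero)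
    then have "((\<lambda>w. cmod ((h w - h z) / (w - z) - h') * nrm i e) \<longlongrightarrow> 0) (at z)"
      by (auto intro!: tendsto_mult_left_zero tendsto_norm_zero)
    then show "((\<lambda>w. nrm i (quot (\<lambda>z. scal (h z) e) z w - scal h' e)) \<longlongrightarrow> 0) (at z)"
      unfolding q using i e by (simp add: nrm_scal)
  qed
  then show "\<exists>D. hderiv (\<lambda>z. scal (h z) e) z D" by blast
qed

lemma const_in_H: "e \<in> S \<Longrightarrow> (\<lambda>z\<in>Cx. e) \<in> H"
  using hol_scalar_in_H[of "\<lambda>_. 1" e] by (simp add: scal_def)

lemma H_hderiv: "f \<in> H \<Longrightarrow> z \<in> Cx \<Longrightarrow> \<exists>D. hderiv f z D"
  by (simp add: H_def)

lemma H_add: assumes "f \<in> H" "g \<in> H" shows "(\<lambda>z\<in>Cx. f z + g z) \<in> H"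
proof (rule H_I)
  fix z assume z: "z \<in> Cx"
  show "f z + g z \<in> S" using assms z by (simp add: H_S S_add)
  obtain D E where "hderiv f z D" "hderiv g z E"
    using H_hderiv[OF assms(1) z] H_hderiv[OF assms(2) z] by blast
  then have "hderiv (\<lambda>z. f z + g z) z (D + E)"
    by (intro hderiv_add z H_S assms)
  then show "\<exists>D. hderiv (\<lambda>z. f z + g z) z D" by blast
qed

lemma H_mult: assumes "f \<in> H" "g \<in> H" shows "(\<lambda>z\<in>Cx. conv (f z) (g z)) \<in> H"
proof (rule H_I)
  fix z assume z: "z \<in> Cx"
  show "conv (f z) (g z) \<in> S" using assms z by (simp add: H_S conv_in_S)
  obtain D E where "hderiv f z D" "hderiv g z E"
    using H_hderiv[OF assms(1) z] H_hderiv[OF assms(2) z] by blast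
  then have "hderiv (\<lambda>z. conv (f z) (g z)) z (conv D (g z) + conv (f z) E)"
    by (intro hderiv_mult z H_S assms)
  then show "\<exists>D. hderiv (\<lambda>z. conv (f z) (g z)) z D" by blast
qed

text \<open>A holomorphic scalar acts as left multiplication by that scalar times the unit, so the
  product rule for \<open>conv\<close> already covers scalars.\<close>

lemma H_smult:
  assumes h: "h holomorphic_on Cx" and f: "f \<in> H"
  shows "(\<lambda>z\<in>Cx. scal (h z) (f z)) \<in> H"
proof -
  have "word_ind [] \<in> S" by (rule word_ind_in_S) simp
  from H_mult[OF hol_scalar_in_H[OF h this] f] show ?thesis
    by (simp add: conv_scal_left conv_one_left cong: restrict_cong)
qed

lemma H_uminus: "f \<in> H \<Longrightarrow> (\<lambda>z\<in>Cx. - f z) \<in> H"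
  using H_smult[of "\<lambda>_. -1" f] by (simp add: uminus_scal)

lemma H_restrict: "f \<in> H \<Longrightarrow> restrict f Cx = f"
  by (simp add: H_ext extensional_restrict)

lemma ring_A0: "ring A0"
proof (rule ringI)
  show "abelian_group A0"
  proof (rule abelian_groupI)
    fix x assume x: "x \<in> carrier A0"
    then show "\<exists>y\<in>carrier A0. y \<oplus>\<^bsub>A0\<^esub> x = \<zero>\<^bsub>A0\<^esub>"
      by (intro bexI[of _ "\<lambda>z\<in>Cx. - x z"]) (auto simp: H_uminus)
    show "\<zero>\<^bsub>A0\<^esub> \<oplus>\<^bsub>A0\<^esub> x = x"
      using x by (simp add: H_restrict cong: restrict_cong)
  qed (simp_all add: H_add const_in_H S_zero add_ac cong: restrict_cong)
  show "Group.monoid A0"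
  proof (rule monoidI)
    fix x assume x: "x \<in> carrier A0"
    show "\<one>\<^bsub>A0\<^esub> \<otimes>\<^bsub>A0\<^esub> x = x" "x \<otimes>\<^bsub>A0\<^esub> \<one>\<^bsub>A0\<^esub> = x"
      using x by (simp_all add: H_restrict conv_one_left conv_one_right cong: restrict_cong)
  qed (simp_all add: H_mult const_in_H word_ind_in_S conv_assoc cong: restrict_cong)
qed (simp_all add: conv_add_left conv_add_right cong: restrict_cong)

sublocale AR: ring A0
  by (rule ring_A0)

lemma A0_uminus: "f \<in> H \<Longrightarrow> \<ominus>\<^bsub>A0\<^esub> f = (\<lambda>z\<in>Cx. - f z)"
  using AR.minus_equality[of "\<lambda>z\<in>Cx. - f z" f] by (simp add: H_uminus cong: restrict_cong)

lemma A0_minus: "f \<in> H \<Longrightarrow> g \<in> H \<Longrightarrow> f \<ominus>\<^bsub>A0\<^esub> g = (\<lambda>z\<in>Cx. f z - g z)"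
  by (simp add: a_minus_def A0_uminus cong: restrict_cong)

end

section \<open>The compact-open topology as uniform convergence on compact sets\<close>

context graded_free_alg
begin

lemma topspace_A0 [simp]: "topspace (topol A0) = H"
proof -
  have "{f \<in> H. f ` {} \<subseteq> {}} \<in> {{f \<in> H. f ` K \<subseteq> U} | K U. compact K \<and> K \<subseteq> Cx \<and> openin T U}"
    by blast
  then show ?thesis unfolding topol_A0 topology_generated_by_topspace by auto
qed

lemma H_nbhd:
  assumes f: "f \<in> H" and z: "z \<in> Cx" and i: "i \<in> Idx" and e: "\<epsilon> > 0"
  obtains \<delta> where "\<delta> > 0" "cball z \<delta> \<subseteq> Cx" "\<And>w. w \<in> cball z \<delta> \<Longrightarrow> nrm i (f w - f z) < \<epsilon>"
proof -
  obtain D where "hderiv f z D" using H_hderiv[OF f z] by blast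
  from hderiv_continuous[OF H_S[OF f] z this i]
  have "eventually (\<lambda>w. nrm i (f w - f z) < \<epsilon>) (at z)" using e by (rule order_tendstoD)
  then obtain d where d: "d > 0" "\<And>w. w \<noteq> z \<Longrightarrow> dist w z < d \<Longrightarrow> nrm i (f w - f z) < \<epsilon>"
    unfolding eventually_at by auto
  obtain d' where d': "d' > 0" "cball z d' \<subseteq> Cx" using open_Cx z open_contains_cball by blast
  show ?thesis
  proof (rule that[of "min (d/2) d'"])
    show "nrm i (f w - f z) < \<epsilon>" if w: "w \<in> cball z (min (d/2) d')" for w
    proof (cases "w = z")
      case True
      then show ?thesis using e nrm_zero[OF i] by simp
    next
      case False
      then show ?thesis using d w by (intro d(2)) (auto simp: dist_commute)
    qed
  qed (use d d' in auto)
qed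

definition close_on :: "complex set \<Rightarrow> 'i \<Rightarrow> real \<Rightarrow> (complex \<Rightarrow> nat list \<Rightarrow> complex) \<Rightarrow> (complex \<Rightarrow> nat list \<Rightarrow> complex) \<Rightarrow> bool" where
  "close_on K i \<epsilon> f g \<longleftrightarrow> (\<forall>z\<in>K. nrm i (g z - f z) < \<epsilon>)"

lemma compact_finite_cover:
  assumes "compact K" "K \<subseteq> Cx" and \<delta>: "\<And>z. z \<in> K \<Longrightarrow> \<delta> z > (0::real)"
  obtains Z where "finite Z" "Z \<subseteq> K" "K \<subseteq> (\<Union>z\<in>Z. ball z (\<delta> z))"
proof -
  have "K \<subseteq> (\<Union>z\<in>K. ball z (\<delta> z))" using \<delta> by force
  then show ?thesis
    by (rule compactE_image[OF assms(1) open_ball]) (rule that)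
qed

text \<open>Interior points for uniform convergence on compact sets, measured by one norm. The open
  subsets of \<open>H\<close> turn out to be those all of whose points are inner, which turns
  topological claims into estimates.\<close>

definition inner :: "(complex \<Rightarrow> nat list \<Rightarrow> complex) set \<Rightarrow> (complex \<Rightarrow> nat list \<Rightarrow> complex) \<Rightarrow> bool" where
  "inner U f \<longleftrightarrow> (\<exists>K i \<epsilon>. compact K \<and> K \<subseteq> Cx \<and> i \<in> Idx \<and> \<epsilon> > 0 \<and> (\<forall>g\<in>H. close_on K i \<epsilon> f g \<longrightarrow> g \<in> U))"

lemma innerE:
  assumes "inner U f"
  obtains K i \<epsilon> where "compact K" "K \<subseteq> Cx" "i \<in> Idx" "\<epsilon> > 0"
    "\<And>g. g \<in> H \<Longrightarrow> close_on K i \<epsilon> f g \<Longrightarrow> g \<in> U"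
proof -
  obtain K i \<epsilon> where "compact K \<and> K \<subseteq> Cx \<and> i \<in> Idx \<and> \<epsilon> > 0 \<and> (\<forall>g\<in>H. close_on K i \<epsilon> f g \<longrightarrow> g \<in> U)"
    using assms unfolding inner_def by (elim exE)
  then show ?thesis by (intro that[of K i \<epsilon>]) auto
qed

lemma innerI:
  assumes "compact K" "K \<subseteq> Cx" "i \<in> Idx" "\<epsilon> > 0" "\<And>g. g \<in> H \<Longrightarrow> close_on K i \<epsilon> f g \<Longrightarrow> g \<in> U"
  shows "inner U f"
  unfolding inner_def by (rule exI[of _ K], rule exI[of _ i], rule exI[of _ \<epsilon>]) (use assms in simp)

text \<open>For a subbasic set, the ball around \<open>f z\<close> that fits into \<open>V\<close>
  has a radius and a norm depending on \<open>z\<close>. Continuity of \<open>f\<close> and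
  compactness of \<open>K\<close> leave finitely many \<open>z\<close>, and directedness a single
  norm; half of the radius absorbs the variation of \<open>f\<close>, the other half the distance
  from \<open>f\<close> to \<open>g\<close>.\<close>

lemma openin_A0_close:
  assumes U: "openin (topol A0) U" and f: "f \<in> U"
  shows "inner U f"
proof -
  have "generate_topology_on {{f \<in> H. f ` K \<subseteq> U} | K U. compact K \<and> K \<subseteq> Cx \<and> openin T U} U"
    using U by (simp add: topol_A0 openin_topology_generated_by_iff)
  then have "\<forall>f\<in>U. inner U f"
  proof induction
    case Empty
    show ?case by simp
  next
    case (Int A B)
    show ?case
    proof
      fix f assume f: "f \<in> A \<inter> B"
      have "f \<in> H"
        using Int(1) f openin_subset[of "topol A0" A]
        by (auto simp: topol_A0[symmetric] openin_topology_generated_by_iff[symmetric])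
      obtain K i \<epsilon> where A: "compact K" "K \<subseteq> Cx" "i \<in> Idx" "\<epsilon> > 0" "\<And>g. g \<in> H \<Longrightarrow> close_on K i \<epsilon> f g \<Longrightarrow> g \<in> A"
        by (rule innerE[of A f]) (use Int(3) f in auto)
      obtain L j \<delta> where B: "compact L" "L \<subseteq> Cx" "j \<in> Idx" "\<delta> > 0" "\<And>g. g \<in> H \<Longrightarrow> close_on L j \<delta> f g \<Longrightarrow> g \<in> B"
        by (rule innerE[of B f]) (use Int(4) f in auto)
      obtain l where l: "l \<in> Idx" "\<And>a. a \<in> S \<Longrightarrow> nrm i a \<le> nrm l a" "\<And>a. a \<in> S \<Longrightarrow> nrm j a \<le> nrm l a"
        using nrm_directed A(3) B(3) by blast
      have "g \<in> A \<inter> B" if g: "g \<in> H" "close_on (K \<union> L) l (min \<epsilon> \<delta>) f g" for g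
      proof -
        have "g z - f z \<in> S" if "z \<in> K \<union> L" for z
          using that A(2) B(2) H_S[OF g(1)] H_S[OF \<open>f \<in> H\<close>] by (intro S_diff) auto
        then have "close_on K i \<epsilon> f g" "close_on L j \<delta> f g"
          using g(2) l(2,3) unfolding close_on_def by (meson UnCI le_less_trans min_less_iff_conj)+
        then show ?thesis using A(5) B(5) g(1) by blast
      qed
      then show "inner (A \<inter> B) f"
        using A(1,2,4) B(1,2,4) l(1) by (intro innerI[of "K \<union> L" l "min \<epsilon> \<delta>"]) auto
    qed
  next
    case (UN K)
    then show ?case unfolding inner_def by (meson UnionE UnionI)
  next
    case (Basis A)
    then obtain K V where A: "A = {f \<in> H. f ` K \<subseteq> V}" "compact K" "K \<subseteq> Cx" "openin T V" by blast
    show ?case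
    proof
      fix f assume f: "f \<in> A"
      then have fH: "f \<in> H" and fV: "\<And>z. z \<in> K \<Longrightarrow> f z \<in> V" using A(1) by auto
      have "\<forall>z\<in>K. \<exists>i \<epsilon>. i \<in> Idx \<and> \<epsilon> > 0 \<and> (\<forall>y\<in>S. nrm i (y - f z) < \<epsilon> \<longrightarrow> y \<in> V)"
        using A(4) fV unfolding openin_T by blast
      then obtain i \<epsilon> where ie: "\<And>z. z \<in> K \<Longrightarrow> i z \<in> Idx" "\<And>z. z \<in> K \<Longrightarrow> \<epsilon> z > 0"
          "\<And>z y. z \<in> K \<Longrightarrow> y \<in> S \<Longrightarrow> nrm (i z) (y - f z) < \<epsilon> z \<Longrightarrow> y \<in> V"
        by metis
      have "\<forall>z\<in>K. \<exists>\<delta>>0. \<forall>w\<in>cball z \<delta>. nrm (i z) (f w - f z) < \<epsilon> z / 2"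
      proof
        fix z assume z: "z \<in> K"
        obtain \<delta> where "\<delta> > 0" "\<And>w. w \<in> cball z \<delta> \<Longrightarrow> nrm (i z) (f w - f z) < \<epsilon> z / 2"
          by (rule H_nbhd[OF fH _ ie(1)[OF z], of z "\<epsilon> z / 2"]) (use z A(3) ie(2) in auto)
        then show "\<exists>\<delta>>0. \<forall>w\<in>cball z \<delta>. nrm (i z) (f w - f z) < \<epsilon> z / 2" by blast
      qed
      then obtain \<delta> where \<delta>: "\<And>z. z \<in> K \<Longrightarrow> \<delta> z > 0" "\<And>z w. z \<in> K \<Longrightarrow> w \<in> cball z (\<delta> z) \<Longrightarrow> nrm (i z) (f w - f z) < \<epsilon> z / 2"
        by metis
      obtain Z where Z: "finite Z" "Z \<subseteq> K" "K \<subseteq> (\<Union>z\<in>Z. ball z (\<delta> z))"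
        by (rule compact_finite_cover[OF A(2,3) \<delta>(1)])
      obtain l where l: "l \<in> Idx" "\<And>z a. z \<in> Z \<Longrightarrow> a \<in> S \<Longrightarrow> nrm (i z) a \<le> nrm l a"
      proof -
        have "i ` Z \<subseteq> Idx" using Z(2) ie(1) by blast
        from nrm_directed_finite[OF finite_imageI[OF Z(1)] this] obtain l
          where "l \<in> Idx" "\<forall>j\<in>i ` Z. \<forall>a\<in>S. nrm j a \<le> nrm l a" by blast
        then show ?thesis by (intro that[of l]) auto
      qed
      \<comment> \<open>The inserted 1 keeps the minimum meaningful when \<open>K\<close>, and with
        it \<open>Z\<close>, is empty.\<close>
      define e where "e = Min (insert 1 ((\<lambda>z. \<epsilon> z / 2) ` Z))"
      have e: "e > 0" "\<And>z. z \<in> Z \<Longrightarrow> e \<le> \<epsilon> z / 2"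
      proof -
        show "e > 0" using Z(1,2) ie(2) by (auto simp: e_def)
        show "e \<le> \<epsilon> z / 2" if "z \<in> Z" for z
          unfolding e_def by (rule Min_le) (use Z(1) that in auto)
      qed
      have "g \<in> A" if g: "g \<in> H" "close_on K l e f g" for g
      proof -
        have "g w \<in> V" if w: "w \<in> K" for w
        proof -
          obtain z where z: "z \<in> Z" "w \<in> ball z (\<delta> z)" using Z(3) w by blast
          have S: "g w \<in> S" "f w \<in> S" "f z \<in> S" using H_S[OF g(1)] H_S[OF fH] w A(3) z(1) Z(2) by auto
          have zK: "z \<in> K" using z Z by blast
          have "nrm (i z) (g w - f z) \<le> nrm (i z) (g w - f w) + nrm (i z) (f w - f z)"
            using nrm_diff_triangle[OF ie(1)[OF zK] S] .
          also have "nrm (i z) (f w - f z) < \<epsilon> z / 2" using \<delta>(2)[OF zK, of w] z(2) by simp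
          also have "nrm (i z) (g w - f w) \<le> nrm l (g w - f w)" by (rule l(2)[OF z(1)]) (use S in \<open>auto intro: S_diff\<close>)
          also have "\<dots> < e" using g(2) w by (simp add: close_on_def)
          also have "e \<le> \<epsilon> z / 2" using e(2) z(1) by blast
          finally show ?thesis using ie(3)[OF zK S(1)] by simp
        qed
        then show ?thesis using A(1) g(1) by auto
      qed
      then show "inner A f"
        using A(2,3) l(1) e(1) by (intro innerI[of K l e])
    qed
  qed
  then show ?thesis using f by blast
qed

text \<open>A uniform neighbourhood contains a finite intersection of subbasic sets:
  \<open>K\<close> is covered by balls on which \<open>f\<close> varies little, and on each of them
  \<open>g\<close> is required to stay near the value of \<open>f\<close> at the centre.\<close>

lemma openin_A0I:
  assumes UH: "U \<subseteq> H"
    and U: "\<And>f. f \<in> U \<Longrightarrow> inner U f"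
  shows "openin (topol A0) U"
proof (subst openin_subopen, intro ballI)
  fix f assume f: "f \<in> U"
  then obtain K i \<epsilon> where K: "compact K" "K \<subseteq> Cx" "i \<in> Idx" "\<epsilon> > 0"
    and KU: "\<And>g. g \<in> H \<Longrightarrow> close_on K i \<epsilon> f g \<Longrightarrow> g \<in> U"
    using innerE[OF U] by metis
  have fH: "f \<in> H" using f UH by blast
  have "\<forall>z\<in>K. \<exists>\<delta>>0. \<forall>w\<in>cball z \<delta>. nrm i (f w - f z) < \<epsilon> / 2"
  proof
    fix z assume z: "z \<in> K"
    obtain \<delta> where "\<delta> > 0" "\<And>w. w \<in> cball z \<delta> \<Longrightarrow> nrm i (f w - f z) < \<epsilon> / 2"
      by (rule H_nbhd[OF fH _ K(3), of z "\<epsilon> / 2"]) (use z K in auto)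
    then show "\<exists>\<delta>>0. \<forall>w\<in>cball z \<delta>. nrm i (f w - f z) < \<epsilon> / 2" by blast
  qed
  then obtain \<delta> where \<delta>: "\<And>z. z \<in> K \<Longrightarrow> \<delta> z > 0" "\<And>z w. z \<in> K \<Longrightarrow> w \<in> cball z (\<delta> z) \<Longrightarrow> nrm i (f w - f z) < \<epsilon> / 2"
    by metis
  obtain Z where Z: "finite Z" "Z \<subseteq> K" "K \<subseteq> (\<Union>z\<in>Z. ball z (\<delta> z))"
    by (rule compact_finite_cover[OF K(1,2) \<delta>(1)])
  define B where "B z = {y \<in> S. nrm i (y - f z) < \<epsilon> / 2}" for z
  \<comment> \<open>Closed balls, since a subbasic set needs the compact set
    \<open>K \<inter> cball z (\<delta> z)\<close>.\<close>
  define V where "V z = {g \<in> H. g ` (K \<inter> cball z (\<delta> z)) \<subseteq> B z}" for z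
  have Vopen: "openin (topol A0) (V z)" if "z \<in> Z" for z
  proof -
    have "f z \<in> S" using that Z(2) K(2) H_S[OF fH] by auto
    then have "openin T (B z)" unfolding B_def by (rule ball_open[OF K(3)]) (use K(4) in simp)
    then show ?thesis
      unfolding topol_A0 V_def
      by (intro topology_generated_by_Basis)
        (use K(1,2) in \<open>auto intro!: exI[of _ "K \<inter> cball z (\<delta> z)"] exI[of _ "B z"] compact_Int_closed\<close>)
  qed
  have fV: "f \<in> V z" if "z \<in> Z" for z
    using that Z(2) \<delta>(2)[of z] fH H_S[OF fH] K(2) by (auto simp: V_def B_def)
  have "g \<in> U" if g: "g \<in> H" "\<And>z. z \<in> Z \<Longrightarrow> g \<in> V z" for g
  proof (rule KU[OF g(1)])
    show "close_on K i \<epsilon> f g"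
      unfolding close_on_def
    proof
      fix w assume w: "w \<in> K"
      then obtain z where z: "z \<in> Z" "w \<in> ball z (\<delta> z)" using Z(3) by blast
      have S: "g w \<in> S" "f z \<in> S" "f w \<in> S" using H_S[OF g(1)] H_S[OF fH] w K(2) z(1) Z(2) by auto
      have zK: "z \<in> K" using z Z by blast
      have "nrm i (g w - f w) \<le> nrm i (g w - f z) + nrm i (f z - f w)"
        using nrm_diff_triangle[OF K(3) S] .
      also have "nrm i (f z - f w) = nrm i (f w - f z)" using nrm_diff_commute K(3) S by blast
      also have "\<dots> < \<epsilon> / 2" using \<delta>(2)[OF zK, of w] z(2) by simp
      also have "nrm i (g w - f z) < \<epsilon> / 2"
      proof -
        have "w \<in> K \<inter> cball z (\<delta> z)" using w z(2) by simp
        then have "g w \<in> B z" using g(2)[OF z(1)] by (auto simp: V_def)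
        then show ?thesis by (simp add: B_def)
      qed
      finally show "nrm i (g w - f w) < \<epsilon>" by (simp add: fun_diff_def)
    qed
  qed
  \<comment> \<open>Intersecting with \<open>H\<close> covers the case of an empty \<open>Z\<close>,
    where the intersection of the \<open>V z\<close> would be the whole type.\<close>
  moreover have "openin (topol A0) (H \<inter> (\<Inter>z\<in>Z. V z))"
  proof (cases "Z = {}")
    case True
    then show ?thesis using openin_topspace[of "topol A0"] by simp
  next
    case False
    have "openin (topol A0) (\<Inter>z\<in>Z. V z)"
      by (rule openin_Inter) (use Z(1) False Vopen in auto)
    then show ?thesis using openin_topspace[of "topol A0"] by (simp add: openin_Int)
  qed
  ultimately show "\<exists>V. openin (topol A0) V \<and> f \<in> V \<and> V \<subseteq> U"
    using fV fH by (intro exI[of _ "H \<inter> (\<Inter>z\<in>Z. V z)"]) blast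
qed

lemma translate_open:
  assumes U: "openin (topol A0) U" and g: "g \<in> H"
  shows "openin (topol A0) {f \<in> H. f \<ominus>\<^bsub>A0\<^esub> g \<in> U}"
proof (rule openin_A0I)
  fix f assume f: "f \<in> {f \<in> H. f \<ominus>\<^bsub>A0\<^esub> g \<in> U}"
  then obtain K i \<epsilon> where K: "compact K" "K \<subseteq> Cx" "i \<in> Idx" "\<epsilon> > 0"
    and KU: "\<And>h. h \<in> H \<Longrightarrow> close_on K i \<epsilon> (f \<ominus>\<^bsub>A0\<^esub> g) h \<Longrightarrow> h \<in> U"
    by (auto elim!: innerE[OF openin_A0_close[OF U, of "f \<ominus>\<^bsub>A0\<^esub> g"]])
  have "h \<ominus>\<^bsub>A0\<^esub> g \<in> U" if h: "h \<in> H" "close_on K i \<epsilon> f h" for h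
  proof (rule KU)
    show "h \<ominus>\<^bsub>A0\<^esub> g \<in> H" using AR.minus_closed[of h g] h g by simp
    show "close_on K i \<epsilon> (f \<ominus>\<^bsub>A0\<^esub> g) (h \<ominus>\<^bsub>A0\<^esub> g)"
      unfolding close_on_def
    proof
      fix z assume z: "z \<in> K"
      have "(h \<ominus>\<^bsub>A0\<^esub> g) z - (f \<ominus>\<^bsub>A0\<^esub> g) z = h z - f z"
        using z K(2) h f g by (auto simp: A0_minus)
      then show "nrm i ((h \<ominus>\<^bsub>A0\<^esub> g) z - (f \<ominus>\<^bsub>A0\<^esub> g) z) < \<epsilon>"
        using h(2) z by (simp add: close_on_def)
    qed
  qed
  then show "inner {f \<in> H. f \<ominus>\<^bsub>A0\<^esub> g \<in> U} f"
    using K by (intro innerI[of K i \<epsilon>]) auto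
qed auto

lemma eval_continuous:
  assumes "q \<in> Cx"
  shows "continuous_map (topol A0) T (\<lambda>f. f q)"
  unfolding continuous_map_def
proof (intro conjI allI impI)
  show "(\<lambda>f. f q) \<in> topspace (topol A0) \<rightarrow> topspace T" using assms by (auto simp: H_S)
  fix U assume U: "openin T U"
  have "{f \<in> H. f ` {q} \<subseteq> U} \<in> {{f \<in> H. f ` K \<subseteq> U} | K U. compact K \<and> K \<subseteq> Cx \<and> openin T U}"
    using U assms by (intro CollectI exI[of _ "{q}"] exI[of _ U]) auto
  then have "openin (topol A0) {f \<in> H. f ` {q} \<subseteq> U}" unfolding topol_A0 by (rule topology_generated_by_Basis)
  then show "openin (topol A0) {f \<in> topspace (topol A0). f q \<in> U}" by simp
qed

text \<open>Through this embedding a continuous linear section of the reordering map becomes one of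
  the evaluation map.\<close>

lemma const_continuous: "continuous_map T (topol A0) (\<lambda>a. \<lambda>z\<in>Cx. a)"
  unfolding topol_A0
proof (rule continuous_on_generated_topo)
  fix V assume "V \<in> {{f \<in> H. f ` K \<subseteq> U} |K U. compact K \<and> K \<subseteq> Cx \<and> openin T U}"
  then obtain K U where V: "V = {f \<in> H. f ` K \<subseteq> U}" "K \<subseteq> Cx" "openin T U" by blast
  have "(\<lambda>a. \<lambda>z\<in>Cx. a) -` V \<inter> topspace T = (if K = {} then topspace T else U)"
  proof -
    have "((\<lambda>z\<in>Cx. a) \<in> V) = (K = {} \<or> a \<in> U)" if "a \<in> S" for a
      using that V const_in_H[OF that] by (auto simp: image_subset_iff subset_iff)
    moreover have "U \<subseteq> S" using openin_subset[OF V(3)] by simp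
    ultimately show ?thesis by auto
  qed
  then show "openin T ((\<lambda>a. \<lambda>z\<in>Cx. a) -` V \<inter> topspace T)" using V(3) openin_topspace[of T] by auto
next
  show "(\<lambda>a. \<lambda>z\<in>Cx. a) ` topspace T \<subseteq> \<Union> {{f \<in> H. f ` K \<subseteq> U} |K U. compact K \<and> K \<subseteq> Cx \<and> openin T U}"
    using topspace_A0 const_in_H unfolding topol_A0 topology_generated_by_topspace by auto
qed

text \<open>Truncation never increases a norm, so the truncations of \<open>f\<close> vary at most
  as much as \<open>f\<close>, uniformly in \<open>m\<close>. Convergence at the finitely many
  centres of a cover by small balls therefore gives uniform convergence on \<open>K\<close>; hence
  the three thirds of \<open>\<epsilon>\<close>.\<close>

lemma trunc_uniform:
  assumes f: "f \<in> H" and K: "compact K" "K \<subseteq> Cx" and i: "i \<in> Idx" and e: "\<epsilon> > 0"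
  shows "\<exists>M. \<forall>m\<ge>M. \<forall>z\<in>K. nrm i (trunc m (f z) - f z) < \<epsilon>"
proof -
  have "\<forall>z\<in>K. \<exists>\<delta>>0. \<forall>w\<in>cball z \<delta>. nrm i (f w - f z) < \<epsilon> / 3"
  proof
    fix z assume z: "z \<in> K"
    obtain \<delta> where "\<delta> > 0" "\<And>w. w \<in> cball z \<delta> \<Longrightarrow> nrm i (f w - f z) < \<epsilon> / 3"
      by (rule H_nbhd[OF f _ i, of z "\<epsilon> / 3"]) (use z K e in auto)
    then show "\<exists>\<delta>>0. \<forall>w\<in>cball z \<delta>. nrm i (f w - f z) < \<epsilon> / 3" by blast
  qed
  then obtain \<delta> where \<delta>: "\<And>z. z \<in> K \<Longrightarrow> \<delta> z > 0" "\<And>z w. z \<in> K \<Longrightarrow> w \<in> cball z (\<delta> z) \<Longrightarrow> nrm i (f w - f z) < \<epsilon> / 3"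
    by metis
  obtain Z where Z: "finite Z" "Z \<subseteq> K" "K \<subseteq> (\<Union>z\<in>Z. ball z (\<delta> z))"
    by (rule compact_finite_cover[OF K \<delta>(1)])
  have "eventually (\<lambda>m. \<forall>z\<in>Z. nrm i (trunc m (f z) - f z) < \<epsilon> / 3) sequentially"
    using Z(1,2) K(2) H_S[OF f] e
    by (intro eventually_ball_finite ballI order_tendstoD(2)[OF nrm_trunc_tendsto[OF i]]) auto
  then obtain M where M: "\<And>m z. m \<ge> M \<Longrightarrow> z \<in> Z \<Longrightarrow> nrm i (trunc m (f z) - f z) < \<epsilon> / 3"
    unfolding eventually_sequentially by blast
  have "nrm i (trunc m (f w) - f w) < \<epsilon>" if m: "m \<ge> M" and w: "w \<in> K" for m w
  proof -
    obtain z where z: "z \<in> Z" "w \<in> ball z (\<delta> z)" using Z(3) w by blast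
    have zK: "z \<in> K" using z Z by blast
    have S: "f w \<in> S" "f z \<in> S" using H_S[OF f] w K(2) zK by auto
    have c: "nrm i (f w - f z) < \<epsilon> / 3" using \<delta>(2)[OF zK, of w] z(2) by simp
    have "nrm i (trunc m (f w) - f w) \<le> nrm i (trunc m (f w) - trunc m (f z)) + nrm i (trunc m (f z) - f w)"
      by (rule nrm_diff_triangle[OF i]) (use S in \<open>auto simp: trunc_in_S\<close>)
    also have "nrm i (trunc m (f z) - f w) \<le> nrm i (trunc m (f z) - f z) + nrm i (f z - f w)"
      by (rule nrm_diff_triangle[OF i]) (use S in \<open>auto simp: trunc_in_S\<close>)
    also have "nrm i (trunc m (f w) - trunc m (f z)) \<le> nrm i (f w - f z)"
      unfolding trunc_diff[symmetric] using S by (intro nrm_trunc_le i S_diff)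
    also have "nrm i (f z - f w) = nrm i (f w - f z)" using nrm_diff_commute i S by blast
    finally show ?thesis using c M[OF m z(1)] by linarith
  qed
  then show ?thesis by blast
qed

lemma trunc_dense:
  assumes U: "openin (topol A0) U" and f: "f \<in> U" and t: "\<And>m. (\<lambda>z\<in>Cx. trunc m (f z)) \<in> H"
  shows "\<exists>m. (\<lambda>z\<in>Cx. trunc m (f z)) \<in> U"
proof -
  obtain K i \<epsilon> where K: "compact K" "K \<subseteq> Cx" "i \<in> Idx" "\<epsilon> > 0"
    and KU: "\<And>h. h \<in> H \<Longrightarrow> close_on K i \<epsilon> f h \<Longrightarrow> h \<in> U"
    using innerE[OF openin_A0_close[OF U f]] by metis
  have "f \<in> H" using openin_subset[OF U] f by auto
  from trunc_uniform[OF this K] obtain M where "\<forall>z\<in>K. nrm i (trunc M (f z) - f z) < \<epsilon>" by blast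
  then have "close_on K i \<epsilon> f (\<lambda>z\<in>Cx. trunc M (f z))"
    using K(2) by (auto simp: close_on_def)
  then show ?thesis using KU t by blast
qed

text \<open>A coefficient is a linear functional bounded by one of the norms, so it commutes with
  the limit of the difference quotients.\<close>

lemma coeff_holomorphic:
  assumes f: "f \<in> H" and a: "\<alpha> \<in> words n"
  shows "(\<lambda>z. f z \<alpha>) holomorphic_on Cx"
  unfolding holomorphic_on_def
proof
  fix z assume z: "z \<in> Cx"
  obtain D where D: "hderiv f z D" using H_hderiv[OF f z] by blast
  then have DS: "D \<in> S" by (simp add: hderiv_def)
  obtain i C where i: "i \<in> Idx" "C > 0" "\<And>a. a \<in> S \<Longrightarrow> cmod (a \<alpha>) \<le> C * nrm i a"
    using coeff_bound[OF a] by blast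
  have "((\<lambda>w. C * nrm i (quot f z w - D)) \<longlongrightarrow> 0) (at z)"
    using D i(1) by (auto simp: hderiv_def intro!: tendsto_mult_right_zero)
  moreover have "eventually (\<lambda>w. cmod ((f w \<alpha> - f z \<alpha>) / (w - z) - D \<alpha>) \<le> C * nrm i (quot f z w - D)) (at z)"
    using eventually_Cx[OF z]
  proof eventually_elim
    case (elim w)
    have "quot f z w - D \<in> S" using H_S[OF f] z elim DS by (intro S_diff quot_in_S) auto
    from i(3)[OF this] show ?case by (simp add: quot_def field_simps)
  qed
  ultimately have "((\<lambda>w. cmod ((f w \<alpha> - f z \<alpha>) / (w - z) - D \<alpha>)) \<longlongrightarrow> 0) (at z)"
    by - (rule squeeze0[of _ _ "\<lambda>w. C * nrm i (quot f z w - D)"], simp_all)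
  then have "((\<lambda>w. (f w \<alpha> - f z \<alpha>) / (w - z)) \<longlongrightarrow> D \<alpha>) (at z)"
    by (simp add: tendsto_norm_zero_iff LIM_zero_iff)
  then have "((\<lambda>z. f z \<alpha>) has_field_derivative D \<alpha>) (at z)"
    by (simp add: has_field_derivative_iff)
  then show "(\<lambda>z. f z \<alpha>) field_differentiable at z within Cx"
    using field_differentiable_at_within field_differentiable_def by blast
qed

end

section \<open>Quotient algebras\<close>

lemma quotient_alg_simps:
  "carrier (quotient_alg A J) = carrier (A Quot J)" "mult (quotient_alg A J) = mult (A Quot J)"
  "one (quotient_alg A J) = one (A Quot J)" "zero (quotient_alg A J) = zero (A Quot J)"
  "add (quotient_alg A J) = add (A Quot J)"
  by (simp_all add: quotient_alg_def)

lemma carrier_Quot: "carrier (A Quot J) = (\<lambda>a. J +>\<^bsub>A\<^esub> a) ` carrier A"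
  by (auto simp: FactRing_def A_RCOSETS_def')

text \<open>The ring axioms do not see additional record fields. This moves them between records
  that share carrier and operations, such as a quotient ring and the same quotient with scalars and
  a topology.\<close>

lemma ring_cong_ops:
  assumes "ring R" "carrier R' = carrier R" "mult R' = mult R" "one R' = one R"
    "zero R' = zero R" "add R' = add R"
  shows "ring R'"
proof -
  interpret R: ring R by fact
  show ?thesis
  proof (rule ringI)
    show "abelian_group R'"
      by (rule abelian_groupI)
        (use assms R.add.l_inv_ex in \<open>auto simp: R.add.m_ac\<close>)
    show "Group.monoid R'"
      by (rule monoidI) (auto simp: assms R.m_assoc)
  qed (auto simp: assms R.l_distr R.r_distr)
qed

lemma ring_hom_cong_ops:
  assumes "h \<in> ring_hom R S" "carrier R' = carrier R" "mult R' = mult R" "one R' = one R" "add R' = add R"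
  shows "h \<in> ring_hom R' S"
  using assms by (auto simp: ring_hom_def)

lemma ring_quotient_alg: "ideal J A \<Longrightarrow> ring (quotient_alg A J)"
  by (rule ring_cong_ops[OF ideal.quotient_is_ring]) (auto simp: quotient_alg_simps)

lemma coset_ring_hom: "ideal J A \<Longrightarrow> (\<lambda>a. J +>\<^bsub>A\<^esub> a) \<in> ring_hom A (quotient_alg A J)"
  using ideal.rcos_ring_hom[of J A] by (auto simp: ring_hom_def quotient_alg_simps)

lemma coset_eq_iff:
  assumes "ideal J A" "a \<in> carrier A" "b \<in> carrier A"
  shows "J +>\<^bsub>A\<^esub> a = J +>\<^bsub>A\<^esub> b \<longleftrightarrow> a \<ominus>\<^bsub>A\<^esub> b \<in> J"
  using ring.quotient_eq_iff_same_a_r_cos[OF ideal.axioms(2), of J A J a b] assms by blast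

lemma coset_self: "ideal J A \<Longrightarrow> a \<in> carrier A \<Longrightarrow> a \<in> J +>\<^bsub>A\<^esub> a"
proof -
  assume "ideal J A" and a: "a \<in> carrier A"
  then interpret ideal J A by simp
  show ?thesis using a by (rule a_rcos_self)
qed

text \<open>Only with this is the \<open>topology\<close> constructor in \<open>quotient_alg\<close>
  known to have the intended open sets.\<close>

lemma istopology_quotient:
  "istopology (\<lambda>U. U \<subseteq> carrier (A Quot J) \<and> openin (topol A) {a \<in> carrier A. J +>\<^bsub>A\<^esub> a \<in> U})"
  unfolding istopology_def
proof (intro conjI allI impI)
  fix U V
  assume "U \<subseteq> carrier (A Quot J) \<and> openin (topol A) {a \<in> carrier A. J +>\<^bsub>A\<^esub> a \<in> U}"
    "V \<subseteq> carrier (A Quot J) \<and> openin (topol A) {a \<in> carrier A. J +>\<^bsub>A\<^esub> a \<in> V}"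
  moreover have "{a \<in> carrier A. J +>\<^bsub>A\<^esub> a \<in> U \<inter> V} = {a \<in> carrier A. J +>\<^bsub>A\<^esub> a \<in> U} \<inter> {a \<in> carrier A. J +>\<^bsub>A\<^esub> a \<in> V}"
    by auto
  ultimately show "U \<inter> V \<subseteq> carrier (A Quot J)" "openin (topol A) {a \<in> carrier A. J +>\<^bsub>A\<^esub> a \<in> U \<inter> V}"
    by (auto simp: openin_Int)
next
  fix \<U>
  assume U: "\<forall>U\<in>\<U>. U \<subseteq> carrier (A Quot J) \<and> openin (topol A) {a \<in> carrier A. J +>\<^bsub>A\<^esub> a \<in> U}"
  then show "\<Union>\<U> \<subseteq> carrier (A Quot J)" by blast
  have "{a \<in> carrier A. J +>\<^bsub>A\<^esub> a \<in> \<Union>\<U>} = (\<Union>U\<in>\<U>. {a \<in> carrier A. J +>\<^bsub>A\<^esub> a \<in> U})" by auto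
  then show "openin (topol A) {a \<in> carrier A. J +>\<^bsub>A\<^esub> a \<in> \<Union>\<U>}" using U by auto
qed

lemma openin_quotient:
  "openin (topol (quotient_alg A J)) U \<longleftrightarrow>
     U \<subseteq> carrier (A Quot J) \<and> openin (topol A) {a \<in> carrier A. J +>\<^bsub>A\<^esub> a \<in> U}"
  unfolding quotient_alg_def top_alg.select_convs topology_inverse'[OF istopology_quotient] ..

lemma topspace_quotient:
  assumes "topspace (topol A) = carrier A"
  shows "topspace (topol (quotient_alg A J)) = carrier (quotient_alg A J)"
proof -
  have "{a \<in> carrier A. J +>\<^bsub>A\<^esub> a \<in> carrier (A Quot J)} = carrier A" by (auto simp: carrier_Quot)
  then have "openin (topol (quotient_alg A J)) (carrier (A Quot J))"
    using openin_topspace[of "topol A"] by (simp add: openin_quotient assms)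
  then show ?thesis
    using openin_topspace[of "topol (quotient_alg A J)"]
    by (metis openin_quotient openin_subset quotient_alg_simps(1) subset_antisym)
qed

lemma coset_continuous:
  assumes "topspace (topol A) = carrier A"
  shows "continuous_map (topol A) (topol (quotient_alg A J)) (\<lambda>a. J +>\<^bsub>A\<^esub> a)"
  unfolding continuous_map_def topspace_quotient[OF assms] assms quotient_alg_simps
proof (intro conjI allI impI)
  show "(\<lambda>a. J +>\<^bsub>A\<^esub> a) \<in> carrier A \<rightarrow> carrier (A Quot J)" by (auto simp: carrier_Quot)
  show "openin (topol A) {a \<in> carrier A. J +>\<^bsub>A\<^esub> a \<in> U}" if "openin (topol (quotient_alg A J)) U" for U
    using that unfolding openin_quotient by blast
qed

text \<open>The map induced on cosets, meaningful for maps constant on cosets.\<close>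
definition induced :: "('a \<Rightarrow> 'b) \<Rightarrow> 'a set \<Rightarrow> 'b" where
  "induced h X = h (SOME a. a \<in> X)"

context
  fixes A :: "('s, 'a) top_alg" and J and B :: "('t, 'b) top_alg" and h
  assumes ring_A: "ring A" and ideal_J: "ideal J A" and ring_B: "ring B"
    and h: "h \<in> ring_hom A B" and h_J: "\<And>a. a \<in> J \<Longrightarrow> h a = \<zero>\<^bsub>B\<^esub>"
begin

interpretation A: ring A by (rule ring_A)
interpretation B: ring B by (rule ring_B)
interpretation J: ideal J A by (rule ideal_J)
interpretation h: ring_hom_ring A B h
  by (rule ring_hom_ringI2[OF ring_A ring_B h])

lemma hom_const_coset:
  assumes a: "a \<in> carrier A" and x: "x \<in> J +>\<^bsub>A\<^esub> a"
  shows "h x = h a"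
proof -
  obtain j where j: "j \<in> J" "x = j \<oplus>\<^bsub>A\<^esub> a" using x by (auto simp: a_r_coset_def')
  then show ?thesis using a h_J J.a_subset by (auto simp: subset_iff)
qed

lemma induced_coset: assumes a: "a \<in> carrier A" shows "induced h (J +>\<^bsub>A\<^esub> a) = h a"
proof -
  have "a \<in> J +>\<^bsub>A\<^esub> a" by (rule J.a_rcos_self[OF a])
  then have "(SOME x. x \<in> J +>\<^bsub>A\<^esub> a) \<in> J +>\<^bsub>A\<^esub> a" by (rule someI)
  then show ?thesis unfolding induced_def by (rule hom_const_coset[OF a])
qed

lemma induced_ring_hom: "induced h \<in> ring_hom (quotient_alg A J) B"
proof -
  note c = coset_ring_hom[OF ideal_J]
  have ex: "\<exists>a\<in>carrier A. X = J +>\<^bsub>A\<^esub> a" if "X \<in> carrier (quotient_alg A J)" for X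
    using that by (auto simp: quotient_alg_simps carrier_Quot)
  show ?thesis
  proof (rule ring_hom_memI)
    fix X assume "X \<in> carrier (quotient_alg A J)"
    then obtain a where a: "a \<in> carrier A" "X = J +>\<^bsub>A\<^esub> a" using ex by blast
    then show "induced h X \<in> carrier B" by (simp add: induced_coset)
    fix Y assume "Y \<in> carrier (quotient_alg A J)"
    then obtain b where b: "b \<in> carrier A" "Y = J +>\<^bsub>A\<^esub> b" using ex by blast
    show "induced h (X \<otimes>\<^bsub>quotient_alg A J\<^esub> Y) = induced h X \<otimes>\<^bsub>B\<^esub> induced h Y"
      using a b by (simp add: ring_hom_mult[OF c, of a b, symmetric] induced_coset)
    show "induced h (X \<oplus>\<^bsub>quotient_alg A J\<^esub> Y) = induced h X \<oplus>\<^bsub>B\<^esub> induced h Y"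
      using a b by (simp add: ring_hom_add[OF c, of a b, symmetric] induced_coset)
  next
    show "induced h \<one>\<^bsub>quotient_alg A J\<^esub> = \<one>\<^bsub>B\<^esub>"
      using ring_hom_one[OF c] induced_coset[of "\<one>\<^bsub>A\<^esub>"] by simp
  qed
qed

lemma induced_continuous:
  assumes cont: "continuous_map (topol A) X h" and top: "topspace (topol A) = carrier A"
  shows "continuous_map (topol (quotient_alg A J)) X (induced h)"
  unfolding continuous_map_def topspace_quotient[OF top]
proof (intro conjI allI impI)
  show "induced h \<in> carrier (quotient_alg A J) \<rightarrow> topspace X"
    using continuous_map_funspace[OF cont] by (auto simp: quotient_alg_simps carrier_Quot induced_coset top)
  fix U assume U: "openin X U"
  have "{a \<in> carrier A. J +>\<^bsub>A\<^esub> a \<in> {x \<in> carrier (quotient_alg A J). induced h x \<in> U}} = {a \<in> topspace (topol A). h a \<in> U}"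
    by (auto simp: quotient_alg_simps carrier_Quot induced_coset top)
  then show "openin (topol (quotient_alg A J)) {x \<in> carrier (quotient_alg A J). induced h x \<in> U}"
    unfolding openin_quotient using openin_continuous_map_preimage[OF cont U] by (auto simp: quotient_alg_simps)
qed

end

text \<open>Scalar multiplication on a quotient is encoded as a union over all representatives; it
  collapses to one coset once the choice of representative is immaterial. Each of the two quotients
  below supplies its own reason for that.\<close>

lemma smult_quotient_coset:
  assumes "ideal J A" "x \<in> carrier A"
    and "\<And>y. y \<in> J +>\<^bsub>A\<^esub> x \<Longrightarrow> J +>\<^bsub>A\<^esub> (c \<odot>\<^bsub>A\<^esub> y) = J +>\<^bsub>A\<^esub> (c \<odot>\<^bsub>A\<^esub> x)"
  shows "c \<odot>\<^bsub>quotient_alg A J\<^esub> (J +>\<^bsub>A\<^esub> x) = J +>\<^bsub>A\<^esub> (c \<odot>\<^bsub>A\<^esub> x)"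
proof -
  have "x \<in> J +>\<^bsub>A\<^esub> x"
    using assms(1,2) by (rule coset_self)
  moreover have "c \<odot>\<^bsub>quotient_alg A J\<^esub> (J +>\<^bsub>A\<^esub> x) = (\<Union>y\<in>J +>\<^bsub>A\<^esub> x. J +>\<^bsub>A\<^esub> (c \<odot>\<^bsub>A\<^esub> y))"
    by (simp add: quotient_alg_def)
  moreover have "\<dots> = (\<Union>y\<in>J +>\<^bsub>A\<^esub> x. J +>\<^bsub>A\<^esub> (c \<odot>\<^bsub>A\<^esub> x))"
    by (rule SUP_cong[OF refl assms(3)])
  ultimately show ?thesis by auto
qed

text \<open>The whole carrier belongs to the family, so the intersection is taken over a nonempty
  set of ideals.\<close>

lemma closed_ideal_gen_ideal:
  assumes "ring A" "S \<subseteq> carrier A" "topspace (topol A) = carrier A"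
  shows "ideal (closed_ideal_gen A S) A"
proof -
  have "carrier A \<in> {J. ideal J A \<and> closedin (topol A) J \<and> S \<subseteq> J}"
    using ring.oneideal[OF assms(1)] closedin_topspace[of "topol A"] assms(2,3) by auto
  then show ?thesis unfolding closed_ideal_gen_def
    by (intro ring.i_Intersect[OF assms(1)]) auto
qed

lemma closed_ideal_gen_incl: "S \<subseteq> closed_ideal_gen A S"
  by (auto simp: closed_ideal_gen_def)

lemma closed_ideal_gen_least: "ideal J A \<Longrightarrow> closedin (topol A) J \<Longrightarrow> S \<subseteq> J \<Longrightarrow> closed_ideal_gen A S \<subseteq> J"
  by (auto simp: closed_ideal_gen_def)

section \<open>Inversions of words and the quantum product\<close>

fun inversions :: "nat list \<Rightarrow> nat" where
  "inversions [] = 0"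
| "inversions (i # \<beta>) = length (filter (\<lambda>b. b < i) \<beta>) + inversions \<beta>"

text \<open>Counts the inversions between a left factor with letter counts \<open>k\<close> and a
  right factor with letter counts \<open>l\<close>. It is also the exponent of
  \<open>inverse q\<close> in the quantum product, and \<open>crossing n k k\<close> is the exponent
  in \<open>u_weight\<close>.\<close>

definition crossing :: "nat \<Rightarrow> (nat \<Rightarrow> nat) \<Rightarrow> (nat \<Rightarrow> nat) \<Rightarrow> nat" where
  "crossing n k l = (\<Sum>j=1..n. \<Sum>i=1..<j. l i * k j)"

definition words_of :: "nat \<Rightarrow> (nat \<Rightarrow> nat) \<Rightarrow> nat list set" where
  "words_of n k = {\<alpha> \<in> words n. count_list \<alpha> = k}"

lemma words_Cons [simp]: "i # \<alpha> \<in> words n \<longleftrightarrow> 1 \<le> i \<and> i \<le> n \<and> \<alpha> \<in> words n"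
  by (auto simp: words_def)

lemma count_list_multi_index: "\<alpha> \<in> words n \<Longrightarrow> count_list \<alpha> \<in> multi_indices n"
  by (auto simp: words_def multi_indices_def count_list_0_iff)

lemma mi_deg_count_list: "\<alpha> \<in> words n \<Longrightarrow> mi_deg n (count_list \<alpha>) = length \<alpha>"
  unfolding mi_deg_def by (rule sum_count_set) (auto simp: words_def)

lemma finite_words_len: "finite (words_len n d)"
proof -
  have "words_len n d = {\<alpha>. set \<alpha> \<subseteq> {1..n} \<and> length \<alpha> = d}"
    by (auto simp: words_len_def words_def)
  then show ?thesis by (simp add: finite_lists_length_eq)
qed

lemma words_of_subset: "words_of n k \<subseteq> words_len n (mi_deg n k)"
  by (auto simp: words_of_def words_len_def mi_deg_count_list)

lemma finite_words_of: "finite (words_of n k)"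
  by (rule finite_subset[OF words_of_subset finite_words_len])

lemma words_of_not_multi_index: "k \<notin> multi_indices n \<Longrightarrow> words_of n k = {}"
  using count_list_multi_index by (auto simp: words_of_def)

lemma length_filter_less:
  assumes "\<gamma> \<in> words n"
  shows "length (filter (\<lambda>b. b < j) \<gamma>) = (\<Sum>i=1..<j. count_list \<gamma> i)"
  using assms
proof (induction \<gamma>)
  case (Cons a \<gamma>)
  have "(\<Sum>i=1..<j. count_list (a # \<gamma>) i) = (\<Sum>i=1..<j. count_list \<gamma> i) + (\<Sum>i=1..<j. if a = i then 1 else 0)"
    unfolding sum.distrib[symmetric] by (rule sum.cong) auto
  also have "(\<Sum>i=1..<j. if a = i then 1 else 0) = (if a < j then 1 else (0::nat))"
    using Cons by simp
  finally show ?case using Cons by simp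
qed simp

text \<open>An inversion of the concatenation either lies within one factor or has its larger letter
  in \<open>\<beta>\<close> and its smaller one in \<open>\<gamma>\<close>.\<close>

lemma inversions_append:
  assumes "\<beta> \<in> words n" "\<gamma> \<in> words n"
  shows "inversions (\<beta> @ \<gamma>) = inversions \<beta> + inversions \<gamma> + crossing n (count_list \<beta>) (count_list \<gamma>)"
  using assms(1)
proof (induction \<beta>)
  case Nil
  then show ?case by (simp add: crossing_def)
next
  case (Cons a \<beta>)
  have "crossing n (count_list (a # \<beta>)) (count_list \<gamma>)
      = crossing n (count_list \<beta>) (count_list \<gamma>) + (\<Sum>j=1..n. if j = a then (\<Sum>i=1..<j. count_list \<gamma> i) else 0)"
    unfolding crossing_def sum.distrib[symmetric] by (rule sum.cong) (auto simp: sum.distrib)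
  also have "(\<Sum>j=1..n. if j = a then (\<Sum>i=1..<j. count_list \<gamma> i) else 0) = length (filter (\<lambda>b. b < a) \<gamma>)"
    using Cons.prems by (simp add: length_filter_less[OF assms(2)])
  finally show ?case using Cons by simp
qed

definition qpi :: "nat \<Rightarrow> complex \<Rightarrow> (nat list \<Rightarrow> complex) \<Rightarrow> (nat \<Rightarrow> nat) \<Rightarrow> complex" where
  "qpi n q a k = (\<Sum>\<alpha>\<in>words_of n k. inverse q ^ inversions \<alpha> * a \<alpha>)"

lemma qpi_add: "qpi n q (a + b) = qpi n q a + qpi n q b"
  by (simp add: qpi_def fun_eq_iff algebra_simps sum.distrib)

lemma qpi_diff: "qpi n q (a - b) = qpi n q a - qpi n q b"
  by (simp add: qpi_def fun_eq_iff algebra_simps sum_subtractf)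

lemma qpi_scal: "qpi n q (scal c a) = scal c (qpi n q a)"
  by (simp add: qpi_def fun_eq_iff sum_distrib_left mult_ac)

lemma qpi_supp: "k \<notin> multi_indices n \<Longrightarrow> qpi n q a k = 0"
  by (simp add: qpi_def words_of_not_multi_index)

lemma qpi_word_ind: "\<alpha> \<in> words n \<Longrightarrow>
    qpi n q (word_ind \<alpha>) = (\<lambda>k. if k = count_list \<alpha> then inverse q ^ inversions \<alpha> else 0)"
proof
  fix k assume "\<alpha> \<in> words n"
  have "qpi n q (word_ind \<alpha>) k = (\<Sum>\<beta>\<in>words_of n k. if \<beta> = \<alpha> then inverse q ^ inversions \<alpha> else 0)"
    unfolding qpi_def by (rule sum.cong) (auto simp: word_ind_def)
  then show "qpi n q (word_ind \<alpha>) k = (if k = count_list \<alpha> then inverse q ^ inversions \<alpha> else 0)"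
    using \<open>\<alpha> \<in> words n\<close> sum.delta[OF finite_words_of[of n k], of \<alpha> "\<lambda>_. inverse q ^ inversions \<alpha>"]
    by (auto simp: words_of_def)
qed

definition qmult :: "nat \<Rightarrow> complex \<Rightarrow> ((nat \<Rightarrow> nat) \<Rightarrow> complex) \<Rightarrow> ((nat \<Rightarrow> nat) \<Rightarrow> complex) \<Rightarrow> (nat \<Rightarrow> nat) \<Rightarrow> complex" where
  "qmult n q a b = (\<lambda>m. \<Sum>(k, l)\<in>{(k, l). k \<in> multi_indices n \<and> l \<in> multi_indices n \<and> (\<lambda>i. k i + l i) = m}.
               inverse q ^ crossing n k l * a k * b l)"

lemma count_list_append_fun: "count_list (\<beta> @ \<gamma>) = (\<lambda>i. count_list \<beta> i + count_list \<gamma> i)"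
  by auto

lemma finite_mi_pairs:
  "finite {(k, l). k \<in> multi_indices n \<and> l \<in> multi_indices n \<and> (\<lambda>i. k i + l i) = m}"
proof -
  let ?B = "{k. \<forall>i. (i \<in> {1..n} \<longrightarrow> k i \<in> {..sum m {1..n}}) \<and> (i \<notin> {1..n} \<longrightarrow> k i = (0::nat))}"
  have "finite ?B" by (rule finite_set_of_finite_funs) auto
  moreover have "{(k, l). k \<in> multi_indices n \<and> l \<in> multi_indices n \<and> (\<lambda>i. k i + l i) = m} \<subseteq> ?B \<times> ?B"
  proof
    fix x assume "x \<in> {(k, l). k \<in> multi_indices n \<and> l \<in> multi_indices n \<and> (\<lambda>i. k i + l i) = m}"
    then obtain k l where x: "x = (k, l)" and kl: "k \<in> multi_indices n" "l \<in> multi_indices n" "m = (\<lambda>i. k i + l i)"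
      by blast
    have "k i + l i \<le> sum m {1..n}" if "i \<in> {1..n}" for i
      unfolding kl(3) by (rule member_le_sum[of i "{1..n}" "\<lambda>i. k i + l i"]) (use that in auto)
    then have "k i \<le> sum m {1..n}" "l i \<le> sum m {1..n}" if "i \<in> {1..n}" for i
      using that by (meson add_leD1 add_leD2)+
    then show "x \<in> ?B \<times> ?B" using kl(1,2) unfolding x by (auto simp: multi_indices_def)
  qed
  ultimately show ?thesis by (meson finite_SigmaI finite_subset)
qed

text \<open>A word with a cut point is the same as a pair of words. When the pairs are grouped by
  their letter counts \<open>k\<close> and \<open>l\<close>, additivity of inversions up to
  \<open>crossing n k l\<close> produces the twist of the quantum product.\<close>

lemma qpi_conv: "qpi n q (conv a b) = qmult n q (qpi n q a) (qpi n q b)"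
proof
  fix m
  let ?P = "{(k, l). k \<in> multi_indices n \<and> l \<in> multi_indices n \<and> (\<lambda>i. k i + l i) = m}"
  let ?g = "\<lambda>\<beta> \<gamma>. inverse q ^ inversions (\<beta> @ \<gamma>) * a \<beta> * b \<gamma>"
  have "qpi n q (conv a b) m
      = (\<Sum>\<alpha>\<in>words_of n m. \<Sum>t\<le>length \<alpha>. ?g (take t \<alpha>) (drop t \<alpha>))"
    by (simp add: qpi_def conv_def sum_distrib_left mult.assoc)
  also have "\<dots> = (\<Sum>(\<alpha>, t)\<in>Sigma (words_of n m) (\<lambda>\<alpha>. {..length \<alpha>}). ?g (take t \<alpha>) (drop t \<alpha>))"
    by (rule sum.Sigma) (auto simp: finite_words_of)
  also have "\<dots> = (\<Sum>((k, l), (\<beta>, \<gamma>))\<in>Sigma ?P (\<lambda>(k, l). words_of n k \<times> words_of n l). ?g \<beta> \<gamma>)"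
    by (rule sum.reindex_bij_witness[of _ "\<lambda>((k, l), (\<beta>, \<gamma>)). (\<beta> @ \<gamma>, length \<beta>)"
          "\<lambda>(\<alpha>, t). ((count_list (take t \<alpha>), count_list (drop t \<alpha>)), (take t \<alpha>, drop t \<alpha>))"])
      (auto simp: words_of_def words_take words_drop count_list_multi_index
        simp flip: count_list_append_fun)
  also have "\<dots> = (\<Sum>(k, l)\<in>?P. \<Sum>(\<beta>, \<gamma>)\<in>words_of n k \<times> words_of n l. ?g \<beta> \<gamma>)"
    by (subst sum.Sigma[symmetric]) (auto simp: finite_mi_pairs finite_words_of intro!: sum.cong)
  also have "\<dots> = (\<Sum>(k, l)\<in>?P. inverse q ^ crossing n k l * qpi n q a k * qpi n q b l)"
  proof (rule sum.cong[OF refl], clarify)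
    fix k l
    have "(\<Sum>(\<beta>, \<gamma>)\<in>words_of n k \<times> words_of n l. ?g \<beta> \<gamma>)
        = (\<Sum>\<beta>\<in>words_of n k. \<Sum>\<gamma>\<in>words_of n l. inverse q ^ crossing n k l *
             ((inverse q ^ inversions \<beta> * a \<beta>) * (inverse q ^ inversions \<gamma> * b \<gamma>)))"
      unfolding sum.cartesian_product[symmetric]
      by (intro sum.cong refl) (auto simp: words_of_def inversions_append[of _ n] power_add mult_ac)
    also have "\<dots> = inverse q ^ crossing n k l * (qpi n q a k * qpi n q b l)"
      unfolding qpi_def sum_product by (simp add: sum_distrib_left)
    finally show "(\<Sum>(\<beta>, \<gamma>)\<in>words_of n k \<times> words_of n l. ?g \<beta> \<gamma>)
        = inverse q ^ crossing n k l * qpi n q a k * qpi n q b l" by (simp add: mult.assoc)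
  qed
  finally show "qpi n q (conv a b) m = qmult n q (qpi n q a) (qpi n q b) m"
    by (simp add: qmult_def)
qed

lemma quantum_alg_simps:
  "carrier (quantum_alg n q S P) = S" "mult (quantum_alg n q S P) = qmult n q"
  "one (quantum_alg n q S P) = (\<lambda>k. if k = (\<lambda>_. 0) then 1 else 0)" "zero (quantum_alg n q S P) = 0"
  "add (quantum_alg n q S P) = (+)" "smult (quantum_alg n q S P) = scal"
  "topol (quantum_alg n q S P) = seminorm_topology S P"
  by (simp_all add: quantum_alg_def qmult_def crossing_def zero_fun_def plus_fun_def scal_def fun_eq_iff)

lemma length_filter_sort: "length (filter P (sort xs)) = length (filter P xs)"
  by (metis mset_filter mset_sort size_mset)

section \<open>Sorting words modulo the defining relations\<close>

context graded_free_alg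
begin

definition I :: "(complex \<Rightarrow> nat list \<Rightarrow> complex) set" where
  "I = closed_ideal_gen A0 (def_relations n F)"

text \<open>Each exchange of two letters costs a factor \<open>inverse z\<close>; \<open>mon\<close>
  carries a word together with the factors collected so far.\<close>

definition mon :: "nat \<Rightarrow> nat list \<Rightarrow> complex \<Rightarrow> nat list \<Rightarrow> complex" where
  "mon m \<alpha> = (\<lambda>z\<in>Cx. scal (inverse z ^ m) (word_ind \<alpha>))"

lemma holomorphic_inverse_power: "(\<lambda>z. inverse z ^ m) holomorphic_on Cx"
  by (intro holomorphic_intros) (auto simp: Cx_def)

lemma mon_in_H: "\<alpha> \<in> words n \<Longrightarrow> mon m \<alpha> \<in> H"
  unfolding mon_def by (intro hol_scalar_in_H holomorphic_inverse_power word_ind_in_S)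

lemma mon_mult: "mon m \<alpha> \<otimes>\<^bsub>A0\<^esub> mon l \<beta> = mon (m + l) (\<alpha> @ \<beta>)"
  by (auto simp: mon_def fun_eq_iff conv_scal_left conv_scal_right conv_word_ind power_add mult.assoc)

lemma zeta_const_mon: "zeta_const i = mon 0 [i]"
  by (auto simp: zeta_const_def mon_def zeta_def word_ind_def scal_def fun_eq_iff)

lemma def_relation_eq:
  assumes "1 \<le> i" "i < j" "j \<le> n"
  shows "(zeta_const i \<otimes>\<^bsub>A0\<^esub> zeta_const j) \<ominus>\<^bsub>A0\<^esub> ((\<lambda>z. z) \<odot>\<^bsub>A0\<^esub> (zeta_const j \<otimes>\<^bsub>A0\<^esub> zeta_const i))
    = (\<lambda>z\<in>Cx. word_ind [i, j] - scal z (word_ind [j, i]))" (is ?eq)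
    "(\<lambda>z\<in>Cx. word_ind [i, j] - scal z (word_ind [j, i])) \<in> H" (is ?in)
proof -
  have a: "mon 0 [i, j] \<in> H" "mon 0 [j, i] \<in> H" using assms by (auto intro!: mon_in_H)
  have b: "(\<lambda>z. z) \<odot>\<^bsub>A0\<^esub> mon 0 [j, i] \<in> H"
    using H_smult[OF _ a(2), of "\<lambda>z. z"] by simp
  show ?eq
    unfolding zeta_const_mon mon_mult using A0_minus[of "mon 0 [i, j]" "(\<lambda>z. z) \<odot>\<^bsub>A0\<^esub> mon 0 [j, i]"] a b
    by (auto simp: mon_def scal_def fun_eq_iff)
  then show ?in
    using AR.minus_closed[of "mon 0 [i, j]" "(\<lambda>z. z) \<odot>\<^bsub>A0\<^esub> mon 0 [j, i]"] a b
    unfolding zeta_const_mon mon_mult by simp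
qed

lemma def_relations_eq:
  "def_relations n F = {(\<lambda>z\<in>Cx. word_ind [i, j] - scal z (word_ind [j, i])) | i j. 1 \<le> i \<and> i < j \<and> j \<le> n}"
  unfolding def_relations_def using def_relation_eq(1) by (intro Collect_cong) metis

lemma def_relations_H: "def_relations n F \<subseteq> H"
  unfolding def_relations_eq using def_relation_eq(2) by auto

lemma ideal_I: "ideal I A0"
  unfolding I_def using closed_ideal_gen_ideal[OF ring_A0, of "def_relations n F"] def_relations_H by simp

sublocale I: ideal I A0
  by (rule ideal_I)

abbreviation cls :: "(complex \<Rightarrow> nat list \<Rightarrow> complex) \<Rightarrow> (complex \<Rightarrow> nat list \<Rightarrow> complex) set" where
  "cls f \<equiv> I +>\<^bsub>A0\<^esub> f"

abbreviation Q :: "(complex \<Rightarrow> complex, (complex \<Rightarrow> nat list \<Rightarrow> complex) set) top_alg" where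
  "Q \<equiv> quotient_alg A0 I"

lemma deformation_eq: "deformation n F = Q"
  by (simp add: deformation_def I_def)

lemma ring_Q: "ring Q"
  by (rule ring_quotient_alg[OF ideal_I])

lemma cls_hom: "cls \<in> ring_hom A0 Q"
  by (rule coset_ring_hom[OF ideal_I])

lemma cls_mult: "x \<in> H \<Longrightarrow> y \<in> H \<Longrightarrow> cls (x \<otimes>\<^bsub>A0\<^esub> y) = cls x \<otimes>\<^bsub>Q\<^esub> cls y"
  using ring_hom_mult[OF cls_hom] by simp

lemma cls_add: "x \<in> H \<Longrightarrow> y \<in> H \<Longrightarrow> cls (\<lambda>z\<in>Cx. x z + y z) = cls x \<oplus>\<^bsub>Q\<^esub> cls y"
  using ring_hom_add[OF cls_hom, of x y] by simp

lemma carrier_Q: "carrier Q = cls ` H"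
  by (simp add: quotient_alg_simps carrier_Quot)

text \<open>The relation is multiplied by \<open>inverse z\<close>, which is holomorphic because 0
  has been removed from the plane. Solved in this direction, it rewrites towards sorted
  words.\<close>

lemma cls_swap:
  assumes "1 \<le> i" "i < j" "j \<le> n"
  shows "cls (mon 0 [j, i]) = cls (mon 1 [i, j])"
proof -
  let ?r = "\<lambda>z\<in>Cx. word_ind [i, j] - scal z (word_ind [j, i])"
  have rI: "?r \<in> I"
    using closed_ideal_gen_incl[of "def_relations n F" A0] assms unfolding I_def def_relations_eq by blast
  have m: "mon 1 [] \<in> H" "mon 0 [j, i] \<in> H" "mon 1 [i, j] \<in> H" using assms by (auto intro!: mon_in_H)
  have "mon 1 [] \<otimes>\<^bsub>A0\<^esub> ?r \<in> I" using I.I_l_closed[OF rI, of "mon 1 []"] m by simp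
  also have "mon 1 [] \<otimes>\<^bsub>A0\<^esub> ?r = mon 1 [i, j] \<ominus>\<^bsub>A0\<^esub> mon 0 [j, i]"
    using m by (auto simp: A0_minus fun_eq_iff mon_def conv_scal_left conv_one_left Cx_def algebra_simps)
  finally show ?thesis using coset_eq_iff[OF ideal_I, of "mon 1 [i, j]" "mon 0 [j, i]"] m by simp
qed

text \<open>Allows rewriting inside a word: the class of a product depends only on the classes of
  its factors.\<close>

lemma cls_mon_append:
  assumes "cls (mon m \<beta>) = cls (mon m' \<beta>')" "\<alpha> \<in> words n" "\<beta> \<in> words n" "\<beta>' \<in> words n" "\<gamma> \<in> words n"
  shows "cls (mon (l + m) (\<alpha> @ \<beta> @ \<gamma>)) = cls (mon (l + m') (\<alpha> @ \<beta>' @ \<gamma>))"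
proof -
  have "cls (mon (l + m) (\<alpha> @ \<beta> @ \<gamma>)) = cls (mon l \<alpha>) \<otimes>\<^bsub>Q\<^esub> (cls (mon m \<beta>) \<otimes>\<^bsub>Q\<^esub> cls (mon 0 \<gamma>))"
    if "\<beta> \<in> words n" for m \<beta>
    using that assms(2,5) mon_mult[of m \<beta> 0 \<gamma>] mon_mult[of l \<alpha> m "\<beta> @ \<gamma>"]
    by (simp add: cls_mult[symmetric] mon_in_H del: hol_alg_simps)
  then show ?thesis using assms by simp
qed

text \<open>In the sorted word \<open>\<gamma>\<close> the letters smaller than \<open>i\<close>
  form an initial segment; \<open>i\<close> is moved past exactly these, one exchange each.\<close>

lemma cls_mon_insort:
  assumes "sorted \<gamma>" "\<gamma> \<in> words n" "1 \<le> i" "i \<le> n"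
  shows "cls (mon 0 (i # \<gamma>)) = cls (mon (length (filter (\<lambda>b. b < i) \<gamma>)) (insort i \<gamma>))"
  using assms(1,2)
proof (induction \<gamma>)
  case Nil
  then show ?case by simp
next
  case (Cons j \<gamma>)
  show ?case
  proof (cases "i \<le> j")
    case True
    then have "filter (\<lambda>b. b < i) (j # \<gamma>) = []" using Cons.prems(1) by (auto simp: filter_empty_conv)
    then show ?thesis using True by (metis insort_key.simps(2) list.size(3))
  next
    case False
    have w: "insort i \<gamma> \<in> words n" using Cons.prems assms(3,4) by (auto simp: words_def set_insort_key)
    have "cls (mon 0 (i # j # \<gamma>)) = cls (mon 1 (j # i # \<gamma>))"
      using cls_mon_append[OF cls_swap[of j i], of "[]" \<gamma> 0] False Cons.prems assms(3,4) by simp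
    also have "\<dots> = cls (mon (1 + length (filter (\<lambda>b. b < i) \<gamma>)) (j # insort i \<gamma>))"
      using cls_mon_append[OF Cons.IH, of "[j]" "[]" 1] Cons.prems assms(3,4) w by simp
    finally show ?thesis using False by simp
  qed
qed

text \<open>Insertion sort follows the recursion of \<open>inversions\<close>: the number of letters
  of \<open>\<beta>\<close> below \<open>i\<close> is the same after \<open>\<beta>\<close> has been
  sorted.\<close>

lemma cls_mon_sort: "\<alpha> \<in> words n \<Longrightarrow> cls (mon 0 \<alpha>) = cls (mon (inversions \<alpha>) (sort \<alpha>))"
proof (induction \<alpha>)
  case Nil
  then show ?case by simp
next
  case (Cons i \<beta>)
  have w: "sort \<beta> \<in> words n" "insort i (sort \<beta>) \<in> words n" using Cons.prems by (auto simp: words_def set_insort_key)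
  have "cls (mon 0 (i # \<beta>)) = cls (mon (inversions \<beta>) (i # sort \<beta>))"
    using cls_mon_append[OF Cons.IH, of "[i]" "[]" 0] Cons.prems w by simp
  also have "\<dots> = cls (mon (inversions \<beta> + length (filter (\<lambda>b. b < i) \<beta>)) (insort i (sort \<beta>)))"
    using cls_mon_append[OF cls_mon_insort[of "sort \<beta>" i], of "[]" "[]" "inversions \<beta>"] Cons.prems w
    by (simp add: length_filter_sort)
  finally show ?case by (simp add: add.commute)
qed

end

section \<open>The kernel of the evaluation map\<close>

context graded_seminorms
begin

text \<open>A nonzero coefficient of \<open>x\<close> keeps a ball around \<open>x\<close> away from
  0. The purpose is that kernels of continuous homomorphisms into such a space are closed.\<close>

lemma closedin_zero: "closedin T {0}"
  unfolding closedin_def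
proof
  show "{0} \<subseteq> topspace T" by (simp add: S_zero)
  show "openin T (topspace T - {0})"
    unfolding openin_T
  proof (intro conjI ballI)
    fix x assume x: "x \<in> topspace T - {0}"
    then have xS: "x \<in> S" and "x \<noteq> 0" by auto
    then obtain k where k: "x k \<noteq> 0" by (auto simp: fun_eq_iff)
    then have "k \<in> W" using S_supp[OF xS] by blast
    then obtain i C where i: "i \<in> Idx" "C > 0" "\<And>a. a \<in> S \<Longrightarrow> cmod (a k) \<le> C * nrm i a"
      using coeff_bound by blast
    have "y \<noteq> 0" if "y \<in> S" "nrm i (y - x) < cmod (x k) / C" for y
    proof
      assume "y = 0"
      then have "C * nrm i x < cmod (x k)"
        using that i(1,2) nrm_uminus[OF i(1) xS] by (simp add: field_simps)
      then show False using i(3)[OF xS] by simp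
    qed
    then show "\<exists>i\<in>Idx. \<exists>\<epsilon>>0. \<forall>y\<in>S. nrm i (y - x) < \<epsilon> \<longrightarrow> y \<in> topspace T - {0}"
      using i(1,2) k by (intro bexI[of _ i] exI[of _ "cmod (x k) / C"]) auto
  qed auto
qed

lemma nrm_continuous:
  assumes i: "i \<in> Idx"
  shows "continuous_map T euclideanreal (nrm i)"
  unfolding continuous_map_def
proof (intro conjI allI impI)
  fix U :: "real set" assume "openin euclideanreal U"
  then have U: "open U" by simp
  show "openin T {x \<in> topspace T. nrm i x \<in> U}"
    unfolding openin_T
  proof (intro conjI ballI)
    fix x assume x: "x \<in> {x \<in> topspace T. nrm i x \<in> U}"
    then obtain e where e: "e > 0" "\<And>t. \<bar>t - nrm i x\<bar> < e \<Longrightarrow> t \<in> U"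
      using U unfolding open_dist by (auto simp: dist_real_def)
    have "nrm i y \<in> U" if y: "y \<in> S" "nrm i (y - x) < e" for y
    proof (rule e(2))
      have xS: "x \<in> S" using x by simp
      have "nrm i y \<le> nrm i (y - x) + nrm i x" "nrm i x \<le> nrm i (x - y) + nrm i y"
        using nrm_add[OF i S_diff[OF y(1) xS] xS] nrm_add[OF i S_diff[OF xS y(1)] y(1)] by simp_all
      then show "\<bar>nrm i y - nrm i x\<bar> < e" using nrm_diff_commute[OF i xS y(1)] y(2) by linarith
    qed
    then show "\<exists>i'\<in>Idx. \<exists>\<epsilon>>0. \<forall>y\<in>S. nrm i' (y - x) < \<epsilon> \<longrightarrow> y \<in> {x \<in> topspace T. nrm i x \<in> U}"
      using i e(1) by (intro bexI[of _ i] exI[of _ e]) auto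
  qed auto
qed auto

end

text \<open>An additive map that is bounded degree by degree is bounded for the summed norms, hence
  continuous. The reordering map and its section are both of this kind, in opposite
  directions.\<close>

locale graded_map = X: graded_seminorms W deg Idx N + Y: graded_seminorms W' deg' Idx' N'
  for W :: "'k set" and deg and Idx :: "'i set" and N
    and W' :: "'l set" and deg' and Idx' :: "'j set" and N' +
  fixes L :: "('k \<Rightarrow> complex) \<Rightarrow> ('l \<Rightarrow> complex)"
  assumes L_diff: "L (a - b) = L a - L b"
    and L_supp: "a \<in> X.S \<Longrightarrow> k \<notin> W' \<Longrightarrow> L a k = 0"
    and L_bound: "j \<in> Idx' \<Longrightarrow> \<exists>i\<in>Idx. \<exists>C. \<forall>d. \<forall>a\<in>X.S. N' j d (L a) \<le> C * N i d a"
begin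

lemma L_S: assumes a: "a \<in> X.S" shows "L a \<in> Y.S"
  unfolding Y.S_def
proof (clarsimp, intro conjI allI impI ballI)
  show "L a k = 0" if "k \<notin> W'" for k using a that by (rule L_supp)
  fix j assume j: "j \<in> Idx'"
  obtain i C where i: "i \<in> Idx" "\<And>d. N' j d (L a) \<le> C * N i d a" using L_bound[OF j] a by blast
  show "summable (\<lambda>d. N' j d (L a))"
    by (rule summable_comparison_test'[of "\<lambda>d. C * N i d a" 0])
      (use i j a in \<open>auto intro: summable_mult X.S_summable simp: Y.N_nonneg\<close>)
qed

lemma nrm_L:
  assumes j: "j \<in> Idx'"
  shows "\<exists>i\<in>Idx. \<exists>C>0. \<forall>a\<in>X.S. Y.nrm j (L a) \<le> C * X.nrm i a"
proof -
  obtain i C where i: "i \<in> Idx" "\<And>d a. a \<in> X.S \<Longrightarrow> N' j d (L a) \<le> C * N i d a" using L_bound[OF j] by blast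
  have "Y.nrm j (L a) \<le> (\<bar>C\<bar> + 1) * X.nrm i a" if a: "a \<in> X.S" for a
  proof -
    have "N' j d (L a) \<le> (\<bar>C\<bar> + 1) * N i d a" for d
      by (rule order.trans[OF i(2)[OF a]]) (use i(1) in \<open>auto intro!: mult_right_mono X.N_nonneg\<close>)
    then have "Y.nrm j (L a) \<le> (\<Sum>d. (\<bar>C\<bar> + 1) * N i d a)"
      unfolding Y.nrm_def
      by (rule suminf_le) (use a i(1) j in \<open>auto intro!: summable_mult X.S_summable Y.S_summable L_S\<close>)
    also have "\<dots> = (\<bar>C\<bar> + 1) * X.nrm i a"
      unfolding X.nrm_def by (rule suminf_mult) (rule X.S_summable[OF a i(1)])
    finally show ?thesis .
  qed
  then show ?thesis using i(1) by (intro bexI[of _ i] exI[of _ "\<bar>C\<bar> + 1"]) auto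
qed

lemma L_continuous: "continuous_map X.T Y.T L"
  unfolding continuous_map_def
proof (intro conjI allI impI)
  show "L \<in> topspace X.T \<rightarrow> topspace Y.T" by (auto simp: L_S)
  fix U assume U: "openin Y.T U"
  show "openin X.T {x \<in> topspace X.T. L x \<in> U}"
    unfolding X.openin_T
  proof (intro conjI ballI)
    fix x assume x: "x \<in> {x \<in> topspace X.T. L x \<in> U}"
    then obtain j \<epsilon> where j: "j \<in> Idx'" "\<epsilon> > 0" "\<And>y. y \<in> Y.S \<Longrightarrow> Y.nrm j (y - L x) < \<epsilon> \<Longrightarrow> y \<in> U"
      using U unfolding Y.openin_T by blast
    obtain i C where i: "i \<in> Idx" "C > 0" "\<And>a. a \<in> X.S \<Longrightarrow> Y.nrm j (L a) \<le> C * X.nrm i a"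
      using nrm_L[OF j(1)] by blast
    have "L y \<in> U" if y: "y \<in> X.S" "X.nrm i (y - x) < \<epsilon> / C" for y
    proof (rule j(3)[OF L_S[OF y(1)]])
      have "Y.nrm j (L (y - x)) \<le> C * X.nrm i (y - x)" using i(3) y(1) x X.S_diff by auto
      also have "\<dots> < \<epsilon>" using y(2) i(2) by (simp add: field_simps)
      finally show "Y.nrm j (L y - L x) < \<epsilon>" by (simp add: L_diff)
    qed
    then show "\<exists>i\<in>Idx. \<exists>\<epsilon>>0. \<forall>y\<in>X.S. X.nrm i (y - x) < \<epsilon> \<longrightarrow> y \<in> {x \<in> topspace X.T. L x \<in> U}"
      using i(1,2) j(2) by (intro bexI[of _ i] exI[of _ "\<epsilon> / C"]) auto
  qed auto
qed

end

section \<open>Normal forms of truncations modulo the relations\<close>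

context graded_free_alg
begin

text \<open>Two representatives differ by an element of \<open>I\<close>, and multiplying that
  element by \<open>h\<close> is multiplication by \<open>h\<close> times the unit, which the ideal
  absorbs.\<close>

lemma smult_Q:
  assumes h: "h holomorphic_on Cx" and f: "f \<in> H"
  shows "h \<odot>\<^bsub>Q\<^esub> cls f = cls (\<lambda>z\<in>Cx. scal (h z) (f z))"
proof -
  have "h \<odot>\<^bsub>Q\<^esub> cls f = cls (h \<odot>\<^bsub>A0\<^esub> f)"
  proof (rule smult_quotient_coset[OF ideal_I])
    show "f \<in> carrier A0" using f by simp
    fix y assume y: "y \<in> cls f"
    obtain i where i: "i \<in> I" "y = i \<oplus>\<^bsub>A0\<^esub> f" using y by (auto simp: a_r_coset_def')
    have iH: "i \<in> H" using i(1) I.a_subset by auto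
    let ?u = "\<lambda>z\<in>Cx. scal (h z) (word_ind [])"
    have u: "?u \<in> H" using h by (intro hol_scalar_in_H word_ind_in_S) auto
    have yH: "y \<in> H" using i iH f H_add by auto
    have "?u \<otimes>\<^bsub>A0\<^esub> i \<in> I" by (rule I.I_l_closed[OF i(1) u[folded hol_alg_simps(1)]])
    moreover have "?u \<otimes>\<^bsub>A0\<^esub> i = (h \<odot>\<^bsub>A0\<^esub> y) \<ominus>\<^bsub>A0\<^esub> (h \<odot>\<^bsub>A0\<^esub> f)"
    proof -
      have "(h \<odot>\<^bsub>A0\<^esub> y) \<ominus>\<^bsub>A0\<^esub> (h \<odot>\<^bsub>A0\<^esub> f) = (\<lambda>z\<in>Cx. scal (h z) (y z) - scal (h z) (f z))"
        using A0_minus[OF H_smult[OF h yH] H_smult[OF h f]] by (simp cong: restrict_cong)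
      also have "\<dots> = ?u \<otimes>\<^bsub>A0\<^esub> i"
        unfolding i(2) by (auto simp: fun_eq_iff conv_scal_left conv_one_left algebra_simps)
      finally show ?thesis by (rule sym)
    qed
    ultimately show "cls (h \<odot>\<^bsub>A0\<^esub> y) = cls (h \<odot>\<^bsub>A0\<^esub> f)"
      using coset_eq_iff[OF ideal_I] H_smult[OF h yH] H_smult[OF h f] by simp
  qed
  then show ?thesis by simp
qed

text \<open>Serves to cut a truncation into the parts with given letter counts.\<close>

definition rst :: "nat list set \<Rightarrow> (complex \<Rightarrow> nat list \<Rightarrow> complex) \<Rightarrow> complex \<Rightarrow> nat list \<Rightarrow> complex" where
  "rst X f = (\<lambda>z\<in>Cx. \<lambda>\<alpha>. if \<alpha> \<in> X then f z \<alpha> else 0)"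

lemma rst_empty: "rst {} f = \<zero>\<^bsub>A0\<^esub>"
  by (simp add: rst_def zero_fun_def cong: restrict_cong)

lemma rst_Un: "X \<inter> Y = {} \<Longrightarrow> rst (X \<union> Y) f = (\<lambda>z\<in>Cx. rst X f z + rst Y f z)"
  by (auto simp: rst_def fun_eq_iff)

lemma rst_insert: "\<alpha> \<notin> X \<Longrightarrow> rst (insert \<alpha> X) f = (\<lambda>z\<in>Cx. rst {\<alpha>} f z + rst X f z)"
  using rst_Un[of "{\<alpha>}" X f] by simp

lemma rst_single: "rst {\<alpha>} f = (\<lambda>z\<in>Cx. scal (f z \<alpha>) (word_ind \<alpha>))"
  by (auto simp: rst_def fun_eq_iff word_ind_def)

lemma rst_single_in_H: "f \<in> H \<Longrightarrow> \<alpha> \<in> words n \<Longrightarrow> rst {\<alpha>} f \<in> H"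
  unfolding rst_single by (intro hol_scalar_in_H coeff_holomorphic word_ind_in_S)

lemma rst_in_H:
  assumes "finite X" "X \<subseteq> words n" "f \<in> H"
  shows "rst X f \<in> H"
  using assms(1,2)
proof (induction X)
  case empty
  show ?case unfolding rst_empty using AR.zero_closed by (simp only: hol_alg_simps(1))
next
  case (insert \<alpha> X)
  show ?case
    unfolding rst_insert[OF insert.hyps(2)]
    by (intro H_add rst_single_in_H insert.IH assms(3)) (use insert.prems in auto)
qed

lemma cls_term:
  assumes h: "h holomorphic_on Cx" and a: "\<alpha> \<in> words n"
  shows "cls (\<lambda>z\<in>Cx. scal (h z) (word_ind \<alpha>)) = cls (\<lambda>z\<in>Cx. scal (h z * inverse z ^ inversions \<alpha>) (word_ind (sort \<alpha>)))"
proof -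
  let ?u = "\<lambda>z\<in>Cx. scal (h z) (word_ind [])"
  have u: "?u \<in> H" using h by (intro hol_scalar_in_H word_ind_in_S) auto
  have s: "sort \<alpha> \<in> words n" using a by (auto simp: words_def)
  have "(\<lambda>z\<in>Cx. scal (h z) (word_ind \<alpha>)) = ?u \<otimes>\<^bsub>A0\<^esub> mon 0 \<alpha>"
    by (auto simp: mon_def fun_eq_iff conv_scal_left conv_scal_right conv_one_left)
  moreover have "(\<lambda>z\<in>Cx. scal (h z * inverse z ^ inversions \<alpha>) (word_ind (sort \<alpha>))) = ?u \<otimes>\<^bsub>A0\<^esub> mon (inversions \<alpha>) (sort \<alpha>)"
    by (auto simp: mon_def fun_eq_iff conv_scal_left conv_scal_right conv_one_left mult_ac)
  ultimately show ?thesis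
    using cls_mult[OF u mon_in_H[OF a]] cls_mult[OF u mon_in_H[OF s]] cls_mon_sort[OF a] by simp
qed

lemma sort_words_of: "\<alpha> \<in> words_of n k \<Longrightarrow> \<beta> \<in> words_of n k \<Longrightarrow> sort \<alpha> = sort \<beta>"
proof -
  assume "\<alpha> \<in> words_of n k" "\<beta> \<in> words_of n k"
  then have "mset \<alpha> = mset \<beta>"
    by (intro multiset_eqI) (simp add: words_of_def count_mset)
  then show ?thesis by (metis mset_sort properties_for_sort sorted_sort)
qed

text \<open>The coefficient of the common sorted word once all words of \<open>X\<close> have been
  sorted. For \<open>X = words_of n k\<close> its value at \<open>q\<close> is
  \<open>qpi n q (f q) k\<close>.\<close>

definition nf_coeff :: "nat list set \<Rightarrow> (complex \<Rightarrow> nat list \<Rightarrow> complex) \<Rightarrow> complex \<Rightarrow> complex" where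
  "nf_coeff X f z = (\<Sum>\<alpha>\<in>X. f z \<alpha> * inverse z ^ inversions \<alpha>)"

lemma nf_coeff_holomorphic:
  assumes "X \<subseteq> words n" "f \<in> H"
  shows "nf_coeff X f holomorphic_on Cx"
  unfolding nf_coeff_def
  by (intro holomorphic_on_sum holomorphic_on_mult coeff_holomorphic holomorphic_inverse_power) (use assms in auto)

text \<open>All words with the same letter counts sort to one word, so their coefficients, each with
  its power of \<open>inverse z\<close>, can be added.\<close>

lemma cls_rst:
  assumes "finite X" "X \<subseteq> words_of n k" "\<beta> \<in> words_of n k" "f \<in> H"
  shows "cls (rst X f) = cls (\<lambda>z\<in>Cx. scal (nf_coeff X f z) (word_ind (sort \<beta>)))"
  using assms(1,2)
proof (induction X)
  case empty
  show ?case by (simp add: rst_empty nf_coeff_def scal_def zero_fun_def cong: restrict_cong)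
next
  case (insert \<alpha> X)
  have w: "\<alpha> \<in> words n" "X \<subseteq> words n" "sort \<beta> \<in> words n"
    using insert.prems assms(3) by (auto simp: words_of_def words_def)
  let ?g = "\<lambda>X. \<lambda>z\<in>Cx. scal (nf_coeff X f z) (word_ind (sort \<beta>))"
  have g: "?g X \<in> H" if "X \<subseteq> words n" for X
    using that assms(4) w(3) by (intro hol_scalar_in_H nf_coeff_holomorphic word_ind_in_S)
  have "cls (rst (insert \<alpha> X) f) = cls (\<lambda>z\<in>Cx. rst {\<alpha>} f z + rst X f z)"
    using rst_Un[of "{\<alpha>}" X f] insert.hyps by simp
  also have "\<dots> = cls (rst {\<alpha>} f) \<oplus>\<^bsub>Q\<^esub> cls (rst X f)"
    by (intro cls_add rst_in_H) (use w assms(4) insert.hyps in auto)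
  also have "cls (rst X f) = cls (?g X)" by (rule insert.IH) (use insert.prems in simp)
  also have "cls (rst {\<alpha>} f) = cls (?g {\<alpha>})"
    unfolding rst_single using cls_term[OF coeff_holomorphic[OF assms(4) w(1)] w(1)]
      sort_words_of[of \<alpha> k \<beta>] insert.prems assms(3) by (simp add: nf_coeff_def)
  also have "cls (?g {\<alpha>}) \<oplus>\<^bsub>Q\<^esub> cls (?g X) = cls (\<lambda>z\<in>Cx. ?g {\<alpha>} z + ?g X z)"
    by (rule cls_add[OF g g, symmetric]) (use w in auto)
  also have "(\<lambda>z\<in>Cx. ?g {\<alpha>} z + ?g X z) = ?g (insert \<alpha> X)"
    using insert.hyps by (auto simp: nf_coeff_def fun_eq_iff algebra_simps)
  finally show ?case .
qed

text \<open>Kept apart from its closure \<open>fiber_ideal Q q\<close> because classes of suitable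
  truncations lie in it exactly, without any limit.\<close>

definition Gen :: "complex \<Rightarrow> (complex \<Rightarrow> nat list \<Rightarrow> complex) set set" where
  "Gen q = generate (add_monoid Q) {f \<odot>\<^bsub>Q\<^esub> a | f a. f \<in> max_ideal q \<and> a \<in> carrier Q}"

lemma zero_Gen: "cls \<zero>\<^bsub>A0\<^esub> \<in> Gen q"
proof -
  have "cls \<zero>\<^bsub>A0\<^esub> = \<zero>\<^bsub>Q\<^esub>"
    by (rule ring_hom_zero[OF cls_hom ring_A0 ring_Q])
  then show ?thesis unfolding Gen_def using generate.one[of "add_monoid Q"] by simp
qed

text \<open>The normal-form coefficient vanishes at \<open>q\<close>, so the class is a single
  product of an element of \<open>max_ideal q\<close> with the class of the sorted word.\<close>

lemma cls_rst_words_of_Gen: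
  assumes f: "f \<in> H" and 0: "qpi n q (f q) k = 0"
  shows "cls (rst (words_of n k) f) \<in> Gen q"
proof (cases "words_of n k = {}")
  case True
  then show ?thesis using zero_Gen by (simp only: rst_empty)
next
  case False
  then obtain \<beta> where b: "\<beta> \<in> words_of n k" by blast
  have s: "sort \<beta> \<in> words n" using b by (auto simp: words_of_def words_def)
  let ?h = "nf_coeff (words_of n k) f"
  have h: "?h holomorphic_on Cx" by (rule nf_coeff_holomorphic) (use f in \<open>auto simp: words_of_def\<close>)
  have "cls (rst (words_of n k) f) = cls (\<lambda>z\<in>Cx. scal (?h z) (word_ind (sort \<beta>)))"
    by (rule cls_rst[OF finite_words_of subset_refl b f])
  also have "\<dots> = ?h \<odot>\<^bsub>Q\<^esub> cls (mon 0 (sort \<beta>))"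
    unfolding smult_Q[OF h mon_in_H[OF s]] by (simp add: mon_def scal_def cong: restrict_cong)
  also have "\<dots> \<in> Gen q"
    unfolding Gen_def
  proof (rule generate.incl, intro CollectI exI[of _ ?h] exI[of _ "cls (mon 0 (sort \<beta>))"] conjI refl)
    have "?h q = 0" using 0 by (simp add: nf_coeff_def qpi_def mult.commute)
    then show "?h \<in> max_ideal q" using h by (simp add: max_ideal_def)
    show "cls (mon 0 (sort \<beta>)) \<in> carrier Q" unfolding carrier_Q using mon_in_H[OF s] by blast
  qed
  finally show ?thesis .
qed

lemma cls_rst_Union_Gen:
  assumes f: "f \<in> H" and 0: "qpi n q (f q) = 0" and "finite Ks"
  shows "cls (rst (\<Union>k\<in>Ks. words_of n k) f) \<in> Gen q"
  using assms(3)
proof (induction Ks)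
  case empty
  then show ?case using zero_Gen by (simp only: rst_empty UN_empty)
next
  case (insert k Ks)
  have w: "words_of n l \<subseteq> words n" for l by (auto simp: words_of_def)
  have "rst (\<Union>k\<in>insert k Ks. words_of n k) f = (\<lambda>z\<in>Cx. rst (words_of n k) f z + rst (\<Union>k\<in>Ks. words_of n k) f z)"
    unfolding UN_insert by (rule rst_Un) (use insert.hyps in \<open>auto simp: words_of_def\<close>)
  then have "cls (rst (\<Union>k\<in>insert k Ks. words_of n k) f)
      = cls (\<lambda>z\<in>Cx. rst (words_of n k) f z + rst (\<Union>k\<in>Ks. words_of n k) f z)" by simp
  also have "\<dots> = cls (rst (words_of n k) f) \<oplus>\<^bsub>Q\<^esub> cls (rst (\<Union>k\<in>Ks. words_of n k) f)"
    by (intro cls_add rst_in_H) (use w f insert.hyps finite_words_of in auto)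
  also have "\<dots> \<in> Gen q"
    using generate.eng[OF cls_rst_words_of_Gen[OF f, of q k, unfolded Gen_def] insert.IH[unfolded Gen_def]] 0
    unfolding Gen_def by simp
  finally show ?case .
qed

text \<open>Letter counts determine the length, so a truncation by degree consists of complete
  classes \<open>words_of n k\<close>. The vanishing of the image of \<open>f\<close> therefore
  passes to every truncation.\<close>

lemma trunc_rst:
  "(\<lambda>z\<in>Cx. trunc m (f z)) = rst (\<Union>k\<in>count_list ` {\<alpha> \<in> words n. length \<alpha> \<le> m}. words_of n k) f"
proof -
  have "\<alpha> \<in> words n \<and> length \<alpha> \<le> m \<longleftrightarrow> \<alpha> \<in> (\<Union>k\<in>count_list ` {\<alpha> \<in> words n. length \<alpha> \<le> m}. words_of n k)" for \<alpha>
    by (auto simp: words_of_def simp flip: mi_deg_count_list)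
  then show ?thesis by (auto simp: rst_def trunc_def fun_eq_iff)
qed

lemma topspace_Q: "topspace (topol Q) = carrier Q"
  by (rule topspace_quotient) simp

lemma cls_continuous: "continuous_map (topol A0) (topol Q) cls"
  by (rule coset_continuous) simp

lemma kernel_subset_fiber_ideal:
  assumes f: "f \<in> H" and 0: "qpi n q (f q) = 0"
  shows "cls f \<in> fiber_ideal Q q"
  unfolding fiber_ideal_def in_closure_of Gen_def[symmetric]
proof (intro conjI allI impI)
  show "cls f \<in> topspace (topol Q)" using f by (simp add: topspace_Q carrier_Q)
  fix U assume U: "cls f \<in> U \<and> openin (topol Q) U"
  have open': "openin (topol A0) {g \<in> H. cls g \<in> U}"
    using openin_continuous_map_preimage[OF cls_continuous] U by simp
  have fin: "finite (count_list ` {\<alpha> \<in> words n. length \<alpha> \<le> m})" for m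
    using finite_deg_le by blast
  have t: "(\<lambda>z\<in>Cx. trunc m (f z)) \<in> H" for m
    unfolding trunc_rst by (rule rst_in_H[OF finite_UN_I[OF fin finite_words_of] _ f]) (auto simp: words_of_def)
  obtain m where "(\<lambda>z\<in>Cx. trunc m (f z)) \<in> {g \<in> H. cls g \<in> U}"
    using trunc_dense[OF open' _ t] f U by blast
  moreover have "cls (\<lambda>z\<in>Cx. trunc m (f z)) \<in> Gen q"
    unfolding trunc_rst by (rule cls_rst_Union_Gen[OF f 0 fin])
  ultimately show "\<exists>y. y \<in> Gen q \<and> y \<in> U" by blast
qed

end

section \<open>The fiber as the image of evaluation at \<open>q\<close>\<close>

definition qsec :: "nat \<Rightarrow> (nat list \<Rightarrow> complex) \<Rightarrow> ((nat \<Rightarrow> nat) \<Rightarrow> complex) \<Rightarrow> nat list \<Rightarrow> complex" where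
  "qsec n \<sigma> f \<alpha> = (if \<alpha> \<in> words n then \<sigma> \<alpha> * f (count_list \<alpha>) else 0)"

text \<open>Collects what has to be checked for each concrete algebra. \<open>qpi_bound\<close>
  makes evaluation followed by reordering continuous; \<open>qsec_bound\<close> and
  \<open>qsec_normalized\<close> give it a continuous right inverse, which spreads the coefficient
  of \<open>x^k\<close> over the words with letter counts \<open>k\<close> with weights
  \<open>\<sigma>\<close>.\<close>

locale deformation_fiber = graded_free_alg n Idx N
    + B: graded_seminorms "multi_indices n" "mi_deg n" Jdx M
  for n :: nat and Idx :: "'i set" and N and Jdx :: "'j set" and M +
  fixes q :: complex and \<sigma> :: "nat list \<Rightarrow> complex"
  assumes q: "q \<in> Cx"
    and qpi_bound: "j \<in> Jdx \<Longrightarrow> \<exists>i\<in>Idx. \<exists>C. \<forall>d. \<forall>a\<in>S. M j d (qpi n q a) \<le> C * N i d a"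
    and qsec_bound: "i \<in> Idx \<Longrightarrow> \<exists>j\<in>Jdx. \<exists>C. \<forall>d. \<forall>f\<in>B.S. N i d (qsec n \<sigma> f) \<le> C * M j d f"
    and qsec_normalized: "k \<in> multi_indices n \<Longrightarrow> (\<Sum>\<alpha>\<in>words_of n k. inverse q ^ inversions \<alpha> * \<sigma> \<alpha>) = 1"
begin

definition Bq :: "(complex, (nat \<Rightarrow> nat) \<Rightarrow> complex) top_alg" where
  "Bq = quantum_alg n q B.S B.P"

lemma Bq_simps [simp]:
  "carrier Bq = B.S" "mult Bq = qmult n q" "one Bq = (\<lambda>k. if k = (\<lambda>_. 0) then 1 else 0)"
  "zero Bq = 0" "add Bq = (+)" "smult Bq = scal" "topol Bq = B.T"
  by (simp_all add: Bq_def quantum_alg_simps B.T_def)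

sublocale pi: graded_map "words n" length Idx N "multi_indices n" "mi_deg n" Jdx M "qpi n q"
proof unfold_locales
  show "qpi n q (a - b) = qpi n q a - qpi n q b" for a b by (rule qpi_diff)
  show "qpi n q a k = 0" if "k \<notin> multi_indices n" for a k using that by (rule qpi_supp)
qed (rule qpi_bound)

sublocale sec: graded_map "multi_indices n" "mi_deg n" Jdx M "words n" length Idx N "qsec n \<sigma>"
proof unfold_locales
  show "qsec n \<sigma> (a - b) = qsec n \<sigma> a - qsec n \<sigma> b" for a b
    by (simp add: qsec_def fun_eq_iff algebra_simps)
  show "qsec n \<sigma> a \<alpha> = 0" if "\<alpha> \<notin> words n" for a \<alpha> using that by (simp add: qsec_def)
qed (rule qsec_bound)

lemma qpi_qsec: "f \<in> B.S \<Longrightarrow> qpi n q (qsec n \<sigma> f) = f"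
proof
  fix k assume f: "f \<in> B.S"
  have "qpi n q (qsec n \<sigma> f) k = (\<Sum>\<alpha>\<in>words_of n k. inverse q ^ inversions \<alpha> * \<sigma> \<alpha>) * f k"
    unfolding qpi_def sum_distrib_right by (rule sum.cong) (auto simp: qsec_def words_of_def)
  then show "qpi n q (qsec n \<sigma> f) k = f k"
    using qsec_normalized[of k] B.S_supp[OF f, of k] by (cases "k \<in> multi_indices n") auto
qed

definition ev :: "(complex \<Rightarrow> nat list \<Rightarrow> complex) \<Rightarrow> (nat \<Rightarrow> nat) \<Rightarrow> complex" where
  "ev f = qpi n q (f q)"

lemma ev_hom: "ev \<in> ring_hom A0 Bq"
proof (rule ring_hom_memI)
  show "ev \<one>\<^bsub>A0\<^esub> = \<one>\<^bsub>Bq\<^esub>" by (auto simp: ev_def q qpi_word_ind fun_eq_iff)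
qed (simp_all add: ev_def q H_S pi.L_S qpi_conv qpi_add)

lemma ev_qsec: "f \<in> B.S \<Longrightarrow> (\<lambda>z\<in>Cx. qsec n \<sigma> f) \<in> H \<and> ev (\<lambda>z\<in>Cx. qsec n \<sigma> f) = f"
  by (simp add: ev_def q qpi_qsec const_in_H sec.L_S)

lemma ev_surj: "ev ` H = B.S"
proof
  show "ev ` H \<subseteq> B.S" using ev_hom by (auto simp: ring_hom_def)
  show "B.S \<subseteq> ev ` H" using ev_qsec by (metis imageI subsetI)
qed

lemma ev_smult: "ev (\<lambda>z\<in>Cx. scal (h z) (f z)) = scal (h q) (ev f)"
  by (simp add: ev_def q qpi_scal)

text \<open>The quantum algebra is the image of \<open>ev\<close>, which respects the operations, so
  the ring axioms are inherited and associativity need not be verified on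
  \<open>qmult\<close>.\<close>

lemma ring_Bq: "ring Bq"
proof (rule ring_cong_ops[OF AR.ring_hom_imp_img_ring[OF ev_hom]])
  have "ev \<zero>\<^bsub>A0\<^esub> = 0" by (simp add: ev_def q qpi_def fun_eq_iff)
  then show "\<zero>\<^bsub>Bq\<^esub> = \<zero>\<^bsub>Bq\<lparr>carrier := ev ` carrier A0, zero := ev \<zero>\<^bsub>A0\<^esub>\<rparr>\<^esub>" by simp
qed (simp_all add: ev_surj)

lemma ev_continuous: "continuous_map (topol A0) B.T ev"
  using continuous_map_compose[OF eval_continuous[OF q] pi.L_continuous] by (simp add: ev_def[abs_def] o_def)

lemma ev_hom_ring: "ring_hom_ring A0 Bq ev"
  by (rule ring_hom_ringI2[OF ring_A0 ring_Bq ev_hom])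

text \<open>\<open>I\<close> is the smallest closed ideal containing the relations, and the kernel
  of a continuous homomorphism into a Hausdorff algebra is a closed ideal; only the relations have
  to be evaluated.\<close>

lemma I_subset_kernel: "f \<in> I \<Longrightarrow> ev f = 0"
proof -
  have "I \<subseteq> a_kernel A0 Bq ev"
    unfolding I_def
  proof (rule closed_ideal_gen_least)
    show "ideal (a_kernel A0 Bq ev) A0" by (rule ring_hom_ring.kernel_is_ideal[OF ev_hom_ring])
    show "closedin (topol A0) (a_kernel A0 Bq ev)"
      using closedin_continuous_map_preimage[OF ev_continuous B.closedin_zero] by (simp add: a_kernel_def')
    show "def_relations n F \<subseteq> a_kernel A0 Bq ev"
    proof
      fix f assume f: "f \<in> def_relations n F"
      then obtain i j where ij: "1 \<le> i" "i < j" "j \<le> n"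
          "f = (\<lambda>z\<in>Cx. word_ind [i, j] - scal z (word_ind [j, i]))"
        unfolding def_relations_eq by blast
      have c: "count_list [j, i] = count_list [i, j]" by auto
      have e1: "qpi n q (word_ind [i, j]) = (\<lambda>k. if k = count_list [i, j] then 1 else 0)"
        using ij by (subst qpi_word_ind) auto
      have e2: "qpi n q (word_ind [j, i]) = (\<lambda>k. if k = count_list [i, j] then inverse q else 0)"
        using ij by (subst qpi_word_ind) (auto simp del: count_list.simps simp: c)
      have e3: "f q = word_ind [i, j] - scal q (word_ind [j, i])" using ij(4) q by simp
      \<comment> \<open>The word \<open>[j, i]\<close> has one inversion, whose factor
        \<open>inverse q\<close> cancels the scalar \<open>q\<close>.\<close>
      have "ev f = 0"
        unfolding ev_def e3 qpi_diff qpi_scal e1 e2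
        by (rule ext) (use q in \<open>simp add: Cx_def del: count_list.simps\<close>)
      then show "f \<in> a_kernel A0 Bq ev" using f def_relations_H by (auto simp: a_kernel_def')
    qed
  qed
  then show "f \<in> I \<Longrightarrow> ev f = 0" by (auto simp: a_kernel_def')
qed

definition evQ :: "(complex \<Rightarrow> nat list \<Rightarrow> complex) set \<Rightarrow> (nat \<Rightarrow> nat) \<Rightarrow> complex" where
  "evQ = induced ev"

lemma evQ_cls: "f \<in> H \<Longrightarrow> evQ (cls f) = ev f"
  unfolding evQ_def using induced_coset[OF ring_A0 ideal_I ring_Bq ev_hom, of f] I_subset_kernel by simp

lemma evQ_hom: "evQ \<in> ring_hom Q Bq"
  unfolding evQ_def using induced_ring_hom[OF ring_A0 ideal_I ring_Bq ev_hom] I_subset_kernel by simp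

lemma evQ_continuous: "continuous_map (topol Q) B.T evQ"
  unfolding evQ_def
  using induced_continuous[OF ring_A0 ideal_I ring_Bq ev_hom _ ev_continuous] I_subset_kernel by simp

lemma evQ_hom_ring: "ring_hom_ring Q Bq evQ"
  by (rule ring_hom_ringI2[OF ring_Q ring_Bq evQ_hom])

definition J :: "(complex \<Rightarrow> nat list \<Rightarrow> complex) set set" where
  "J = fiber_ideal Q q"

text \<open>\<open>J\<close> is defined as the closure of an additive subgroup, and this equality is
  what shows it to be an ideal. The kernel is closed and contains the generators, which gives one
  inclusion; approximation by truncations gives the other.\<close>

lemma J_eq_kernel: "J = a_kernel Q Bq evQ"
proof
  have ideal: "ideal (a_kernel Q Bq evQ) Q" by (rule ring_hom_ring.kernel_is_ideal[OF evQ_hom_ring])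
  have "Gen q \<subseteq> a_kernel Q Bq evQ"
    unfolding Gen_def
  proof (rule group.generate_subgroup_incl)
    show "group (add_monoid Q)" by (rule abelian_group.a_group[OF ring.is_abelian_group[OF ring_Q]])
    show "subgroup (a_kernel Q Bq evQ) (add_monoid Q)"
      by (rule additive_subgroup.a_subgroup[OF ideal.axioms(1)[OF ideal]])
    show "{f \<odot>\<^bsub>Q\<^esub> a |f a. f \<in> max_ideal q \<and> a \<in> carrier Q} \<subseteq> a_kernel Q Bq evQ"
    proof clarify
      fix h a assume h: "h \<in> max_ideal q" and "a \<in> carrier Q"
      then obtain f where f: "f \<in> H" "a = cls f" by (auto simp: carrier_Q)
      have hh: "h holomorphic_on Cx" "h q = 0" using h by (auto simp: max_ideal_def)
      have "h \<odot>\<^bsub>Q\<^esub> a = cls (\<lambda>z\<in>Cx. scal (h z) (f z))" using smult_Q hh f by simp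
      then show "h \<odot>\<^bsub>Q\<^esub> a \<in> a_kernel Q Bq evQ"
        using H_smult[OF hh(1) f(1)] hh(2) by (auto simp: a_kernel_def' carrier_Q evQ_cls ev_smult fun_eq_iff)
    qed
  qed
  moreover have "closedin (topol Q) (a_kernel Q Bq evQ)"
    using closedin_continuous_map_preimage[OF evQ_continuous B.closedin_zero] by (simp add: a_kernel_def' topspace_Q)
  ultimately show "J \<subseteq> a_kernel Q Bq evQ"
    unfolding J_def fiber_ideal_def Gen_def[symmetric] by (rule closure_of_minimal)
  show "a_kernel Q Bq evQ \<subseteq> J"
    unfolding J_def
    using kernel_subset_fiber_ideal by (auto simp: a_kernel_def' carrier_Q evQ_cls ev_def)
qed

lemma ideal_J: "ideal J Q"
  unfolding J_eq_kernel by (rule ring_hom_ring.kernel_is_ideal[OF evQ_hom_ring])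

lemma J_zero: "X \<in> J \<Longrightarrow> evQ X = 0"
  by (simp add: J_eq_kernel a_kernel_def')

abbreviation clsJ :: "(complex \<Rightarrow> nat list \<Rightarrow> complex) set \<Rightarrow> (complex \<Rightarrow> nat list \<Rightarrow> complex) set set" where
  "clsJ X \<equiv> J +>\<^bsub>Q\<^esub> X"

lemma clsJ_eq: "X \<in> carrier Q \<Longrightarrow> clsJ X = {Y \<in> carrier Q. evQ Y = evQ X}"
  unfolding J_eq_kernel by (rule ring_hom_ring.rcos_eq_homeq[OF evQ_hom_ring])

lemma clsJ_eq_iff: "X \<in> carrier Q \<Longrightarrow> Y \<in> carrier Q \<Longrightarrow> clsJ X = clsJ Y \<longleftrightarrow> evQ X = evQ Y"
  using clsJ_eq[of X] clsJ_eq[of Y] by auto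

definition Fb :: "(complex, (complex \<Rightarrow> nat list \<Rightarrow> complex) set set) top_alg" where
  "Fb = fiber Q q"

lemma Fb_simps:
  "carrier Fb = clsJ ` carrier Q" "mult Fb = mult (quotient_alg Q J)" "one Fb = one (quotient_alg Q J)"
  "zero Fb = zero (quotient_alg Q J)" "add Fb = add (quotient_alg Q J)"
  "smult Fb = (\<lambda>c. smult (quotient_alg Q J) (\<lambda>_. c))" "topol Fb = topol (quotient_alg Q J)"
  by (simp_all add: Fb_def fiber_def complex_alg_def J_def[symmetric] quotient_alg_simps carrier_Quot)

lemma carrier_Fb: "carrier Fb = carrier (quotient_alg Q J)"
  by (simp add: Fb_simps quotient_alg_simps carrier_Quot)

definition \<phi> :: "(complex \<Rightarrow> nat list \<Rightarrow> complex) set set \<Rightarrow> (nat \<Rightarrow> nat) \<Rightarrow> complex" where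
  "\<phi> = induced evQ"

lemma phi_clsJ: "X \<in> carrier Q \<Longrightarrow> \<phi> (clsJ X) = evQ X"
  unfolding \<phi>_def using induced_coset[OF ring_Q ideal_J ring_Bq evQ_hom, of X] J_zero by simp

lemma ring_Fb: "ring Fb"
  by (rule ring_cong_ops[OF ring_quotient_alg[OF ideal_J]]) (simp_all add: Fb_simps quotient_alg_simps carrier_Quot)

lemma phi_hom: "\<phi> \<in> ring_hom Fb Bq"
proof (rule ring_hom_cong_ops)
  show "\<phi> \<in> ring_hom (quotient_alg Q J) Bq"
    unfolding \<phi>_def using induced_ring_hom[OF ring_Q ideal_J ring_Bq evQ_hom] J_zero by simp
qed (simp_all add: Fb_simps quotient_alg_simps carrier_Quot)

lemma phi_S: "v \<in> carrier Fb \<Longrightarrow> \<phi> v \<in> B.S"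
  using ring_hom_closed[OF phi_hom] by simp

lemma topspace_Fb: "topspace (topol Fb) = carrier Fb"
  unfolding carrier_Fb Fb_simps(7) by (rule topspace_quotient[OF topspace_Q])

text \<open>The inverse of \<open>\<phi>\<close>, written through the section so that its continuity
  is that of a composition.\<close>

definition \<psi> :: "((nat \<Rightarrow> nat) \<Rightarrow> complex) \<Rightarrow> (complex \<Rightarrow> nat list \<Rightarrow> complex) set set" where
  "\<psi> b = clsJ (cls (\<lambda>z\<in>Cx. qsec n \<sigma> b))"

lemma psi_carrier: "b \<in> B.S \<Longrightarrow> \<psi> b \<in> carrier Fb"
  using ev_qsec by (auto simp: \<psi>_def Fb_simps carrier_Q)

lemma phi_psi: "b \<in> B.S \<Longrightarrow> \<phi> (\<psi> b) = b"
  using ev_qsec[of b] phi_clsJ[of "cls (\<lambda>z\<in>Cx. qsec n \<sigma> b)"] evQ_cls[of "\<lambda>z\<in>Cx. qsec n \<sigma> b"]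
  by (simp add: \<psi>_def carrier_Q)

lemma phi_inj: "v \<in> carrier Fb \<Longrightarrow> w \<in> carrier Fb \<Longrightarrow> \<phi> v = \<phi> w \<Longrightarrow> v = w"
proof -
  assume "v \<in> carrier Fb" "w \<in> carrier Fb" and eq: "\<phi> v = \<phi> w"
  then obtain X Y where "X \<in> carrier Q" "v = clsJ X" "Y \<in> carrier Q" "w = clsJ Y"
    unfolding Fb_simps(1) by blast
  then show "v = w" using eq clsJ_eq_iff[of X Y] phi_clsJ[of X] phi_clsJ[of Y] by simp
qed

lemma psi_phi: "v \<in> carrier Fb \<Longrightarrow> \<psi> (\<phi> v) = v"
  using phi_inj[OF psi_carrier, of "\<phi> v" v] phi_psi phi_S by simp

lemma psi_continuous: "continuous_map B.T (topol Fb) \<psi>"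
proof -
  have "continuous_map B.T (topol Fb) (clsJ \<circ> (cls \<circ> ((\<lambda>a. \<lambda>z\<in>Cx. a) \<circ> qsec n \<sigma>)))"
    unfolding Fb_simps(7)
    by (intro continuous_map_compose[OF _ coset_continuous[OF topspace_Q]]
        continuous_map_compose[OF _ cls_continuous] continuous_map_compose[OF _ const_continuous]
        sec.L_continuous)
  then show ?thesis by (simp add: \<psi>_def[abs_def] o_def)
qed

lemma smult_Fb:
  assumes X: "X \<in> carrier Q"
  shows "c \<odot>\<^bsub>Fb\<^esub> clsJ X = clsJ ((\<lambda>_. c) \<odot>\<^bsub>Q\<^esub> X)" "(\<lambda>_. c) \<odot>\<^bsub>Q\<^esub> X \<in> carrier Q"
    "evQ ((\<lambda>_. c) \<odot>\<^bsub>Q\<^esub> X) = scal c (evQ X)"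
proof -
  have c: "(\<lambda>_. c) \<odot>\<^bsub>Q\<^esub> X \<in> carrier Q \<and> evQ ((\<lambda>_. c) \<odot>\<^bsub>Q\<^esub> X) = scal c (evQ X)"
    if X: "X \<in> carrier Q" for X
  proof -
    obtain f where f: "f \<in> H" "X = cls f" using X unfolding carrier_Q by blast
    have h: "(\<lambda>_::complex. c) holomorphic_on Cx" by simp
    show ?thesis
      using H_smult[OF h f(1)] smult_Q[OF h f(1)] by (simp add: f carrier_Q evQ_cls ev_smult)
  qed
  show "(\<lambda>_. c) \<odot>\<^bsub>Q\<^esub> X \<in> carrier Q" "evQ ((\<lambda>_. c) \<odot>\<^bsub>Q\<^esub> X) = scal c (evQ X)"
    using c[OF X] by auto
  show "c \<odot>\<^bsub>Fb\<^esub> clsJ X = clsJ ((\<lambda>_. c) \<odot>\<^bsub>Q\<^esub> X)"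
    unfolding Fb_simps(6)
  proof (rule smult_quotient_coset[OF ideal_J X])
    fix Y assume Y: "Y \<in> clsJ X"
    have YQ: "Y \<in> carrier Q" and "evQ Y = evQ X" using Y unfolding clsJ_eq[OF X] by auto
    then show "clsJ ((\<lambda>_. c) \<odot>\<^bsub>Q\<^esub> Y) = clsJ ((\<lambda>_. c) \<odot>\<^bsub>Q\<^esub> X)"
      using clsJ_eq_iff c[OF X] c[OF YQ] by simp
  qed
qed

lemma phi_smult: "v \<in> carrier Fb \<Longrightarrow> \<phi> (c \<odot>\<^bsub>Fb\<^esub> v) = scal c (\<phi> v)"
  using smult_Fb by (auto simp: Fb_simps(1) phi_clsJ)

end

section \<open>The bundle topology on a fiber\<close>

lemma ring_hom_minus:
  assumes "ring R" "ring S" "h \<in> ring_hom R S" "x \<in> carrier R" "y \<in> carrier R"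
  shows "h (x \<ominus>\<^bsub>R\<^esub> y) = h x \<ominus>\<^bsub>S\<^esub> h y"
proof -
  interpret ring_hom_ring R S h by (rule ring_hom_ringI2[OF assms(1-3)])
  show ?thesis using assms(4,5) by (simp add: a_minus_def)
qed

context deformation_fiber
begin

lemma clsJ_hom: "clsJ \<in> ring_hom Q Fb"
  using coset_ring_hom[OF ideal_J] unfolding ring_hom_def by (simp add: Fb_simps carrier_Fb[symmetric] flip: Fb_simps(2,3,5))

lemma ev_minus: "f \<in> H \<Longrightarrow> g \<in> H \<Longrightarrow> ev (f \<ominus>\<^bsub>A0\<^esub> g) = ev f - ev g"
  by (simp add: A0_minus ev_def q qpi_diff)

lemma H_minus: "f \<in> H \<Longrightarrow> g \<in> H \<Longrightarrow> f \<ominus>\<^bsub>A0\<^esub> g \<in> H"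
  using AR.minus_closed[of f g] by (simp only: hol_alg_simps(1))

lemma H_minus_minus: "f \<in> H \<Longrightarrow> g \<in> H \<Longrightarrow> f \<ominus>\<^bsub>A0\<^esub> (f \<ominus>\<^bsub>A0\<^esub> g) = g"
proof (rule H_eqI)
  assume f: "f \<in> H" and g: "g \<in> H"
  show "f \<ominus>\<^bsub>A0\<^esub> (f \<ominus>\<^bsub>A0\<^esub> g) \<in> H" using f g by (simp add: H_minus)
  show "(f \<ominus>\<^bsub>A0\<^esub> (f \<ominus>\<^bsub>A0\<^esub> g)) z = g z" if "z \<in> Cx" for z
  proof -
    have "(f \<ominus>\<^bsub>A0\<^esub> (f \<ominus>\<^bsub>A0\<^esub> g)) z = f z - (f \<ominus>\<^bsub>A0\<^esub> g) z"
      by (simp only: A0_minus[OF f H_minus[OF f g]] restrict_apply that if_True)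
    also have "(f \<ominus>\<^bsub>A0\<^esub> g) z = f z - g z" using that by (simp add: A0_minus[OF f g])
    finally show ?thesis by (simp add: fun_eq_iff)
  qed
qed

lemma cls_minus: "f \<in> H \<Longrightarrow> g \<in> H \<Longrightarrow> cls f \<ominus>\<^bsub>Q\<^esub> cls g = cls (f \<ominus>\<^bsub>A0\<^esub> g)"
  by (rule ring_hom_minus[OF ring_A0 ring_Q cls_hom, symmetric]) simp_all

lemma clsJ_minus: "X \<in> carrier Q \<Longrightarrow> Y \<in> carrier Q \<Longrightarrow> clsJ X \<ominus>\<^bsub>Fb\<^esub> clsJ Y = clsJ (X \<ominus>\<^bsub>Q\<^esub> Y)"
  by (rule ring_hom_minus[OF ring_Q ring_Fb clsJ_hom, symmetric])

lemma clsJ_cls: "f \<in> H \<Longrightarrow> clsJ (cls f) = {cls h | h. h \<in> H \<and> ev h = ev f}"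
  by (subst clsJ_eq) (auto simp: carrier_Q evQ_cls)

section \<open>Quotient seminorms on the fiber\<close>

context
  fixes p :: "(complex \<Rightarrow> nat list \<Rightarrow> complex) set \<Rightarrow> real"
  assumes p: "continuous_seminorm (complex_alg Q) p"
begin

text \<open>Subadditivity applied to \<open>f\<close> and its negative gives
  \<open>0 \<le> 2 * p (cls f)\<close>. This bounds the infimum in the quotient seminorm from
  below.\<close>

lemma p_nonneg: assumes "f \<in> H" shows "0 \<le> p (cls f)"
proof -
  have hom: "p ((\<lambda>_. c) \<odot>\<^bsub>Q\<^esub> a) = cmod c * p a" if "a \<in> carrier Q" for c a
    using p that by (simp add: continuous_seminorm_def complex_alg_def)
  have tri: "p (a \<oplus>\<^bsub>Q\<^esub> b) \<le> p a + p b" if "a \<in> carrier Q" "b \<in> carrier Q" for a b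
    using p that by (simp add: continuous_seminorm_def complex_alg_def)
  have c: "cls g \<in> carrier Q" if "g \<in> H" for g using that by (simp add: carrier_Q)
  have sm: "p (cls (\<lambda>z\<in>Cx. scal c (f z))) = cmod c * p (cls f)" for c
    using hom[OF c[OF assms], of c] smult_Q[of "\<lambda>_. c" f] assms by simp
  let ?g = "\<lambda>z\<in>Cx. scal (-1) (f z)"
  have g: "?g \<in> H" using H_smult[of "\<lambda>_. -1" f] assms by simp
  have "0 = p (cls (\<lambda>z\<in>Cx. scal 0 (f z)))" using sm[of 0] by simp
  also have "(\<lambda>z\<in>Cx. scal 0 (f z)) = (\<lambda>z\<in>Cx. f z + ?g z)" by (auto simp: fun_eq_iff)
  also have "p (cls \<dots>) \<le> p (cls f) + p (cls ?g)"
    using tri[OF c[OF assms] c[OF g]] cls_add[OF assms g] by simp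
  also have "\<dots> = 2 * p (cls f)" using sm[of "-1"] by simp
  finally show ?thesis by simp
qed

lemma quotient_seminorm_less_iff:
  assumes "f \<in> H"
  shows "quotient_seminorm p (clsJ (cls f)) < \<epsilon> \<longleftrightarrow> (\<exists>h\<in>H. ev h = ev f \<and> p (cls h) < \<epsilon>)"
proof -
  have "p ` clsJ (cls f) \<noteq> {}" using clsJ_cls[OF assms] assms by auto
  moreover have "bdd_below (p ` clsJ (cls f))"
    by (rule bdd_belowI[of _ 0]) (auto simp: clsJ_cls[OF assms] p_nonneg)
  ultimately have "quotient_seminorm p (clsJ (cls f)) < \<epsilon> \<longleftrightarrow> (\<exists>y\<in>p ` clsJ (cls f). y < \<epsilon>)"
    unfolding quotient_seminorm_def by (rule cInf_less_iff)
  then show ?thesis unfolding clsJ_cls[OF assms] by blast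
qed

text \<open>The coset of \<open>f\<close> lies in the ball if and only if \<open>f\<close> is the
  sum of a function with small \<open>p\<close> and some \<open>k\<close> that has the same image as
  \<open>g\<close> under \<open>ev\<close>. The preimage in \<open>H\<close> is thus a union of
  translates of the open set \<open>D\<close>.\<close>

lemma quotient_ball_open:
  assumes u: "u \<in> carrier Q"
  shows "openin (topol Fb) {v \<in> carrier Fb. quotient_seminorm p (v \<ominus>\<^bsub>Fb\<^esub> clsJ u) < \<epsilon>}" (is "openin _ ?U")
proof -
  obtain g where g: "g \<in> H" "u = cls g" using u unfolding carrier_Q by blast
  have pc: "continuous_map (topol A0) euclideanreal (p \<circ> cls)"
    using p by (intro continuous_map_compose[OF cls_continuous]) (simp add: continuous_seminorm_def complex_alg_def)
  define D where "D = {h \<in> H. p (cls h) < \<epsilon>}"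
  have "openin (topol A0) {h \<in> topspace (topol A0). (p \<circ> cls) h \<in> {..<\<epsilon>}}"
    by (rule openin_continuous_map_preimage[OF pc]) simp
  then have D: "openin (topol A0) D" by (simp add: D_def)
  have mem: "clsJ (cls f) \<in> ?U \<longleftrightarrow> (\<exists>h\<in>H. ev h = ev f - ev g \<and> p (cls h) < \<epsilon>)" if f: "f \<in> H" for f
  proof -
    have "clsJ (cls f) \<ominus>\<^bsub>Fb\<^esub> clsJ u = clsJ (cls (f \<ominus>\<^bsub>A0\<^esub> g))"
      using f g by (simp add: clsJ_minus cls_minus carrier_Q)
    moreover have "clsJ (cls f) \<in> carrier Fb" using f by (simp add: Fb_simps(1) carrier_Q)
    ultimately show ?thesis
      using quotient_seminorm_less_iff[OF H_minus[OF f g(1)], of \<epsilon>] ev_minus[OF f g(1)] by simp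
  qed
  have eq: "{f \<in> H. clsJ (cls f) \<in> ?U} = (\<Union>k\<in>{k \<in> H. ev k = ev g}. {f \<in> H. f \<ominus>\<^bsub>A0\<^esub> k \<in> D})"
  proof (intro subset_antisym subsetI)
    fix f assume "f \<in> {f \<in> H. clsJ (cls f) \<in> ?U}"
    then have f: "f \<in> H" and "clsJ (cls f) \<in> ?U" by blast+
    then obtain h where h: "h \<in> H" "ev h = ev f - ev g" "p (cls h) < \<epsilon>" using mem by blast
    have "f \<ominus>\<^bsub>A0\<^esub> h \<in> {k \<in> H. ev k = ev g}" using f h(1,2) by (simp add: H_minus ev_minus)
    moreover have "f \<in> {f' \<in> H. f' \<ominus>\<^bsub>A0\<^esub> (f \<ominus>\<^bsub>A0\<^esub> h) \<in> D}"
      using f h by (simp add: D_def H_minus_minus)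
    ultimately show "f \<in> (\<Union>k\<in>{k \<in> H. ev k = ev g}. {f \<in> H. f \<ominus>\<^bsub>A0\<^esub> k \<in> D})" by blast
  next
    fix f assume "f \<in> (\<Union>k\<in>{k \<in> H. ev k = ev g}. {f \<in> H. f \<ominus>\<^bsub>A0\<^esub> k \<in> D})"
    then obtain k where k: "k \<in> H" "ev k = ev g" "f \<in> H" "f \<ominus>\<^bsub>A0\<^esub> k \<in> D" by blast
    have "\<exists>h\<in>H. ev h = ev f - ev g \<and> p (cls h) < \<epsilon>"
      using k ev_minus[OF k(3,1)] by (intro bexI[of _ "f \<ominus>\<^bsub>A0\<^esub> k"]) (auto simp: D_def)
    then show "f \<in> {f \<in> H. clsJ (cls f) \<in> ?U}" using mem[OF k(3)] k(3) by blast
  qed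
  have "openin (topol A0) {f \<in> H. clsJ (cls f) \<in> ?U}"
    unfolding eq by (intro openin_Union ballI) (auto intro: translate_open[OF D])
  then have "openin (topol A0) {f \<in> carrier A0. cls f \<in> {X \<in> carrier Q. clsJ X \<in> ?U}}"
    by (rule back_subst[of "openin (topol A0)"]) (auto simp: carrier_Q)
  then have "openin (topol Q) {X \<in> carrier Q. clsJ X \<in> ?U}"
    unfolding openin_quotient by (auto simp: quotient_alg_simps)
  moreover have "?U \<subseteq> carrier (Q Quot J)" by (auto simp: carrier_Fb quotient_alg_simps)
  ultimately show ?thesis unfolding Fb_simps(7) openin_quotient[of Q J] by blast
qed

end

text \<open>These seminorms are constant on the cosets of \<open>J\<close>, so they coincide with
  their quotient seminorms and carry the topology of the quantum algebra into the bundle.\<close>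

lemma norm_seminorm:
  assumes j: "j \<in> Jdx"
  shows "continuous_seminorm (complex_alg Q) (\<lambda>X. B.nrm j (evQ X))"
proof -
  have S: "evQ X \<in> B.S" if "X \<in> carrier Q" for X using ring_hom_closed[OF evQ_hom that] by simp
  have "continuous_map (topol Q) euclideanreal (B.nrm j \<circ> evQ)"
    by (rule continuous_map_compose[OF evQ_continuous B.nrm_continuous[OF j]])
  then show ?thesis
    unfolding continuous_seminorm_def complex_alg_def
    using ring_hom_add[OF evQ_hom] smult_Fb(3) S j by (simp add: o_def B.nrm_add B.nrm_scal)
qed

lemma zero_seminorm: "continuous_seminorm (complex_alg Q) (\<lambda>X. 0)"
  by (simp add: continuous_seminorm_def)

section \<open>The bundle topology restricted to one fiber\<close>

definition E :: "(complex \<times> (complex \<Rightarrow> nat list \<Rightarrow> complex) set set) set" where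
  "E = {e \<in> bundle_space Q. fst e = q}"

lemma E_eq: "E = Pair q ` carrier Fb"
  using q by (auto simp: E_def bundle_space_def Fb_def)

abbreviation BF :: "(complex, complex \<times> (complex \<Rightarrow> nat list \<Rightarrow> complex) set set) top_alg" where
  "BF \<equiv> bundle_fiber Q q"

lemma BF_simps:
  "carrier BF = E" "mult BF = (\<lambda>x y. (q, snd x \<otimes>\<^bsub>Fb\<^esub> snd y))" "one BF = (q, \<one>\<^bsub>Fb\<^esub>)"
  "add BF = (\<lambda>x y. (q, snd x \<oplus>\<^bsub>Fb\<^esub> snd y))" "smult BF = (\<lambda>c x. (q, c \<odot>\<^bsub>Fb\<^esub> snd x))"
  "topol BF = subtopology (bundle_topology Q) E"
  by (simp_all add: bundle_fiber_def Let_def E_def Fb_def)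

definition basic :: "complex set \<Rightarrow> (complex \<Rightarrow> nat list \<Rightarrow> complex) set \<Rightarrow> real
    \<Rightarrow> ((complex \<Rightarrow> nat list \<Rightarrow> complex) set \<Rightarrow> real) \<Rightarrow> (complex \<times> (complex \<Rightarrow> nat list \<Rightarrow> complex) set set) set" where
  "basic V u \<epsilon> p = {(q, v) \<in> bundle_space Q. q \<in> V
          \<and> quotient_seminorm p (v \<ominus>\<^bsub>fiber Q q\<^esub> fiber_class Q q u) < \<epsilon>}"

lemma bundle_topology_basic:
  "bundle_topology Q = topology_generated_by
     {basic V u \<epsilon> p | V u \<epsilon> p. open V \<and> V \<subseteq> Cx \<and> u \<in> carrier Q \<and> \<epsilon> > 0 \<and> continuous_seminorm (complex_alg Q) p}"
  unfolding bundle_topology_def basic_def ..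

lemma basic_iff:
  assumes "v \<in> carrier Fb"
  shows "(q, v) \<in> basic V u \<epsilon> p \<longleftrightarrow> q \<in> V \<and> quotient_seminorm p (v \<ominus>\<^bsub>Fb\<^esub> clsJ u) < \<epsilon>"
  using assms q by (simp add: basic_def bundle_space_def Fb_def fiber_class_def J_def)

lemma basic_open:
  assumes "open V" "V \<subseteq> Cx" "u \<in> carrier Q" "\<epsilon> > 0" "continuous_seminorm (complex_alg Q) p"
  shows "openin (bundle_topology Q) (basic V u \<epsilon> p)"
  unfolding bundle_topology_basic by (rule topology_generated_by_Basis) (use assms in blast)

lemma E_subset_topspace: "E \<subseteq> topspace (bundle_topology Q)"
proof
  fix e assume "e \<in> E"
  then obtain v where v: "v \<in> carrier Fb" "e = (q, v)" unfolding E_eq by blast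
  then obtain f where f: "f \<in> H" "v = clsJ (cls f)" by (auto simp: Fb_simps(1) carrier_Q)
  have "v \<ominus>\<^bsub>Fb\<^esub> clsJ (cls f) = clsJ (cls (f \<ominus>\<^bsub>A0\<^esub> f))"
    using f by (simp add: clsJ_minus cls_minus carrier_Q)
  \<comment> \<open>The zero seminorm is enough to place every point of the fiber in some basic
    set.\<close>
  then have "quotient_seminorm (\<lambda>X. 0) (v \<ominus>\<^bsub>Fb\<^esub> clsJ (cls f)) < 1"
    using quotient_seminorm_less_iff[OF zero_seminorm H_minus[OF f(1) f(1)], of 1] H_minus[OF f(1) f(1)] by auto
  then have "e \<in> basic Cx (cls f) 1 (\<lambda>X. 0)" using v q by (simp add: basic_iff)
  moreover have "openin (bundle_topology Q) (basic Cx (cls f) 1 (\<lambda>X. 0))"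
    by (rule basic_open) (use open_Cx f zero_seminorm in \<open>auto simp: carrier_Q\<close>)
  ultimately show "e \<in> topspace (bundle_topology Q)" using openin_subset by blast
qed

lemma topspace_BF: "topspace (topol BF) = E"
  using E_subset_topspace by (auto simp: BF_simps)

text \<open>The bundle topology on the fiber is no finer than the quotient topology: a basic set
  meets the fiber in a quotient ball, or not at all if \<open>q\<close> is outside
  \<open>V\<close>.\<close>

lemma Pair_continuous: "continuous_map (topol Fb) (topol BF) (Pair q)"
  unfolding BF_simps continuous_map_in_subtopology
proof
  show "Pair q \<in> topspace (topol Fb) \<rightarrow> E" by (auto simp: topspace_Fb E_eq)
  show "continuous_map (topol Fb) (bundle_topology Q) (Pair q)"
    unfolding bundle_topology_basic
  proof (rule continuous_on_generated_topo)
    show "Pair q ` topspace (topol Fb) \<subseteq> \<Union> {basic V u \<epsilon> p | V u \<epsilon> p. open V \<and> V \<subseteq> Cx \<and> u \<in> carrier Q \<and> \<epsilon> > 0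
        \<and> continuous_seminorm (complex_alg Q) p}"
      using E_subset_topspace unfolding bundle_topology_basic topology_generated_by_topspace topspace_Fb E_eq .
    fix W assume "W \<in> {basic V u \<epsilon> p | V u \<epsilon> p. open V \<and> V \<subseteq> Cx \<and> u \<in> carrier Q \<and> \<epsilon> > 0
        \<and> continuous_seminorm (complex_alg Q) p}"
    then obtain V u \<epsilon> p where W: "W = basic V u \<epsilon> p" "u \<in> carrier Q" "continuous_seminorm (complex_alg Q) p"
      by blast
    have "Pair q -` W \<inter> topspace (topol Fb)
        = (if q \<in> V then {v \<in> carrier Fb. quotient_seminorm p (v \<ominus>\<^bsub>Fb\<^esub> clsJ u) < \<epsilon>} else {})"
      by (auto simp: W(1) topspace_Fb basic_iff)
    then show "openin (topol Fb) (Pair q -` W \<inter> topspace (topol Fb))"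
      using quotient_ball_open[OF W(3,2)] by simp
  qed
qed

lemma quotient_norm_eq:
  assumes X: "X \<in> carrier Q"
  shows "quotient_seminorm (\<lambda>X. B.nrm j (evQ X)) (clsJ X) = B.nrm j (evQ X)"
proof -
  have "(\<lambda>X. B.nrm j (evQ X)) ` clsJ X = {B.nrm j (evQ X)}" unfolding clsJ_eq[OF X] using X by auto
  then show ?thesis by (simp add: quotient_seminorm_def)
qed

text \<open>Balls of the quantum algebra pull back to traces on \<open>E\<close> of basic sets over
  all of \<open>Cx\<close>, whose centres are the constant functions supplied by the
  section.\<close>

lemma phi_snd_continuous: "continuous_map (topol BF) B.T (\<lambda>e. \<phi> (snd e))"
  unfolding B.T_def seminorm_topology_def
proof (rule continuous_on_generated_topo)
  have "topspace B.T = \<Union> {{y \<in> B.S. p (\<lambda>k. y k - x k) < \<epsilon>} |p x \<epsilon>. p \<in> B.P \<and> x \<in> B.S \<and> 0 < \<epsilon>}"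
    unfolding B.T_def seminorm_topology_def topology_generated_by_topspace ..
  then show "(\<lambda>e. \<phi> (snd e)) ` topspace (topol BF) \<subseteq> \<Union> {{y \<in> B.S. p (\<lambda>k. y k - x k) < \<epsilon>} |p x \<epsilon>. p \<in> B.P \<and> x \<in> B.S \<and> 0 < \<epsilon>}"
    unfolding topspace_BF E_eq using phi_S by auto
next
  fix W assume "W \<in> {{y \<in> B.S. p (\<lambda>k. y k - x k) < \<epsilon>} |p x \<epsilon>. p \<in> B.P \<and> x \<in> B.S \<and> 0 < \<epsilon>}"
  then obtain j x \<epsilon> where W: "W = {y \<in> B.S. B.nrm j (y - x) < \<epsilon>}" "j \<in> Jdx" "x \<in> B.S" "\<epsilon> > 0"
    by (auto simp: B.P_def fun_diff_def)
  define u where "u = cls (\<lambda>z\<in>Cx. qsec n \<sigma> x)"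
  have u: "u \<in> carrier Q" "evQ u = x" using ev_qsec[OF W(3)] by (auto simp: u_def carrier_Q evQ_cls)
  let ?p = "\<lambda>X. B.nrm j (evQ X)"
  have "(\<lambda>e. \<phi> (snd e)) -` W \<inter> topspace (topol BF) = basic Cx u \<epsilon> ?p \<inter> E"
  proof -
    have "\<phi> v \<in> W \<longleftrightarrow> (q, v) \<in> basic Cx u \<epsilon> ?p" if v: "v \<in> carrier Fb" for v
    proof -
      obtain X where X: "X \<in> carrier Q" "v = clsJ X" using v unfolding Fb_simps(1) by blast
      have "quotient_seminorm ?p (v \<ominus>\<^bsub>Fb\<^esub> clsJ u) = B.nrm j (evQ (X \<ominus>\<^bsub>Q\<^esub> u))"
        unfolding X(2) clsJ_minus[OF X(1) u(1)] by (rule quotient_norm_eq) (rule ring.ring_simprules(4)[OF ring_Q X(1) u(1)])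
      also have "evQ (X \<ominus>\<^bsub>Q\<^esub> u) = evQ X - x"
      proof -
        obtain f g where "f \<in> H" "X = cls f" "g \<in> H" "u = cls g" using X(1) u(1) unfolding carrier_Q by blast
        then show ?thesis using u(2) by (simp add: cls_minus evQ_cls H_minus ev_minus)
      qed
      finally show ?thesis using v phi_S[OF v] q X by (simp add: basic_iff W(1) phi_clsJ fun_diff_def)
    qed
    then show ?thesis unfolding topspace_BF E_eq by auto
  qed
  moreover have "openin (bundle_topology Q) (basic Cx u \<epsilon> ?p)"
    by (rule basic_open[OF open_Cx subset_refl u(1) W(4) norm_seminorm[OF W(2)]])
  ultimately show "openin (topol BF) ((\<lambda>e. \<phi> (snd e)) -` W \<inter> topspace (topol BF))"
    unfolding BF_simps openin_subtopology by blast
qed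

text \<open>On the fiber \<open>snd e\<close> equals \<open>\<psi> (\<phi> (snd e))\<close>. The
  comparison with the quotient topology thus passes through the quantum algebra, and arbitrary
  quotient-open sets need not be inspected.\<close>

lemma snd_continuous: "continuous_map (topol BF) (topol Fb) snd"
proof (rule continuous_map_eq[OF continuous_map_compose[OF phi_snd_continuous psi_continuous]])
  fix e assume "e \<in> topspace (topol BF)"
  then show "(\<psi> \<circ> (\<lambda>e. \<phi> (snd e))) e = snd e" by (auto simp: topspace_BF E_eq psi_phi)
qed

theorem fiber_iso_bundle_fiber: "fiber (deformation n F) q \<cong>\<^sub>t\<^sub>a bundle_fiber (deformation n F) q"
  unfolding top_alg_iso_def deformation_eq Fb_def[symmetric]
proof (intro exI[of _ "Pair q"] conjI)
  show "Pair q \<in> ring_iso Fb BF"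
    unfolding ring_iso_def ring_hom_def by (auto simp: BF_simps E_eq bij_betw_def inj_on_def)
  show "\<forall>c. \<forall>a\<in>carrier Fb. (q, c \<odot>\<^bsub>Fb\<^esub> a) = c \<odot>\<^bsub>BF\<^esub> (q, a)"
    by (simp add: BF_simps)
  have "homeomorphic_maps (topol Fb) (topol BF) (Pair q) snd"
    unfolding homeomorphic_maps_def using Pair_continuous snd_continuous by (auto simp: topspace_BF E_eq)
  then show "homeomorphic_map (topol Fb) (topol BF) (Pair q)"
    by (auto simp: homeomorphic_map_maps)
qed

theorem bundle_fiber_iso_quantum: "bundle_fiber (deformation n F) q \<cong>\<^sub>t\<^sub>a quantum_alg n q B.S B.P"
  unfolding top_alg_iso_def deformation_eq Bq_def[symmetric]
proof (intro exI[of _ "\<lambda>e. \<phi> (snd e)"] conjI)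
  have inv: "(q, \<psi> (\<phi> v)) = (q, v)" if "v \<in> carrier Fb" for v using that psi_phi by simp
  show "(\<lambda>e. \<phi> (snd e)) \<in> ring_iso BF Bq"
    unfolding ring_iso_def
  proof (intro CollectI conjI)
    show "(\<lambda>e. \<phi> (snd e)) \<in> ring_hom BF Bq"
      using phi_hom unfolding ring_hom_def by (auto simp: BF_simps E_eq)
    have "bij_betw (\<lambda>e. \<phi> (snd e)) E B.S"
      by (rule bij_betw_byWitness[of _ "\<lambda>b. (q, \<psi> b)"]) (auto simp: E_eq psi_phi phi_psi psi_carrier phi_S)
    then show "bij_betw (\<lambda>e. \<phi> (snd e)) (carrier BF) (carrier Bq)" by (simp add: BF_simps)
  qed
  show "\<forall>c. \<forall>a\<in>carrier BF. \<phi> (snd (c \<odot>\<^bsub>BF\<^esub> a)) = c \<odot>\<^bsub>Bq\<^esub> \<phi> (snd a)"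
    by (auto simp: BF_simps E_eq phi_smult)
  have "continuous_map B.T (topol BF) (Pair q \<circ> \<psi>)"
    by (rule continuous_map_compose[OF psi_continuous Pair_continuous])
  then have "homeomorphic_maps (topol BF) B.T (\<lambda>e. \<phi> (snd e)) (Pair q \<circ> \<psi>)"
    unfolding homeomorphic_maps_def using phi_snd_continuous by (auto simp: topspace_BF E_eq psi_phi phi_psi)
  then show "homeomorphic_map (topol BF) (topol Bq) (\<lambda>e. \<phi> (snd e))"
    by (auto simp: homeomorphic_map_maps)
qed

end

section \<open>Weighted spaces and inversion counts\<close>

text \<open>Links unordered summability over words or multi-indices with ordered series over the
  degree. As the terms are nonnegative, a bound on all finite partial sums suffices in one
  direction; in the other, grouping by degree gives the value.\<close>

lemma graded_summable:
  fixes f :: "'k \<Rightarrow> real" and deg :: "'k \<Rightarrow> nat"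
  assumes fin: "\<And>d. finite {k \<in> W. deg k = d}" and nonneg: "\<And>k. k \<in> W \<Longrightarrow> 0 \<le> f k"
  shows "f summable_on W \<longleftrightarrow> summable (\<lambda>d. \<Sum>k\<in>{k \<in> W. deg k = d}. f k)"
    and "f summable_on W \<Longrightarrow> infsum f W = (\<Sum>d. \<Sum>k\<in>{k \<in> W. deg k = d}. f k)"
proof -
  let ?B = "\<lambda>d. {k \<in> W. deg k = d}"
  have sums: "(\<lambda>d. \<Sum>k\<in>?B d. f k) sums s" if s: "(f has_sum s) W" for s
  proof -
    have bij: "bij_betw snd (Sigma UNIV ?B) W"
      by (rule bij_betw_byWitness[of _ "\<lambda>k. (deg k, k)"]) auto
    have "((\<lambda>x. f (snd x)) has_sum s) (Sigma UNIV ?B)"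
      using s has_sum_reindex_bij_betw[OF bij, of f s] by simp
    then have "((\<lambda>d. \<Sum>k\<in>?B d. f k) has_sum s) UNIV"
      by (rule has_sum_SigmaD) (auto intro: has_sum_finite fin)
    then show ?thesis by (rule has_sum_imp_sums)
  qed
  show "f summable_on W \<longleftrightarrow> summable (\<lambda>d. \<Sum>k\<in>?B d. f k)"
  proof
    assume "f summable_on W"
    then show "summable (\<lambda>d. \<Sum>k\<in>?B d. f k)"
      using sums unfolding summable_on_def summable_def by blast
  next
    assume sm: "summable (\<lambda>d. \<Sum>k\<in>?B d. f k)"
    have bnd: "sum f X \<le> (\<Sum>d. \<Sum>k\<in>?B d. f k)" if X: "X \<subseteq> W" "finite X" for X
    proof -
      have "sum f X \<le> sum f (\<Union>d\<in>deg ` X. ?B d)"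
        by (rule sum_mono2) (use X fin nonneg in auto)
      also have "\<dots> = (\<Sum>d\<in>deg ` X. \<Sum>k\<in>?B d. f k)"
        by (rule sum.UNION_disjoint) (use X fin in auto)
      also have "\<dots> \<le> (\<Sum>d. \<Sum>k\<in>?B d. f k)"
        by (rule sum_le_suminf[OF sm]) (use X nonneg in \<open>auto intro: sum_nonneg\<close>)
      finally show ?thesis .
    qed
    have "eventually (\<lambda>X. sum f X \<le> (\<Sum>d. \<Sum>k\<in>?B d. f k)) (finite_subsets_at_top W)"
      by (rule eventually_finite_subsets_at_top_weakI) (rule bnd)
    from nonneg_bounded_partial_sums_imp_summable_on[OF nonneg this] show "f summable_on W" .
  qed
  show "infsum f W = (\<Sum>d. \<Sum>k\<in>?B d. f k)" if "f summable_on W"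
    using sums[OF has_sum_infsum[OF that]] sums_unique by blast
qed

definition graded_l1 :: "'k set \<Rightarrow> ('k \<Rightarrow> nat) \<Rightarrow> ('i \<Rightarrow> 'k \<Rightarrow> real) \<Rightarrow> 'i \<Rightarrow> nat \<Rightarrow> ('k \<Rightarrow> complex) \<Rightarrow> real" where
  "graded_l1 W deg w i d a = (\<Sum>k\<in>{k \<in> W. deg k = d}. cmod (a k) * w i k)"

text \<open>Covers both free polydisk algebras and both quantum algebras; the free ball algebra has
  an l2 norm in each degree and is treated separately.\<close>

locale weighted_l1 =
  fixes W :: "'k set" and deg :: "'k \<Rightarrow> nat" and Idx :: "'i set" and w :: "'i \<Rightarrow> 'k \<Rightarrow> real"
  assumes fin: "finite {k \<in> W. deg k = d}" and nonempty: "Idx \<noteq> {}"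
    and w_pos: "i \<in> Idx \<Longrightarrow> k \<in> W \<Longrightarrow> 0 < w i k"
    and w_directed: "i \<in> Idx \<Longrightarrow> j \<in> Idx \<Longrightarrow> \<exists>l\<in>Idx. \<forall>k\<in>W. w i k \<le> w l k \<and> w j k \<le> w l k"
begin

sublocale graded_seminorms W deg Idx "graded_l1 W deg w"
proof
  fix i j :: 'i and d a b c k
  show "finite {k \<in> W. deg k = d}" "Idx \<noteq> {}" by (rule fin nonempty)+
  assume i: "i \<in> Idx"
  note wn = less_imp_le[OF w_pos[OF i]]
  show "0 \<le> graded_l1 W deg w i d a"
    unfolding graded_l1_def by (intro sum_nonneg) (use wn in auto)
  show "graded_l1 W deg w i d (a + b) \<le> graded_l1 W deg w i d a + graded_l1 W deg w i d b"
    unfolding graded_l1_def sum.distrib[symmetric] distrib_right[symmetric]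
    by (intro sum_mono mult_right_mono) (use wn in \<open>auto intro: norm_triangle_ineq\<close>)
  show "graded_l1 W deg w i d (scal c a) = cmod c * graded_l1 W deg w i d a"
    unfolding graded_l1_def sum_distrib_left by (simp add: norm_mult mult_ac)
  show "graded_l1 W deg w i d a = graded_l1 W deg w i d b" if "\<And>k. k \<in> W \<Longrightarrow> deg k = d \<Longrightarrow> a k = b k"
    unfolding graded_l1_def by (intro sum.cong) (use that in auto)
  show "\<exists>l\<in>Idx. \<forall>d a. graded_l1 W deg w i d a \<le> graded_l1 W deg w l d a \<and> graded_l1 W deg w j d a \<le> graded_l1 W deg w l d a"
    if j: "j \<in> Idx"
  proof -
    obtain l where l: "l \<in> Idx" "\<forall>k\<in>W. w i k \<le> w l k \<and> w j k \<le> w l k" using w_directed[OF i j] by blast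
    then show ?thesis unfolding graded_l1_def by (intro bexI[of _ l]) (auto intro!: sum_mono mult_left_mono)
  qed
next
  fix k assume k: "k \<in> W"
  obtain i where i: "i \<in> Idx" using nonempty by blast
  have "cmod (a k) \<le> inverse (w i k) * graded_l1 W deg w i (deg k) a" for a
  proof -
    have "cmod (a k) * w i k \<le> graded_l1 W deg w i (deg k) a"
      unfolding graded_l1_def
      by (rule member_le_sum[of k _ "\<lambda>k. cmod (a k) * w i k"]) (use k fin less_imp_le[OF w_pos[OF i]] in auto)
    then show ?thesis using w_pos[OF i k] by (simp add: field_simps)
  qed
  then show "\<exists>i\<in>Idx. \<exists>C. \<forall>a. cmod (a k) \<le> C * graded_l1 W deg w i (deg k) a" using i by blast
qed

lemma l1_nonneg: "i \<in> Idx \<Longrightarrow> k \<in> W \<Longrightarrow> 0 \<le> cmod (a k) * w i k"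
  using w_pos[of i k] by simp

lemma l1_summable:
  assumes "i \<in> Idx"
  shows "(\<lambda>k. cmod (a k) * w i k) summable_on W \<longleftrightarrow> summable (\<lambda>d. graded_l1 W deg w i d a)"
    and "(\<lambda>k. cmod (a k) * w i k) summable_on W \<Longrightarrow> infsum (\<lambda>k. cmod (a k) * w i k) W = nrm i a"
  unfolding graded_l1_def nrm_def by (rule graded_summable[OF fin l1_nonneg[OF assms]]; assumption)+

lemma S_eq: "S = {a. (\<forall>k. k \<notin> W \<longrightarrow> a k = 0) \<and> (\<forall>i\<in>Idx. (\<lambda>k. cmod (a k) * w i k) summable_on W)}"
  by (simp add: S_def l1_summable(1))

lemma T_eq: "seminorm_topology S {\<lambda>a. infsum (\<lambda>k. cmod (a k) * w i k) W | i. i \<in> Idx} = seminorm_topology S P"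
proof (rule seminorm_topology_cong)
  have eq: "nrm i a = infsum (\<lambda>k. cmod (a k) * w i k) W" if "i \<in> Idx" "a \<in> S" for i a
    using l1_summable(2)[OF that(1), of a] that unfolding S_eq by simp
  show "\<exists>p'\<in>P. \<forall>a\<in>S. p a = p' a" if "p \<in> {\<lambda>a. infsum (\<lambda>k. cmod (a k) * w i k) W | i. i \<in> Idx}" for p
    using that eq unfolding P_def by auto
  show "\<exists>p'\<in>{\<lambda>a. infsum (\<lambda>k. cmod (a k) * w i k) W | i. i \<in> Idx}. \<forall>a\<in>S. p a = p' a" if "p \<in> P" for p
    using that eq unfolding P_def by auto
qed (rule S_diff)

end

lemma sum_words_len_split:
  assumes "m \<le> d"
  shows "(\<Sum>\<alpha>\<in>words_len n d. g (take m \<alpha>) (drop m \<alpha>)) = (\<Sum>\<beta>\<in>words_len n m. \<Sum>\<gamma>\<in>words_len n (d - m). g \<beta> \<gamma>)"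
  unfolding sum.cartesian_product
  by (rule sum.reindex_bij_witness[of _ "\<lambda>(\<beta>, \<gamma>). \<beta> @ \<gamma>" "\<lambda>\<alpha>. (take m \<alpha>, drop m \<alpha>)"])
    (use assms in \<open>auto simp: words_len_def words_take words_drop\<close>)

lemma words_len_eq: "words_len n d = {\<alpha> \<in> words n. length \<alpha> = d}"
  by (simp add: words_len_def)

lemma finite_mi_deg: "finite {k \<in> multi_indices n. mi_deg n k = d}"
proof -
  have "{k \<in> multi_indices n. mi_deg n k = d} \<subseteq> {k. \<forall>i. (i \<in> {1..n} \<longrightarrow> k i \<in> {..d}) \<and> (i \<notin> {1..n} \<longrightarrow> k i = 0)}"
  proof clarify
    fix k i assume "k \<in> multi_indices n" "d = mi_deg n k"
    then show "(i \<in> {1..n} \<longrightarrow> k i \<in> {..mi_deg n k}) \<and> (i \<notin> {1..n} \<longrightarrow> k i = 0)"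
      using member_le_sum[of i "{1..n}" k] by (auto simp: mi_deg_def multi_indices_def)
  qed
  then show ?thesis by (rule finite_subset) (rule finite_set_of_finite_funs; simp)
qed

lemma sum_words_of:
  "(\<Sum>k\<in>{k \<in> multi_indices n. mi_deg n k = d}. \<Sum>\<alpha>\<in>words_of n k. g \<alpha>) = sum g (words_len n d)"
proof -
  have "words_of n k = {\<alpha> \<in> words_len n d. count_list \<alpha> = k}" if "mi_deg n k = d" for k
    using that by (auto simp: words_of_def words_len_def mi_deg_count_list)
  then have "(\<Sum>k\<in>{k \<in> multi_indices n. mi_deg n k = d}. \<Sum>\<alpha>\<in>words_of n k. g \<alpha>)
      = (\<Sum>k\<in>{k \<in> multi_indices n. mi_deg n k = d}. \<Sum>\<alpha>\<in>{\<alpha> \<in> words_len n d. count_list \<alpha> = k}. g \<alpha>)"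
    by (intro sum.cong) auto
  also have "\<dots> = sum g (words_len n d)"
    by (rule sum.group[OF finite_words_len finite_mi_deg])
      (auto simp: words_len_def mi_deg_count_list count_list_multi_index)
  finally show ?thesis .
qed

text \<open>\<open>k\<close> has finite support, so it is the count function of a multiset, and any
  list of that multiset will do.\<close>

lemma words_of_nonempty:
  assumes "k \<in> multi_indices n"
  shows "words_of n k \<noteq> {}"
proof -
  have "finite {i. 0 < k i}"
    by (rule finite_subset[of _ "{1..n}"]) (use assms in \<open>auto simp: multi_indices_def\<close>)
  then have c: "count (Abs_multiset k) = k" by (simp add: Abs_multiset_inverse)
  obtain \<alpha> where "mset \<alpha> = Abs_multiset k" using ex_mset by blast
  then have a: "count_list \<alpha> = k" using c by (metis count_mset ext)
  have "set \<alpha> \<subseteq> {1..n}"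
  proof
    fix i assume "i \<in> set \<alpha>"
    then have "k i \<noteq> 0" using a by (metis count_list_0_iff)
    then show "i \<in> {1..n}" using assms by (auto simp: multi_indices_def)
  qed
  then have "\<alpha> \<in> words_of n k" using a by (auto simp: words_of_def words_def)
  then show ?thesis by blast
qed

section \<open>Inversions and blocks of monotone words\<close>

lemma crossing_add_left: "crossing n (\<lambda>i. k i + k' i) l = crossing n k l + crossing n k' l"
  by (simp add: crossing_def sum.distrib algebra_simps)

lemma crossing_add_right: "crossing n k (\<lambda>i. l i + l' i) = crossing n k l + crossing n k l'"
  by (simp add: crossing_def sum.distrib algebra_simps)

text \<open>A pair of positions with distinct letters is an inversion of exactly one of the word and
  its reversal, and for letter counts \<open>k\<close> there are \<open>crossing n k k\<close> such
  pairs.\<close>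

lemma inversions_rev:
  "\<alpha> \<in> words n \<Longrightarrow> inversions \<alpha> + inversions (rev \<alpha>) = crossing n (count_list \<alpha>) (count_list \<alpha>)"
proof (induction \<alpha>)
  case Nil
  then show ?case by (simp add: crossing_def)
next
  case (Cons i \<beta>)
  have w: "[i] \<in> words n" "\<beta> \<in> words n" "rev \<beta> \<in> words n" using Cons.prems by (auto simp: words_def)
  have c: "count_list (i # \<beta>) = (\<lambda>x. count_list [i] x + count_list \<beta> x)" by auto
  have z: "crossing n (count_list [i]) (count_list [i]) = 0"
    unfolding crossing_def by (auto intro!: sum.neutral)
  have r: "count_list (rev \<beta>) = count_list \<beta>" by auto
  have "inversions (i # \<beta>) = inversions \<beta> + crossing n (count_list [i]) (count_list \<beta>)"
    using inversions_append[OF w(1,2)] by simp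
  moreover have "inversions (rev (i # \<beta>)) = inversions (rev \<beta>) + crossing n (count_list \<beta>) (count_list [i])"
    using inversions_append[OF w(3,1)] r by simp
  moreover have "crossing n (count_list (i # \<beta>)) (count_list (i # \<beta>))
      = crossing n (count_list [i]) (count_list \<beta>) + crossing n (count_list \<beta>) (count_list [i])
        + crossing n (count_list \<beta>) (count_list \<beta>)"
    unfolding c crossing_add_left crossing_add_right z by linarith
  ultimately show ?case using Cons.IH[OF w(2)] by linarith
qed

lemma inversions_sorted: "sorted \<alpha> \<Longrightarrow> inversions \<alpha> = 0"
  by (induction \<alpha>) (auto simp: filter_empty_conv)

lemma inversions_le_crossing: "\<alpha> \<in> words_of n k \<Longrightarrow> inversions \<alpha> \<le> crossing n k k"
  using inversions_rev[of \<alpha> n] by (auto simp: words_of_def)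

lemma u_weight_crossing: "u_weight n q k = cmod q ^ crossing n k k"
  by (simp add: u_weight_def crossing_def)

text \<open>The number of maximal constant blocks. As a natural number it turns the integer power of
  \<tau> into an ordinary one, with exponent 0 for the empty word.\<close>

definition blocks :: "nat list \<Rightarrow> nat" where
  "blocks \<alpha> = nat (switches \<alpha> + 1)"

lemma switches_blocks: "switches \<alpha> + 1 = int (blocks \<alpha>)"
  by (simp add: blocks_def switches_def)

lemma blocks_Nil [simp]: "blocks [] = 0"
  by (simp add: blocks_def switches_def)

lemma blocks_single [simp]: "blocks [i] = 1"
  by (simp add: blocks_def switches_def)

lemma blocks_Cons_Cons [simp]: "blocks (i # j # \<alpha>) = (if i = j then 0 else 1) + blocks (j # \<alpha>)"
proof -
  let ?A = "\<lambda>\<alpha>. {t. Suc t < length \<alpha> \<and> \<alpha> ! t \<noteq> \<alpha> ! Suc t}"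
  have sw: "switches \<alpha> = int (card (?A \<alpha>))" if "\<alpha> \<noteq> []" for \<alpha> :: "nat list"
  proof (cases "length \<alpha> \<le> 1")
    case True
    then have "length \<alpha> = 1" using that by (cases \<alpha>) auto
    moreover have "?A \<alpha> = {}" using True by auto
    ultimately show ?thesis by (simp add: switches_def)
  qed (simp add: switches_def)
  have A: "?A (i # j # \<alpha>) = (if i = j then {} else {0}) \<union> Suc ` ?A (j # \<alpha>)"
    unfolding set_eq_iff
  proof
    fix t
    show "t \<in> ?A (i # j # \<alpha>) \<longleftrightarrow> t \<in> (if i = j then {} else {0}) \<union> Suc ` ?A (j # \<alpha>)"
      by (cases t) auto
  qed
  have "card (?A (i # j # \<alpha>)) = (if i = j then 0 else 1) + card (?A (j # \<alpha>))"
    unfolding A by (subst card_Un_disjoint) (auto simp: card_image)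
  then show ?thesis by (simp add: blocks_def sw)
qed

lemma blocks_Cons_le: "blocks (i # \<beta>) \<le> 1 + blocks \<beta>"
  by (cases \<beta>) auto

text \<open>Concatenation can only merge the last block of \<open>\<alpha>\<close> with the first
  one of \<open>\<beta>\<close>. As \<tau> is at least 1, this makes the weights of the free
  polydisk algebra submultiplicative.\<close>

lemma blocks_append: "blocks (\<alpha> @ \<beta>) \<le> blocks \<alpha> + blocks \<beta>"
proof (induction \<alpha> rule: induct_list012)
  case (2 i)
  then show ?case using blocks_Cons_le[of i \<beta>] by simp
qed auto

text \<open>In a monotone word a letter does not return once it has been left, so blocks correspond
  to distinct letters.\<close>

lemma blocks_monotone: "sorted \<alpha> \<or> sorted_wrt (\<ge>) \<alpha> \<Longrightarrow> blocks \<alpha> \<le> card (set \<alpha>)"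
proof (induction \<alpha> rule: induct_list012)
  case (3 i j \<alpha>)
  then have IH: "blocks (j # \<alpha>) \<le> card (set (j # \<alpha>))" by auto
  show ?case
  proof (cases "i = j")
    case True
    then show ?thesis using IH by simp
  next
    case False
    then have "i \<notin> set (j # \<alpha>)" using "3.prems" by auto
    then have "card (set (i # j # \<alpha>)) = Suc (card (set (j # \<alpha>)))" by simp
    then show ?thesis using IH False by simp
  qed
qed auto

lemma blocks_words:
  assumes "\<alpha> \<in> words n" "sorted \<alpha> \<or> sorted_wrt (\<ge>) \<alpha>"
  shows "blocks \<alpha> \<le> n"
proof -
  have "card (set \<alpha>) \<le> card {1..n}" by (rule card_mono) (use assms(1) in \<open>auto simp: words_def\<close>)
  then show ?thesis using blocks_monotone[OF assms(2)] by simp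
qed

lemma w_weight_ge1: "1 \<le> cmod q \<Longrightarrow> w_weight n q k = 1"
  unfolding w_weight_def u_weight_crossing by (rule min_absorb2) (rule one_le_power)

lemma w_weight_lt1: "cmod q \<le> 1 \<Longrightarrow> w_weight n q k = cmod q ^ crossing n k k"
  using power_le_one[of "cmod q" "crossing n k k"] by (simp add: w_weight_def u_weight_crossing min_def)

text \<open>The sorted word works for \<open>\<bar>q\<bar> \<ge> 1\<close>, its reversal for \<open>\<bar>q\<bar> < 1\<close>.\<close>
lemma optimal_word:
  assumes "k \<in> multi_indices n"
  shows "\<exists>\<alpha>\<in>words_of n k. blocks \<alpha> \<le> n \<and> cmod q ^ inversions \<alpha> = w_weight n q k"
proof -
  obtain \<beta> where b: "\<beta> \<in> words_of n k" using words_of_nonempty[OF assms] by blast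
  define \<alpha> where "\<alpha> = sort \<beta>"
  have cl: "count_list \<alpha> = count_list \<beta>" unfolding \<alpha>_def by (metis count_mset ext mset_sort)
  have a: "\<alpha> \<in> words_of n k" using b cl by (auto simp: words_of_def words_def \<alpha>_def)
  have ra: "rev \<alpha> \<in> words_of n k" using a by (auto simp: words_of_def words_def)
  have s: "sorted \<alpha>" by (simp add: \<alpha>_def)
  have rs: "sorted_wrt (\<ge>) (rev \<alpha>)" using s by (simp add: sorted_wrt_rev)
  have i0: "inversions \<alpha> = 0" by (rule inversions_sorted[OF s])
  have ir: "inversions (rev \<alpha>) = crossing n k k" using inversions_rev[of \<alpha> n] a i0 by (auto simp: words_of_def)
  show ?thesis
  proof (cases "1 \<le> cmod q")
    case True
    then have "w_weight n q k = 1" by (rule w_weight_ge1)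
    then show ?thesis using a i0 blocks_words[of \<alpha> n] s by (auto simp: words_of_def intro!: bexI[of _ \<alpha>])
  next
    case False
    then have "w_weight n q k = cmod q ^ crossing n k k" by (simp add: w_weight_lt1)
    then show ?thesis using ra ir blocks_words[of "rev \<alpha>" n] rs by (auto simp: words_of_def intro!: bexI[of _ "rev \<alpha>"])
  qed
qed

text \<open>The weight is the least value of \<open>cmod q ^ inversions \<alpha>\<close> over the
  words with letter counts \<open>k\<close>: it is reached without inversions if
  \<open>1 \<le> cmod q\<close>, and with the maximal number \<open>crossing n k k\<close>
  otherwise.\<close>

lemma w_weight_inversions:
  assumes "q \<noteq> 0" "\<alpha> \<in> words_of n k"
  shows "cmod (inverse q ^ inversions \<alpha>) * w_weight n q k \<le> 1"
proof (cases "1 \<le> cmod q")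
  case True
  then have "w_weight n q k = 1" by (rule w_weight_ge1)
  moreover have "inverse (cmod q) ^ inversions \<alpha> \<le> 1" by (rule power_le_one) (use True in \<open>auto simp: inverse_le_1_iff\<close>)
  ultimately show ?thesis by (simp add: norm_power norm_inverse)
next
  case False
  have le: "inversions \<alpha> \<le> crossing n k k" by (rule inversions_le_crossing[OF assms(2)])
  have "cmod (inverse q ^ inversions \<alpha>) * w_weight n q k \<le> cmod (inverse q ^ inversions \<alpha>) * cmod q ^ crossing n k k"
    by (rule mult_left_mono) (auto simp: w_weight_def u_weight_crossing)
  also have "\<dots> = cmod q ^ (crossing n k k - inversions \<alpha>)"
    using assms(1) le by (simp add: norm_power norm_inverse power_diff divide_inverse power_inverse mult.commute)
  also have "\<dots> \<le> 1" by (rule power_le_one) (use False in auto)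
  finally show ?thesis .
qed

section \<open>Polydisks\<close>

lemma radii_nonempty: "0 < r \<Longrightarrow> radii r \<noteq> {}"
  using ereal_dense2[of 0 r] by (auto simp: radii_def)

lemma radii_pos: "\<rho> \<in> radii r \<Longrightarrow> 0 < \<rho>"
  by (simp add: radii_def)

lemma radii_greater: "\<rho> \<in> radii r \<Longrightarrow> \<exists>\<rho>'\<in>radii r. \<rho> < \<rho>'"
proof -
  assume \<rho>: "\<rho> \<in> radii r"
  then obtain z where "ereal \<rho> < ereal z" "ereal z < r"
    using ereal_dense2[of "ereal \<rho>" r] by (auto simp: radii_def)
  then show ?thesis using \<rho> by (intro bexI[of _ z]) (auto simp: radii_def)
qed

lemma radii_max: "\<rho> \<in> radii r \<Longrightarrow> \<rho>' \<in> radii r \<Longrightarrow> max \<rho> \<rho>' \<in> radii r"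
  by (auto simp: max_def)

lemma free_alg_cong: "seminorm_topology S P = seminorm_topology S P' \<Longrightarrow> free_alg S P = free_alg S P'"
  by (simp add: free_alg_def)

lemma quantum_alg_cong: "seminorm_topology S P = seminorm_topology S P' \<Longrightarrow> quantum_alg n q S P = quantum_alg n q S P'"
  by (simp add: quantum_alg_def)

locale weighted_free_alg = weighted_l1 "words n" length Idx w
  for n :: nat and Idx :: "'i set" and w +
  assumes w_append: "i \<in> Idx \<Longrightarrow> \<alpha> \<in> words n \<Longrightarrow> \<beta> \<in> words n \<Longrightarrow> w i (\<alpha> @ \<beta>) \<le> w i \<alpha> * w i \<beta>"
begin

sublocale graded_free_alg n Idx "graded_l1 (words n) length w"
proof
  fix i d a b assume i: "i \<in> Idx"
  have "graded_l1 (words n) length w i d (conv a b)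
      = (\<Sum>\<alpha>\<in>words_len n d. cmod (\<Sum>m\<le>d. a (take m \<alpha>) * b (drop m \<alpha>)) * w i \<alpha>)"
    unfolding graded_l1_def words_len_eq conv_def by (rule sum.cong) auto
  also have "\<dots> \<le> (\<Sum>\<alpha>\<in>words_len n d. \<Sum>m\<le>d. (cmod (a (take m \<alpha>)) * w i (take m \<alpha>)) * (cmod (b (drop m \<alpha>)) * w i (drop m \<alpha>)))"
  proof (rule sum_mono)
    fix \<alpha> assume a: "\<alpha> \<in> words_len n d"
    then have \<alpha>: "\<alpha> \<in> words n" by (simp add: words_len_def)
    have "cmod (\<Sum>m\<le>d. a (take m \<alpha>) * b (drop m \<alpha>)) * w i \<alpha> \<le> (\<Sum>m\<le>d. cmod (a (take m \<alpha>)) * cmod (b (drop m \<alpha>))) * w i \<alpha>"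
      using w_pos[OF i \<alpha>] by (intro mult_right_mono) (auto intro!: order.trans[OF norm_sum] simp: norm_mult)
    also have "\<dots> = (\<Sum>m\<le>d. cmod (a (take m \<alpha>)) * cmod (b (drop m \<alpha>)) * w i (take m \<alpha> @ drop m \<alpha>))"
      by (simp add: sum_distrib_right)
    also have "\<dots> \<le> (\<Sum>m\<le>d. cmod (a (take m \<alpha>)) * cmod (b (drop m \<alpha>)) * (w i (take m \<alpha>) * w i (drop m \<alpha>)))"
      by (intro sum_mono mult_left_mono w_append[OF i] words_take[OF \<alpha>] words_drop[OF \<alpha>]) auto
    finally show "cmod (\<Sum>m\<le>d. a (take m \<alpha>) * b (drop m \<alpha>)) * w i \<alpha>
        \<le> (\<Sum>m\<le>d. (cmod (a (take m \<alpha>)) * w i (take m \<alpha>)) * (cmod (b (drop m \<alpha>)) * w i (drop m \<alpha>)))"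
      by (simp add: mult_ac)
  qed
  also have "\<dots> = (\<Sum>m\<le>d. \<Sum>\<alpha>\<in>words_len n d. (cmod (a (take m \<alpha>)) * w i (take m \<alpha>)) * (cmod (b (drop m \<alpha>)) * w i (drop m \<alpha>)))"
    by (rule sum.swap)
  also have "\<dots> = (\<Sum>m\<le>d. graded_l1 (words n) length w i m a * graded_l1 (words n) length w i (d - m) b)"
  proof (rule sum.cong[OF refl])
    fix m assume m: "m \<in> {..d}"
    show "(\<Sum>\<alpha>\<in>words_len n d. (cmod (a (take m \<alpha>)) * w i (take m \<alpha>)) * (cmod (b (drop m \<alpha>)) * w i (drop m \<alpha>)))
        = graded_l1 (words n) length w i m a * graded_l1 (words n) length w i (d - m) b"
      unfolding graded_l1_def words_len_eq[symmetric] sum_product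
      by (rule sum_words_len_split[where g = "\<lambda>\<beta> \<gamma>. (cmod (a \<beta>) * w i \<beta>) * (cmod (b \<gamma>) * w i \<gamma>)"]) (use m in simp)
  qed
  finally show "graded_l1 (words n) length w i d (conv a b)
      \<le> (\<Sum>m\<le>d. graded_l1 (words n) length w i m a * graded_l1 (words n) length w i (d - m) b)" .
qed

end

section \<open>A section supported on one word for each multi-index\<close>

definition best_word :: "nat \<Rightarrow> complex \<Rightarrow> (nat \<Rightarrow> nat) \<Rightarrow> nat list" where
  "best_word n q k = (SOME \<alpha>. \<alpha> \<in> words_of n k \<and> blocks \<alpha> \<le> n \<and> cmod q ^ inversions \<alpha> = w_weight n q k)"

lemma best_word:
  assumes "k \<in> multi_indices n"
  shows "best_word n q k \<in> words_of n k" "blocks (best_word n q k) \<le> n"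
    "cmod q ^ inversions (best_word n q k) = w_weight n q k"
proof -
  have "\<exists>\<alpha>. \<alpha> \<in> words_of n k \<and> blocks \<alpha> \<le> n \<and> cmod q ^ inversions \<alpha> = w_weight n q k"
    using optimal_word[OF assms, of q] by blast
  from someI_ex[OF this] show "best_word n q k \<in> words_of n k" "blocks (best_word n q k) \<le> n"
    "cmod q ^ inversions (best_word n q k) = w_weight n q k" unfolding best_word_def by auto
qed

text \<open>The factor \<open>q ^ inversions \<alpha>\<close> undoes the one introduced by
  reordering, and its modulus is \<open>w_weight\<close> by the choice of the word.\<close>

definition polydisk_sec :: "nat \<Rightarrow> complex \<Rightarrow> nat list \<Rightarrow> complex" where
  "polydisk_sec n q \<alpha> = (if \<alpha> = best_word n q (count_list \<alpha>) then q ^ inversions \<alpha> else 0)"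

text \<open>Only the best word contributes. The function \<open>g\<close> is left general to serve
  both the normalisation and the norm of the section.\<close>

lemma sum_polydisk_sec:
  fixes g :: "nat list \<Rightarrow> complex \<Rightarrow> 'a :: comm_monoid_add"
  assumes "k \<in> multi_indices n" and "\<And>\<alpha>. g \<alpha> 0 = 0"
  shows "(\<Sum>\<alpha>\<in>words_of n k. g \<alpha> (polydisk_sec n q \<alpha>)) = g (best_word n q k) (q ^ inversions (best_word n q k))"
proof -
  have "(\<Sum>\<alpha>\<in>words_of n k. g \<alpha> (polydisk_sec n q \<alpha>))
      = (\<Sum>\<alpha>\<in>words_of n k. if \<alpha> = best_word n q k then g \<alpha> (q ^ inversions \<alpha>) else 0)"
    by (rule sum.cong) (auto simp: words_of_def polydisk_sec_def assms(2))
  then show ?thesis using best_word(1)[OF assms(1), of q] by (simp add: finite_words_of)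
qed

definition polydisk_weight :: "nat \<Rightarrow> complex \<Rightarrow> real \<Rightarrow> (nat \<Rightarrow> nat) \<Rightarrow> real" where
  "polydisk_weight n q \<rho> k = w_weight n q k * \<rho> ^ mi_deg n k"

lemma w_weight_pos: "q \<noteq> 0 \<Longrightarrow> 0 < w_weight n q k"
  by (simp add: w_weight_def u_weight_crossing)

lemma weighted_l1_polydisk:
  assumes "0 < r" "q \<noteq> 0"
  shows "weighted_l1 (multi_indices n) (mi_deg n) (radii r) (polydisk_weight n q)"
proof
  show "finite {k \<in> multi_indices n. mi_deg n k = d}" for d by (rule finite_mi_deg)
  show "radii r \<noteq> {}" by (rule radii_nonempty[OF assms(1)])
  show "0 < polydisk_weight n q \<rho> k" if "\<rho> \<in> radii r" for \<rho> k
    using w_weight_pos[OF assms(2)] radii_pos[OF that] by (simp add: polydisk_weight_def)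
  fix \<rho> \<rho>' assume r: "\<rho> \<in> radii r" "\<rho>' \<in> radii r"
  show "\<exists>l\<in>radii r. \<forall>k\<in>multi_indices n. polydisk_weight n q \<rho> k \<le> polydisk_weight n q l k
      \<and> polydisk_weight n q \<rho>' k \<le> polydisk_weight n q l k"
    using radii_pos[OF r(1)] radii_pos[OF r(2)] w_weight_pos[OF assms(2)]
    by (intro bexI[OF _ radii_max[OF r]]) (auto simp: polydisk_weight_def less_imp_le intro!: mult_left_mono power_mono)
qed

lemma O_q_D_eq:
  fixes n :: nat
  assumes "0 < r" "q \<noteq> 0"
  defines "M \<equiv> graded_l1 (multi_indices n) (mi_deg n) (polydisk_weight n q)"
  shows "O_q_D q n r = quantum_alg n q (graded_seminorms.S (multi_indices n) (radii r) M) (graded_seminorms.P (radii r) M)"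
proof -
  interpret weighted_l1 "multi_indices n" "mi_deg n" "radii r" "polydisk_weight n q"
    by (rule weighted_l1_polydisk[OF assms(1,2)])
  have t: "q_polydisk_term n q \<rho> f = (\<lambda>k. cmod (f k) * polydisk_weight n q \<rho> k)" for \<rho> f
    by (simp add: q_polydisk_term_def polydisk_weight_def mult.assoc)
  have "{f \<in> quantum_series n. \<forall>\<rho>\<in>radii r. q_polydisk_term n q \<rho> f summable_on multi_indices n} = S"
    unfolding S_eq t by (auto simp: quantum_series_def)
  then show ?thesis
    unfolding O_q_D_def t M_def using quantum_alg_cong[OF T_eq, of n q] by simp
qed

text \<open>\<open>lower\<close> gives continuity of the reordering map, \<open>upper\<close> that
  of the section. The latter concerns only words with at most \<open>n\<close> blocks, where the
  weights of the two free polydisk algebras are comparable.\<close>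

lemma (in weighted_free_alg) polydisk_deformation_fiber:
  assumes r: "0 < r" and q: "q \<in> Cx"
    and lower: "\<And>\<rho>. \<rho> \<in> radii r \<Longrightarrow> \<exists>i\<in>Idx. \<forall>\<alpha>\<in>words n. \<rho> ^ length \<alpha> \<le> w i \<alpha>"
    and upper: "\<And>i. i \<in> Idx \<Longrightarrow> \<exists>\<rho>\<in>radii r. \<exists>C. \<forall>\<alpha>\<in>words n. blocks \<alpha> \<le> n \<longrightarrow> w i \<alpha> \<le> C * \<rho> ^ length \<alpha>"
  shows "deformation_fiber n Idx (graded_l1 (words n) length w) (radii r)
    (graded_l1 (multi_indices n) (mi_deg n) (polydisk_weight n q)) q (polydisk_sec n q)"
proof -
  have q0: "q \<noteq> 0" using q by (simp add: Cx_def)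
  interpret B: weighted_l1 "multi_indices n" "mi_deg n" "radii r" "polydisk_weight n q"
    by (rule weighted_l1_polydisk[OF r q0])
  show ?thesis
  proof unfold_locales
    show "q \<in> Cx" by (rule q)
  next
    fix \<rho> assume \<rho>: "\<rho> \<in> radii r"
    obtain i where i: "i \<in> Idx" "\<And>\<alpha>. \<alpha> \<in> words n \<Longrightarrow> \<rho> ^ length \<alpha> \<le> w i \<alpha>" using lower[OF \<rho>] by blast
    have "graded_l1 (multi_indices n) (mi_deg n) (polydisk_weight n q) \<rho> d (qpi n q a) \<le> 1 * graded_l1 (words n) length w i d a" for d a
    proof -
      have "graded_l1 (multi_indices n) (mi_deg n) (polydisk_weight n q) \<rho> d (qpi n q a)
          \<le> (\<Sum>k\<in>{k \<in> multi_indices n. mi_deg n k = d}. \<Sum>\<alpha>\<in>words_of n k. cmod (a \<alpha>) * \<rho> ^ d)"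
        unfolding graded_l1_def
      proof (rule sum_mono, clarify)
        fix k assume k: "k \<in> multi_indices n" "d = mi_deg n k"
        have "cmod (qpi n q a k) * polydisk_weight n q \<rho> k
            \<le> (\<Sum>\<alpha>\<in>words_of n k. cmod (inverse q ^ inversions \<alpha>) * cmod (a \<alpha>)) * polydisk_weight n q \<rho> k"
          unfolding qpi_def using B.w_pos[OF \<rho> k(1)]
          by (intro mult_right_mono) (auto intro!: order.trans[OF norm_sum] simp: norm_mult)
        \<comment> \<open>Pairing the inversion factor with \<open>w_weight\<close> leaves a product
          that is at most 1.\<close>
        also have "\<dots> = (\<Sum>\<alpha>\<in>words_of n k. (cmod (inverse q ^ inversions \<alpha>) * w_weight n q k) * (cmod (a \<alpha>) * \<rho> ^ mi_deg n k))"
          unfolding sum_distrib_right polydisk_weight_def by (rule sum.cong) (simp_all only: mult_ac)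
        also have "\<dots> \<le> (\<Sum>\<alpha>\<in>words_of n k. 1 * (cmod (a \<alpha>) * \<rho> ^ mi_deg n k))"
          by (intro sum_mono mult_right_mono w_weight_inversions[OF q0]) (use radii_pos[OF \<rho>] in auto)
        finally show "cmod (qpi n q a k) * polydisk_weight n q \<rho> k \<le> (\<Sum>\<alpha>\<in>words_of n k. cmod (a \<alpha>) * \<rho> ^ mi_deg n k)"
          by simp
      qed
      also have "\<dots> = (\<Sum>\<alpha>\<in>words_len n d. cmod (a \<alpha>) * \<rho> ^ d)" by (rule sum_words_of)
      also have "\<dots> \<le> graded_l1 (words n) length w i d a"
        unfolding graded_l1_def words_len_eq[symmetric]
        by (intro sum_mono mult_left_mono) (use i(2) in \<open>auto simp: words_len_def\<close>)
      finally show ?thesis by simp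
    qed
    then show "\<exists>i\<in>Idx. \<exists>C. \<forall>d. \<forall>a\<in>S. graded_l1 (multi_indices n) (mi_deg n) (polydisk_weight n q) \<rho> d (qpi n q a)
        \<le> C * graded_l1 (words n) length w i d a"
      using i(1) by blast
  next
    fix i assume i: "i \<in> Idx"
    obtain \<rho> C where \<rho>: "\<rho> \<in> radii r" and C: "\<And>\<alpha>. \<alpha> \<in> words n \<Longrightarrow> blocks \<alpha> \<le> n \<Longrightarrow> w i \<alpha> \<le> C * \<rho> ^ length \<alpha>"
      using upper[OF i] by blast
    have "graded_l1 (words n) length w i d (qsec n (polydisk_sec n q) f)
        \<le> C * graded_l1 (multi_indices n) (mi_deg n) (polydisk_weight n q) \<rho> d f" for d f
    proof -
      have "graded_l1 (words n) length w i d (qsec n (polydisk_sec n q) f)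
          = (\<Sum>k\<in>{k \<in> multi_indices n. mi_deg n k = d}. \<Sum>\<alpha>\<in>words_of n k. cmod (polydisk_sec n q \<alpha>) * cmod (f k) * w i \<alpha>)"
        unfolding graded_l1_def words_len_eq[symmetric] sum_words_of[symmetric]
        by (intro sum.cong) (auto simp: words_of_def qsec_def norm_mult)
      \<comment> \<open>Only the best word survives, and the modulus of its coefficient is exactly
        the factor \<open>w_weight n q k\<close> of the quantum norm.\<close>
      also have "\<dots> = (\<Sum>k\<in>{k \<in> multi_indices n. mi_deg n k = d}. w_weight n q k * cmod (f k) * w i (best_word n q k))"
        by (rule sum.cong[OF refl])
          (simp add: sum_polydisk_sec[where g = "\<lambda>\<alpha> c. cmod c * cmod (f _) * w i \<alpha>"] norm_power best_word(3))
      also have "\<dots> \<le> (\<Sum>k\<in>{k \<in> multi_indices n. mi_deg n k = d}. C * (cmod (f k) * polydisk_weight n q \<rho> k))"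
      proof (rule sum_mono, clarify)
        fix k assume k: "k \<in> multi_indices n" "d = mi_deg n k"
        note b = best_word[OF k(1), of q]
        have "w i (best_word n q k) \<le> C * \<rho> ^ mi_deg n k"
          using C[of "best_word n q k"] b mi_deg_count_list[of "best_word n q k" n] by (auto simp: words_of_def)
        then have "w_weight n q k * cmod (f k) * w i (best_word n q k) \<le> w_weight n q k * cmod (f k) * (C * \<rho> ^ mi_deg n k)"
          using w_weight_pos[OF q0, of n k] by (intro mult_left_mono) auto
        then show "w_weight n q k * cmod (f k) * w i (best_word n q k) \<le> C * (cmod (f k) * polydisk_weight n q \<rho> k)"
          by (simp add: polydisk_weight_def mult_ac)
      qed
      finally show ?thesis by (simp add: graded_l1_def sum_distrib_left)
    qed
    then show "\<exists>\<rho>\<in>radii r. \<exists>C. \<forall>d. \<forall>f\<in>B.S. graded_l1 (words n) length w i d (qsec n (polydisk_sec n q) f)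
        \<le> C * graded_l1 (multi_indices n) (mi_deg n) (polydisk_weight n q) \<rho> d f"
      using \<rho> by blast
  next
    fix k assume k: "k \<in> multi_indices n"
    show "(\<Sum>\<alpha>\<in>words_of n k. inverse q ^ inversions \<alpha> * polydisk_sec n q \<alpha>) = 1"
      using sum_polydisk_sec[OF k, of "\<lambda>\<alpha> c. inverse q ^ inversions \<alpha> * c" q] q0 by (simp add: power_inverse)
  qed
qed

definition taylor_weight :: "real \<Rightarrow> nat list \<Rightarrow> real" where
  "taylor_weight \<rho> \<alpha> = \<rho> ^ length \<alpha>"

lemma weighted_free_alg_taylor:
  assumes "0 < r"
  shows "weighted_free_alg n (radii r) taylor_weight"
proof
  show "finite {\<alpha> \<in> words n. length \<alpha> = d}" for d unfolding words_len_eq[symmetric] by (rule finite_words_len)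
  show "radii r \<noteq> {}" by (rule radii_nonempty[OF assms])
  show "0 < taylor_weight \<rho> \<alpha>" if "\<rho> \<in> radii r" for \<rho> \<alpha>
    using radii_pos[OF that] by (simp add: taylor_weight_def)
  show "\<exists>l\<in>radii r. \<forall>\<alpha>\<in>words n. taylor_weight \<rho> \<alpha> \<le> taylor_weight l \<alpha> \<and> taylor_weight \<rho>' \<alpha> \<le> taylor_weight l \<alpha>"
    if "\<rho> \<in> radii r" "\<rho>' \<in> radii r" for \<rho> \<rho>'
    using that[THEN radii_pos]
    by (intro bexI[OF _ radii_max[OF that]]) (auto simp: taylor_weight_def less_imp_le intro!: power_mono)
  show "taylor_weight \<rho> (\<alpha> @ \<beta>) \<le> taylor_weight \<rho> \<alpha> * taylor_weight \<rho> \<beta>" for \<rho> \<alpha> \<beta>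
    by (simp add: taylor_weight_def power_add)
qed

definition polydisk_indices :: "ereal \<Rightarrow> (real \<times> real) set" where
  "polydisk_indices r = radii r \<times> {1..}"

definition free_polydisk_weight :: "real \<times> real \<Rightarrow> nat list \<Rightarrow> real" where
  "free_polydisk_weight i \<alpha> = fst i ^ length \<alpha> * snd i ^ blocks \<alpha>"

lemma weighted_free_alg_polydisk:
  assumes "0 < r"
  shows "weighted_free_alg n (polydisk_indices r) free_polydisk_weight"
proof
  show "finite {\<alpha> \<in> words n. length \<alpha> = d}" for d unfolding words_len_eq[symmetric] by (rule finite_words_len)
  show "polydisk_indices r \<noteq> {}" using radii_nonempty[OF assms] by (auto simp: polydisk_indices_def)
  show "0 < free_polydisk_weight i \<alpha>" if "i \<in> polydisk_indices r" for i \<alpha>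
    using that radii_pos by (auto simp: free_polydisk_weight_def polydisk_indices_def)
  show "\<exists>l\<in>polydisk_indices r. \<forall>\<alpha>\<in>words n. free_polydisk_weight i \<alpha> \<le> free_polydisk_weight l \<alpha>
      \<and> free_polydisk_weight j \<alpha> \<le> free_polydisk_weight l \<alpha>"
    if "i \<in> polydisk_indices r" "j \<in> polydisk_indices r" for i j
  proof (intro bexI[of _ "(max (fst i) (fst j), max (snd i) (snd j))"])
    show "(max (fst i) (fst j), max (snd i) (snd j)) \<in> polydisk_indices r"
      using that radii_max by (auto simp: polydisk_indices_def)
    have "0 < fst i" "0 < fst j" "1 \<le> snd i" "1 \<le> snd j"
      using that radii_pos by (auto simp: polydisk_indices_def)
    then show "\<forall>\<alpha>\<in>words n. free_polydisk_weight i \<alpha> \<le> free_polydisk_weight (max (fst i) (fst j), max (snd i) (snd j)) \<alpha>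
        \<and> free_polydisk_weight j \<alpha> \<le> free_polydisk_weight (max (fst i) (fst j), max (snd i) (snd j)) \<alpha>"
      unfolding free_polydisk_weight_def fst_conv snd_conv
      by (intro ballI conjI mult_mono power_mono) auto
  qed
  show "free_polydisk_weight i (\<alpha> @ \<beta>) \<le> free_polydisk_weight i \<alpha> * free_polydisk_weight i \<beta>"
    if "i \<in> polydisk_indices r" for i \<alpha> \<beta>
  proof -
    have i: "0 < fst i" "1 \<le> snd i" using that radii_pos by (auto simp: polydisk_indices_def)
    have "free_polydisk_weight i (\<alpha> @ \<beta>) \<le> fst i ^ length (\<alpha> @ \<beta>) * snd i ^ (blocks \<alpha> + blocks \<beta>)"
      unfolding free_polydisk_weight_def using i
      by (intro mult_left_mono power_increasing blocks_append) auto
    then show ?thesis by (simp add: free_polydisk_weight_def power_add mult_ac)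
  qed
qed

lemma FT_D_eq:
  fixes n :: nat
  assumes "0 < r"
  defines "N \<equiv> graded_l1 (words n) length taylor_weight"
  shows "FT_D n r = free_alg (graded_seminorms.S (words n) (radii r) N) (graded_seminorms.P (radii r) N)"
proof -
  interpret weighted_l1 "words n" length "radii r" taylor_weight
    by (rule weighted_free_alg.axioms(1)[OF weighted_free_alg_taylor[OF assms(1)]])
  have t: "free_taylor_term \<rho> a = (\<lambda>\<alpha>. cmod (a \<alpha>) * taylor_weight \<rho> \<alpha>)" for \<rho> a
    by (simp add: free_taylor_term_def taylor_weight_def)
  have "{a \<in> free_series n. \<forall>\<rho>\<in>radii r. free_taylor_term \<rho> a summable_on words n} = S"
    unfolding S_eq t by (auto simp: free_series_def)
  then show ?thesis
    unfolding FT_D_def t N_def using free_alg_cong[OF T_eq] by simp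
qed

lemma F_D_eq:
  fixes n :: nat
  assumes "0 < r"
  defines "N \<equiv> graded_l1 (words n) length free_polydisk_weight"
  shows "F_D n r = free_alg (graded_seminorms.S (words n) (polydisk_indices r) N) (graded_seminorms.P (polydisk_indices r) N)"
proof -
  interpret weighted_l1 "words n" length "polydisk_indices r" free_polydisk_weight
    by (rule weighted_free_alg.axioms(1)[OF weighted_free_alg_polydisk[OF assms(1)]])
  have t: "free_polydisk_term \<rho> \<tau> a = (\<lambda>\<alpha>. cmod (a \<alpha>) * free_polydisk_weight (\<rho>, \<tau>) \<alpha>)" for \<rho> \<tau> a
    by (simp add: free_polydisk_term_def free_polydisk_weight_def switches_blocks mult.assoc)
  have "{a \<in> free_series n. \<forall>\<rho>\<in>radii r. \<forall>\<tau>\<ge>1. free_polydisk_term \<rho> \<tau> a summable_on words n} = S"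
    unfolding S_eq t by (auto simp: free_series_def polydisk_indices_def)
  moreover have "{\<lambda>a. infsum (free_polydisk_term \<rho> \<tau> a) (words n) | \<rho> \<tau>. \<rho> \<in> radii r \<and> \<tau> \<ge> 1}
      = {\<lambda>a. infsum (\<lambda>\<alpha>. cmod (a \<alpha>) * free_polydisk_weight i \<alpha>) (words n) | i. i \<in> polydisk_indices r}"
    unfolding t polydisk_indices_def by auto
  ultimately show ?thesis
    unfolding F_D_def N_def using free_alg_cong[OF T_eq] by simp
qed

lemma taylor_isos:
  assumes "0 < r" "q \<in> Cx"
  shows "fiber (OT_def_D n r) q \<cong>\<^sub>t\<^sub>a bundle_fiber (OT_def_D n r) q"
    "bundle_fiber (OT_def_D n r) q \<cong>\<^sub>t\<^sub>a O_q_D q n r"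
proof -
  have q0: "q \<noteq> 0" using assms(2) by (simp add: Cx_def)
  interpret W: weighted_free_alg n "radii r" taylor_weight by (rule weighted_free_alg_taylor[OF assms(1)])
  interpret V: weighted_l1 "multi_indices n" "mi_deg n" "radii r" "polydisk_weight n q"
    by (rule weighted_l1_polydisk[OF assms(1) q0])
  interpret D: deformation_fiber n "radii r" "graded_l1 (words n) length taylor_weight" "radii r"
    "graded_l1 (multi_indices n) (mi_deg n) (polydisk_weight n q)" q "polydisk_sec n q"
  proof (rule W.polydisk_deformation_fiber[OF assms])
    show "\<exists>i\<in>radii r. \<forall>\<alpha>\<in>words n. \<rho> ^ length \<alpha> \<le> taylor_weight i \<alpha>" if "\<rho> \<in> radii r" for \<rho>
      using that by (intro bexI[of _ \<rho>]) (auto simp: taylor_weight_def)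
    show "\<exists>\<rho>\<in>radii r. \<exists>C. \<forall>\<alpha>\<in>words n. blocks \<alpha> \<le> n \<longrightarrow> taylor_weight i \<alpha> \<le> C * \<rho> ^ length \<alpha>"
      if "i \<in> radii r" for i
      using that by (intro bexI[of _ i] exI[of _ 1]) (auto simp: taylor_weight_def)
  qed
  have F: "W.F = FT_D n r" unfolding W.F_def by (rule FT_D_eq[OF assms(1), symmetric])
  have B: "O_q_D q n r = quantum_alg n q V.S V.P" by (rule O_q_D_eq[OF assms(1) q0])
  show "fiber (OT_def_D n r) q \<cong>\<^sub>t\<^sub>a bundle_fiber (OT_def_D n r) q"
    using D.fiber_iso_bundle_fiber unfolding F OT_def_D_def .
  show "bundle_fiber (OT_def_D n r) q \<cong>\<^sub>t\<^sub>a O_q_D q n r"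
    using D.bundle_fiber_iso_quantum unfolding F B OT_def_D_def .
qed

lemma polydisk_isos:
  assumes "0 < r" "q \<in> Cx"
  shows "fiber (O_def_D n r) q \<cong>\<^sub>t\<^sub>a bundle_fiber (O_def_D n r) q"
    "bundle_fiber (O_def_D n r) q \<cong>\<^sub>t\<^sub>a O_q_D q n r"
proof -
  have q0: "q \<noteq> 0" using assms(2) by (simp add: Cx_def)
  interpret W: weighted_free_alg n "polydisk_indices r" free_polydisk_weight
    by (rule weighted_free_alg_polydisk[OF assms(1)])
  interpret V: weighted_l1 "multi_indices n" "mi_deg n" "radii r" "polydisk_weight n q"
    by (rule weighted_l1_polydisk[OF assms(1) q0])
  interpret D: deformation_fiber n "polydisk_indices r" "graded_l1 (words n) length free_polydisk_weight" "radii r"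
    "graded_l1 (multi_indices n) (mi_deg n) (polydisk_weight n q)" q "polydisk_sec n q"
  proof (rule W.polydisk_deformation_fiber[OF assms])
    \<comment> \<open>With the second index equal to 1 the block factor disappears and only the
      power of the radius remains.\<close>
    show "\<exists>i\<in>polydisk_indices r. \<forall>\<alpha>\<in>words n. \<rho> ^ length \<alpha> \<le> free_polydisk_weight i \<alpha>" if "\<rho> \<in> radii r" for \<rho>
      using that by (intro bexI[of _ "(\<rho>, 1)"]) (auto simp: free_polydisk_weight_def polydisk_indices_def)
    fix i assume i: "i \<in> polydisk_indices r"
    then have i': "fst i \<in> radii r" "0 < fst i" "1 \<le> snd i" using radii_pos by (auto simp: polydisk_indices_def)
    \<comment> \<open>The constant \<open>snd i ^ n\<close> bounds the block factor, as there are at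
      most \<open>n\<close> blocks and \<open>snd i\<close> is at least 1.\<close>
    have "free_polydisk_weight i \<alpha> \<le> snd i ^ n * fst i ^ length \<alpha>" if "blocks \<alpha> \<le> n" for \<alpha>
      unfolding free_polydisk_weight_def mult.commute[of "fst i ^ _"] using i' that
      by (intro mult_right_mono power_increasing) auto
    then show "\<exists>\<rho>\<in>radii r. \<exists>C. \<forall>\<alpha>\<in>words n. blocks \<alpha> \<le> n \<longrightarrow> free_polydisk_weight i \<alpha> \<le> C * \<rho> ^ length \<alpha>"
      using i'(1) by blast
  qed
  have F: "W.F = F_D n r" unfolding W.F_def by (rule F_D_eq[OF assms(1), symmetric])
  have B: "O_q_D q n r = quantum_alg n q V.S V.P" by (rule O_q_D_eq[OF assms(1) q0])
  show "fiber (O_def_D n r) q \<cong>\<^sub>t\<^sub>a bundle_fiber (O_def_D n r) q"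
    using D.fiber_iso_bundle_fiber unfolding F O_def_D_def .
  show "bundle_fiber (O_def_D n r) q \<cong>\<^sub>t\<^sub>a O_q_D q n r"
    using D.bundle_fiber_iso_quantum unfolding F B O_def_D_def .
qed

section \<open>The ball\<close>

lemma L2_set_sum:
  assumes "finite M"
  shows "L2_set (\<lambda>x. \<Sum>m\<in>M. f m x) A \<le> (\<Sum>m\<in>M. L2_set (f m) A)"
  using assms
proof (induction M)
  case empty
  then show ?case by (simp add: L2_set_def)
next
  case (insert m M)
  then show ?case using L2_set_triangle_ineq[of "f m" "\<lambda>x. \<Sum>m\<in>M. f m x" A] by simp
qed

definition ball_norm :: "nat \<Rightarrow> real \<Rightarrow> nat \<Rightarrow> (nat list \<Rightarrow> complex) \<Rightarrow> real" where
  "ball_norm n \<rho> d a = L2_set (\<lambda>\<alpha>. cmod (a \<alpha>)) (words_len n d) * \<rho> ^ d"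

text \<open>Minkowski's inequality over the cut position \<open>m\<close>; for fixed
  \<open>m\<close> the sum of squares over words of length \<open>d\<close> factors into those over
  the two pieces, so no constant is lost.\<close>

lemma L2_set_conv:
  "L2_set (\<lambda>\<alpha>. cmod (conv a b \<alpha>)) (words_len n d)
    \<le> (\<Sum>m\<le>d. L2_set (\<lambda>\<alpha>. cmod (a \<alpha>)) (words_len n m) * L2_set (\<lambda>\<alpha>. cmod (b \<alpha>)) (words_len n (d - m)))"
proof -
  have "L2_set (\<lambda>\<alpha>. cmod (conv a b \<alpha>)) (words_len n d)
      \<le> L2_set (\<lambda>\<alpha>. \<Sum>m\<le>d. cmod (a (take m \<alpha>)) * cmod (b (drop m \<alpha>))) (words_len n d)"
  proof (rule L2_set_mono)
    fix \<alpha> assume "\<alpha> \<in> words_len n d"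
    then have "length \<alpha> = d" by (simp add: words_len_def)
    then show "cmod (conv a b \<alpha>) \<le> (\<Sum>m\<le>d. cmod (a (take m \<alpha>)) * cmod (b (drop m \<alpha>)))"
      unfolding conv_def by (auto intro!: order.trans[OF norm_sum] simp: norm_mult)
  qed simp
  also have "\<dots> \<le> (\<Sum>m\<le>d. L2_set (\<lambda>\<alpha>. cmod (a (take m \<alpha>)) * cmod (b (drop m \<alpha>))) (words_len n d))"
    by (rule L2_set_sum) simp
  also have "\<dots> = (\<Sum>m\<le>d. L2_set (\<lambda>\<alpha>. cmod (a \<alpha>)) (words_len n m) * L2_set (\<lambda>\<alpha>. cmod (b \<alpha>)) (words_len n (d - m)))"
  proof (rule sum.cong[OF refl])
    fix m assume "m \<in> {..d}"
    then have "(\<Sum>\<alpha>\<in>words_len n d. (cmod (a (take m \<alpha>)))\<^sup>2 * (cmod (b (drop m \<alpha>)))\<^sup>2)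
        = (\<Sum>\<beta>\<in>words_len n m. (cmod (a \<beta>))\<^sup>2) * (\<Sum>\<gamma>\<in>words_len n (d - m). (cmod (b \<gamma>))\<^sup>2)"
      using sum_words_len_split[of m d "\<lambda>\<beta> \<gamma>. (cmod (a \<beta>))\<^sup>2 * (cmod (b \<gamma>))\<^sup>2" n] by (simp add: sum_product)
    then show "L2_set (\<lambda>\<alpha>. cmod (a (take m \<alpha>)) * cmod (b (drop m \<alpha>))) (words_len n d)
        = L2_set (\<lambda>\<alpha>. cmod (a \<alpha>)) (words_len n m) * L2_set (\<lambda>\<alpha>. cmod (b \<alpha>)) (words_len n (d - m))"
      by (simp add: L2_set_def power_mult_distrib real_sqrt_mult)
  qed
  finally show ?thesis .
qed

lemma graded_free_alg_ball:
  assumes "0 < r"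
  shows "graded_free_alg n (radii r) (ball_norm n)"
proof
  show "finite {\<alpha> \<in> words n. length \<alpha> = d}" for d unfolding words_len_eq[symmetric] by (rule finite_words_len)
  show "radii r \<noteq> {}" by (rule radii_nonempty[OF assms])
  show "\<exists>\<rho>\<in>radii r. \<exists>C. \<forall>a. cmod (a \<alpha>) \<le> C * ball_norm n \<rho> (length \<alpha>) a" if "\<alpha> \<in> words n" for \<alpha>
  proof -
    obtain \<rho> where \<rho>: "\<rho> \<in> radii r" using radii_nonempty[OF assms] by blast
    have "cmod (a \<alpha>) \<le> inverse (\<rho> ^ length \<alpha>) * ball_norm n \<rho> (length \<alpha>) a" for a :: "nat list \<Rightarrow> complex"
    proof -
      have "cmod (a \<alpha>) \<le> L2_set (\<lambda>\<alpha>. cmod (a \<alpha>)) (words_len n (length \<alpha>))"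
        by (rule member_le_L2_set[OF finite_words_len]) (use that in \<open>simp add: words_len_def\<close>)
      also have "\<dots> = inverse (\<rho> ^ length \<alpha>) * ball_norm n \<rho> (length \<alpha>) a"
        using radii_pos[OF \<rho>] by (simp add: ball_norm_def)
      finally show ?thesis .
    qed
    then show ?thesis using \<rho> by blast
  qed
  fix \<rho> d assume r: "\<rho> \<in> radii r"
  note pos = radii_pos[OF r]
  fix a b :: "nat list \<Rightarrow> complex"
  show "0 \<le> ball_norm n \<rho> d a" using pos by (simp add: ball_norm_def)
  show "ball_norm n \<rho> d (a + b) \<le> ball_norm n \<rho> d a + ball_norm n \<rho> d b"
    unfolding ball_norm_def distrib_right[symmetric]
    by (intro mult_right_mono order.trans[OF L2_set_mono L2_set_triangle_ineq])
      (use pos in \<open>auto intro: norm_triangle_ineq\<close>)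
  show "ball_norm n \<rho> d (scal c a) = cmod c * ball_norm n \<rho> d a" for c
    by (simp add: ball_norm_def norm_mult L2_set_right_distrib[symmetric])
  show "ball_norm n \<rho> d a = ball_norm n \<rho> d b" if "\<And>\<alpha>. \<alpha> \<in> words n \<Longrightarrow> length \<alpha> = d \<Longrightarrow> a \<alpha> = b \<alpha>"
    unfolding ball_norm_def using that by (auto simp: words_len_def intro!: L2_set_cong)
  show "\<exists>l\<in>radii r. \<forall>d a. ball_norm n \<rho> d a \<le> ball_norm n l d a \<and> ball_norm n \<rho>' d a \<le> ball_norm n l d a"
    if "\<rho>' \<in> radii r" for \<rho>'
    using pos radii_pos[OF that]
    by (intro bexI[OF _ radii_max[OF r that]]) (auto simp: ball_norm_def less_imp_le intro!: mult_left_mono power_mono)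
  show "ball_norm n \<rho> d (conv a b) \<le> (\<Sum>m\<le>d. ball_norm n \<rho> m a * ball_norm n \<rho> (d - m) b)"
  proof -
    have "ball_norm n \<rho> d (conv a b)
        \<le> (\<Sum>m\<le>d. L2_set (\<lambda>\<alpha>. cmod (a \<alpha>)) (words_len n m) * L2_set (\<lambda>\<alpha>. cmod (b \<alpha>)) (words_len n (d - m))) * \<rho> ^ d"
      unfolding ball_norm_def by (rule mult_right_mono[OF L2_set_conv]) (use pos in simp)
    also have "\<dots> = (\<Sum>m\<le>d. ball_norm n \<rho> m a * ball_norm n \<rho> (d - m) b)"
      unfolding sum_distrib_right
    proof (rule sum.cong[OF refl])
      fix m assume "m \<in> {..d}"
      then have "\<rho> ^ d = \<rho> ^ m * \<rho> ^ (d - m)" by (simp add: power_add[symmetric])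
      then show "L2_set (\<lambda>\<alpha>. cmod (a \<alpha>)) (words_len n m) * L2_set (\<lambda>\<alpha>. cmod (b \<alpha>)) (words_len n (d - m)) * \<rho> ^ d
          = ball_norm n \<rho> m a * ball_norm n \<rho> (d - m) b"
        by (simp add: ball_norm_def mult_ac)
    qed
    finally show ?thesis .
  qed
qed

lemma F_B_eq:
  fixes n :: nat
  assumes "0 < r"
  shows "F_B n r = free_alg (graded_seminorms.S (words n) (radii r) (ball_norm n)) (graded_seminorms.P (radii r) (ball_norm n))"
proof -
  interpret graded_seminorms "words n" length "radii r" "ball_norm n"
    by (rule graded_free_alg.axioms(1)[OF graded_free_alg_ball[OF assms]])
  have t: "free_ball_term n \<rho> a = (\<lambda>d. ball_norm n \<rho> d a)" for \<rho> a
    by (simp add: free_ball_term_def ball_norm_def L2_set_def)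
  show ?thesis
    unfolding F_B_def t S_def P_def nrm_def[abs_def]
    by (rule arg_cong2[of _ _ _ _ free_alg]) (auto simp: free_series_def)
qed

section \<open>q-factorials, MacMahon's formula and the weight of the quantum ball\<close>

lemma q_int_Suc: "q_int t (Suc m) = q_int t m + t ^ m"
  by (simp add: q_int_def)

lemma q_int_add: "q_int t (a + b) = q_int t b + t ^ b * q_int t a"
  by (induction a) (simp_all add: q_int_Suc q_int_def power_add algebra_simps)

lemma q_fact_Suc: "q_fact t (Suc m) = q_int t (Suc m) * q_fact t m"
  by (simp add: q_fact_def)

lemma q_int_pos: "0 < t \<Longrightarrow> 0 < m \<Longrightarrow> 0 < q_int t m"
  unfolding q_int_def by (rule sum_pos) auto

lemma q_fact_pos: "0 < t \<Longrightarrow> 0 < q_fact t m"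
  unfolding q_fact_def by (rule prod_pos) (auto intro: q_int_pos)

text \<open>The exponents below the sum of all \<open>k i\<close> are cut into consecutive intervals
  of lengths \<open>k n\<close>, ..., \<open>k 1\<close>; the interval for \<open>i\<close> starts
  at the sum of the \<open>k j\<close> with \<open>j > i\<close>.\<close>

lemma q_int_sum: "(\<Sum>i=1..n. t ^ (\<Sum>j=Suc i..n. k j) * q_int t (k i)) = q_int t (\<Sum>i=1..n. k i)"
proof (induction n)
  case 0
  then show ?case by (simp add: q_int_def)
next
  case (Suc n)
  have "(\<Sum>i=1..n. t ^ (\<Sum>j=Suc i..Suc n. k j) * q_int t (k i))
      = t ^ k (Suc n) * (\<Sum>i=1..n. t ^ (\<Sum>j=Suc i..n. k j) * q_int t (k i))"
    unfolding sum_distrib_left by (rule sum.cong) (auto simp: power_add mult_ac)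
  also have "\<dots> = t ^ k (Suc n) * q_int t (\<Sum>i=1..n. k i)" by (simp only: Suc)
  finally have "(\<Sum>i=1..Suc n. t ^ (\<Sum>j=Suc i..Suc n. k j) * q_int t (k i))
      = t ^ k (Suc n) * q_int t (\<Sum>i=1..n. k i) + q_int t (k (Suc n))" by simp
  also have "\<dots> = q_int t ((\<Sum>i=1..n. k i) + k (Suc n))" by (simp add: q_int_add)
  finally show ?case by simp
qed

lemma crossing_single:
  assumes "1 \<le> i"
  shows "crossing n k (count_list [i]) = (\<Sum>j=Suc i..n. k j)"
proof -
  have "crossing n k (count_list [i]) = (\<Sum>j=1..n. if i < j then k j else 0)"
    unfolding crossing_def
  proof (rule sum.cong[OF refl])
    fix j
    have "(\<Sum>i'=1..<j. count_list [i] i' * k j) = (\<Sum>i'=1..<j. if i' = i then k j else 0)"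
      by (rule sum.cong) auto
    then show "(\<Sum>i'=1..<j. count_list [i] i' * k j) = (if i < j then k j else 0)" using assms by simp
  qed
  also have "\<dots> = (\<Sum>j\<in>{j \<in> {1..n}. i < j}. k j)" by (rule sum.inter_filter[symmetric]) simp
  also have "{j \<in> {1..n}. i < j} = {Suc i..n}" using assms by auto
  finally show ?thesis .
qed

text \<open>In the reversed word the letter \<open>i\<close> comes last and forms an inversion with
  every larger letter before it.\<close>

lemma inversions_rev_Cons:
  assumes "i # \<beta> \<in> words n"
  shows "inversions (rev (i # \<beta>)) = inversions (rev \<beta>) + (\<Sum>j=Suc i..n. count_list \<beta> j)"
proof -
  have w: "[i] \<in> words n" "rev \<beta> \<in> words n" using assms by (auto simp: words_def)
  have r: "count_list (rev \<beta>) = count_list \<beta>" by auto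
  have i: "1 \<le> i" using assms by simp
  show ?thesis using inversions_append[OF w(2,1)] unfolding r crossing_single[OF i] by simp
qed

text \<open>Generating function of the pairs of letters in increasing order, counted as inversions
  of the reversal. The ball leads to this form because \<open>u_weight\<close> turns negative powers
  for inversions into positive powers for these pairs.\<close>

definition coinv_sum :: "nat \<Rightarrow> real \<Rightarrow> (nat \<Rightarrow> nat) \<Rightarrow> real" where
  "coinv_sum n t k = (\<Sum>\<alpha>\<in>words_of n k. t ^ inversions (rev \<alpha>))"

lemma words_of_step:
  assumes "0 < mi_deg n k"
  shows "words_of n k = (\<Union>i\<in>{i \<in> {1..n}. 0 < k i}. (#) i ` words_of n (k(i := k i - 1)))"
proof (intro subset_antisym subsetI)
  fix \<alpha> assume a: "\<alpha> \<in> words_of n k"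
  then have "length \<alpha> = mi_deg n k" using mi_deg_count_list[of \<alpha> n] by (auto simp: words_of_def)
  then obtain i \<beta> where \<alpha>: "\<alpha> = i # \<beta>" using assms by (cases \<alpha>) auto
  have k: "k = count_list (i # \<beta>)" and w: "i # \<beta> \<in> words n" using a \<alpha> by (auto simp: words_of_def)
  have "\<beta> \<in> words_of n (k(i := k i - 1))" using w unfolding k by (auto simp: words_of_def fun_eq_iff)
  moreover have "i \<in> {i \<in> {1..n}. 0 < k i}" using w unfolding k by auto
  ultimately show "\<alpha> \<in> (\<Union>i\<in>{i \<in> {1..n}. 0 < k i}. (#) i ` words_of n (k(i := k i - 1)))"
    unfolding \<alpha> by blast
next
  fix \<alpha> assume "\<alpha> \<in> (\<Union>i\<in>{i \<in> {1..n}. 0 < k i}. (#) i ` words_of n (k(i := k i - 1)))"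
  then obtain i \<beta> where i: "i \<in> {1..n}" "0 < k i" "\<alpha> = i # \<beta>" "\<beta> \<in> words n" "count_list \<beta> = k(i := k i - 1)"
    by (auto simp: words_of_def)
  then have "count_list \<alpha> = k" by (auto simp: fun_eq_iff)
  then show "\<alpha> \<in> words_of n k" using i by (auto simp: words_of_def)
qed

text \<open>MacMahon's theorem on the generating function of inversions; the recursion is on the first letter.\<close>
lemma coinv_sum_q_fact:
  assumes t: "0 < t" and "k \<in> multi_indices n"
  shows "coinv_sum n t k * q_fact_mi n t k = q_fact t (mi_deg n k)"
  using assms(2)
proof (induction "mi_deg n k" arbitrary: k)
  case 0
  then have k0: "k = (\<lambda>_. 0)" by (auto simp: mi_deg_def multi_indices_def fun_eq_iff)
  have "words_of n k = {[]}"
  proof (intro subset_antisym subsetI)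
    fix \<alpha> assume "\<alpha> \<in> words_of n k"
    then show "\<alpha> \<in> {[]}" using mi_deg_count_list[of \<alpha> n] 0 by (auto simp: words_of_def)
  qed (auto simp: words_of_def k0)
  then show ?case using 0 by (simp add: coinv_sum_def q_fact_mi_def q_fact_def k0)
next
  case (Suc d)
  let ?I = "{i \<in> {1..n}. 0 < k i}"
  let ?k = "\<lambda>i. k(i := k i - 1)"
  have mi: "?k i \<in> multi_indices n" "mi_deg n (?k i) = d" if "i \<in> ?I" for i
  proof -
    show "?k i \<in> multi_indices n" using Suc.prems by (auto simp: multi_indices_def)
    have "mi_deg n k = k i + (\<Sum>j\<in>{1..n} - {i}. k j)"
      unfolding mi_deg_def using that by (intro sum.remove) auto
    moreover have "mi_deg n (?k i) = (k i - 1) + (\<Sum>j\<in>{1..n} - {i}. k j)"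
      unfolding mi_deg_def using that by (subst sum.remove[of _ i]) auto
    ultimately show "mi_deg n (?k i) = d" using Suc.hyps(2) that by simp
  qed
  have pos: "0 < mi_deg n k" using Suc.hyps(2) by simp
  have rec: "coinv_sum n t k = (\<Sum>i\<in>?I. t ^ (\<Sum>j=Suc i..n. k j) * coinv_sum n t (?k i))"
  proof -
    have "coinv_sum n t k = (\<Sum>i\<in>?I. \<Sum>\<alpha>\<in>(#) i ` words_of n (?k i). t ^ inversions (rev \<alpha>))"
      unfolding coinv_sum_def words_of_step[OF pos]
      by (rule sum.UNION_disjoint) (auto simp: finite_words_of)
    also have "\<dots> = (\<Sum>i\<in>?I. t ^ (\<Sum>j=Suc i..n. k j) * coinv_sum n t (?k i))"
    proof (rule sum.cong[OF refl])
      fix i assume i: "i \<in> ?I"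
      have "(\<Sum>\<alpha>\<in>(#) i ` words_of n (?k i). t ^ inversions (rev \<alpha>)) = (\<Sum>\<beta>\<in>words_of n (?k i). t ^ inversions (rev (i # \<beta>)))"
        by (subst sum.reindex) (auto simp: inj_on_def)
      also have "\<dots> = (\<Sum>\<beta>\<in>words_of n (?k i). t ^ (\<Sum>j=Suc i..n. k j) * t ^ inversions (rev \<beta>))"
      proof (rule sum.cong[OF refl])
        fix \<beta> assume "\<beta> \<in> words_of n (?k i)"
        then have b: "\<beta> \<in> words n" "count_list \<beta> = ?k i" by (auto simp: words_of_def)
        have "(\<Sum>j=Suc i..n. count_list \<beta> j) = (\<Sum>j=Suc i..n. k j)" unfolding b(2) by (rule sum.cong) auto
        then show "t ^ inversions (rev (i # \<beta>)) = t ^ (\<Sum>j=Suc i..n. k j) * t ^ inversions (rev \<beta>)"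
          using inversions_rev_Cons[of i \<beta> n] b(1) i by (simp add: power_add del: rev.simps)
      qed
      finally show "(\<Sum>\<alpha>\<in>(#) i ` words_of n (?k i). t ^ inversions (rev \<alpha>)) = t ^ (\<Sum>j=Suc i..n. k j) * coinv_sum n t (?k i)"
        by (simp add: coinv_sum_def sum_distrib_left)
    qed
    finally show ?thesis .
  qed
  have fact: "q_fact_mi n t k = q_int t (k i) * q_fact_mi n t (?k i)" if i: "i \<in> ?I" for i
  proof -
    obtain m where m: "k i = Suc m" using i by (cases "k i") auto
    have "q_fact_mi n t k = q_fact t (k i) * (\<Prod>j\<in>{1..n} - {i}. q_fact t (k j))"
      unfolding q_fact_mi_def using i by (intro prod.remove) auto
    moreover have "q_fact_mi n t (?k i) = q_fact t m * (\<Prod>j\<in>{1..n} - {i}. q_fact t (k j))"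
      unfolding q_fact_mi_def using i m by (subst prod.remove[of _ i]) auto
    ultimately show ?thesis using m by (simp add: q_fact_Suc)
  qed
  have "coinv_sum n t k * q_fact_mi n t k
      = (\<Sum>i\<in>?I. t ^ (\<Sum>j=Suc i..n. k j) * q_int t (k i) * (coinv_sum n t (?k i) * q_fact_mi n t (?k i)))"
    unfolding rec sum_distrib_right by (rule sum.cong[OF refl]) (simp only: fact mult_ac)
  also have "\<dots> = (\<Sum>i\<in>?I. t ^ (\<Sum>j=Suc i..n. k j) * q_int t (k i) * q_fact t d)"
  proof (rule sum.cong[OF refl])
    fix i assume i: "i \<in> ?I"
    show "t ^ (\<Sum>j=Suc i..n. k j) * q_int t (k i) * (coinv_sum n t (?k i) * q_fact_mi n t (?k i))
        = t ^ (\<Sum>j=Suc i..n. k j) * q_int t (k i) * q_fact t d"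
      using Suc.hyps(1)[OF mi(2)[OF i, symmetric] mi(1)[OF i]] mi(2)[OF i] by simp
  qed
  \<comment> \<open>Indices with \<open>k i = 0\<close> may be added back because
    \<open>q_int t 0\<close> is 0.\<close>
  also have "\<dots> = (\<Sum>i=1..n. t ^ (\<Sum>j=Suc i..n. k j) * q_int t (k i)) * q_fact t d"
    unfolding sum_distrib_right by (rule sum.mono_neutral_left) (auto simp: q_int_def)
  also have "\<dots> = q_int t (Suc d) * q_fact t d"
    unfolding q_int_sum using Suc.hyps(2) by (simp add: mi_deg_def)
  also have "\<dots> = q_fact t (mi_deg n k)" using Suc.hyps(2)[symmetric] by (simp add: q_fact_Suc)
  finally show ?case .
qed

text \<open>The squared l2 norm of the functional that reads off the \<open>k\<close>-th coefficient
  after reordering. Its inverse is the least squared l2 norm of an element that is mapped to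
  \<open>x^k\<close>.\<close>

definition inv_square_sum :: "nat \<Rightarrow> complex \<Rightarrow> (nat \<Rightarrow> nat) \<Rightarrow> real" where
  "inv_square_sum n q k = (\<Sum>\<alpha>\<in>words_of n k. (cmod (inverse q ^ inversions \<alpha>))\<^sup>2)"

lemma inv_square_sum_pos:
  assumes "q \<noteq> 0" "k \<in> multi_indices n"
  shows "0 < inv_square_sum n q k"
  unfolding inv_square_sum_def
  by (rule sum_pos) (use assms words_of_nonempty finite_words_of in \<open>auto simp: norm_power norm_inverse\<close>)

text \<open>\<open>crossing n k k\<close> is the sum of the inversions of a word and of its
  reversal, so the square of \<open>u_weight\<close> cancels the negative powers and leaves powers
  of \<open>(cmod q)\<^sup>2\<close>.\<close>

lemma inv_square_sum_u_weight:
  assumes "q \<noteq> 0"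
  shows "inv_square_sum n q k * (u_weight n q k)\<^sup>2 = coinv_sum n ((cmod q)\<^sup>2) k"
  unfolding inv_square_sum_def coinv_sum_def sum_distrib_right
proof (rule sum.cong[OF refl])
  fix \<alpha> assume "\<alpha> \<in> words_of n k"
  then have c: "crossing n k k = inversions \<alpha> + inversions (rev \<alpha>)"
    using inversions_rev[of \<alpha> n] by (auto simp: words_of_def)
  have "cmod (inverse q ^ inversions \<alpha>) * u_weight n q k = cmod q ^ inversions (rev \<alpha>)"
    unfolding u_weight_crossing c using assms by (simp add: norm_power norm_inverse power_add power_inverse)
  then have "(cmod (inverse q ^ inversions \<alpha>) * u_weight n q k)\<^sup>2 = (cmod q ^ inversions (rev \<alpha>))\<^sup>2" by simp
  then show "(cmod (inverse q ^ inversions \<alpha>))\<^sup>2 * (u_weight n q k)\<^sup>2 = ((cmod q)\<^sup>2) ^ inversions (rev \<alpha>)"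
    by (simp add: power_mult_distrib power_mult[symmetric] mult.commute)
qed

text \<open>Explains the weight in the definition of the quantum ball: by MacMahon's formula it is
  the l2 norm of the minimal preimage of \<open>x^k\<close>.\<close>

lemma ball_weight_eq:
  assumes "q \<noteq> 0" "k \<in> multi_indices n"
  shows "sqrt (q_fact_mi n ((cmod q)\<^sup>2) k / q_fact ((cmod q)\<^sup>2) (mi_deg n k)) * u_weight n q k
    = 1 / sqrt (inv_square_sum n q k)"
proof -
  let ?t = "(cmod q)\<^sup>2"
  have t: "0 < ?t" using assms(1) by simp
  have u: "0 < u_weight n q k" using assms(1) by (simp add: u_weight_crossing)
  have f: "0 < q_fact_mi n ?t k" unfolding q_fact_mi_def by (rule prod_pos) (auto intro: q_fact_pos[OF t])
  have s: "0 < inv_square_sum n q k" by (rule inv_square_sum_pos[OF assms])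
  have e: "q_fact ?t (mi_deg n k) = inv_square_sum n q k * (u_weight n q k)\<^sup>2 * q_fact_mi n ?t k"
    unfolding inv_square_sum_u_weight[OF assms(1)] by (rule coinv_sum_q_fact[OF t assms(2), symmetric])
  have "q_fact_mi n ?t k / q_fact ?t (mi_deg n k) = 1 / (inv_square_sum n q k * (u_weight n q k)\<^sup>2)"
    unfolding e using f by simp
  then have "sqrt (q_fact_mi n ?t k / q_fact ?t (mi_deg n k)) = 1 / (sqrt (inv_square_sum n q k) * u_weight n q k)"
    using u by (simp add: real_sqrt_divide real_sqrt_mult)
  then show ?thesis using u by simp
qed

definition ball_weight :: "nat \<Rightarrow> complex \<Rightarrow> real \<Rightarrow> (nat \<Rightarrow> nat) \<Rightarrow> real" where
  "ball_weight n q \<rho> k = 1 / sqrt (inv_square_sum n q k) * \<rho> ^ mi_deg n k"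

lemma weighted_l1_ball:
  assumes "0 < r" "q \<noteq> 0"
  shows "weighted_l1 (multi_indices n) (mi_deg n) (radii r) (ball_weight n q)"
proof
  show "finite {k \<in> multi_indices n. mi_deg n k = d}" for d by (rule finite_mi_deg)
  show "radii r \<noteq> {}" by (rule radii_nonempty[OF assms(1)])
  show "0 < ball_weight n q \<rho> k" if "\<rho> \<in> radii r" "k \<in> multi_indices n" for \<rho> k
    using inv_square_sum_pos[OF assms(2) that(2)] radii_pos[OF that(1)] by (simp add: ball_weight_def)
  fix \<rho> \<rho>' assume r: "\<rho> \<in> radii r" "\<rho>' \<in> radii r"
  show "\<exists>l\<in>radii r. \<forall>k\<in>multi_indices n. ball_weight n q \<rho> k \<le> ball_weight n q l k \<and> ball_weight n q \<rho>' k \<le> ball_weight n q l k"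
  proof (intro bexI[OF _ radii_max[OF r]] ballI)
    fix k assume "k \<in> multi_indices n"
    then have "0 \<le> 1 / sqrt (inv_square_sum n q k)" using inv_square_sum_pos[OF assms(2)] by (simp add: less_imp_le)
    then show "ball_weight n q \<rho> k \<le> ball_weight n q (max \<rho> \<rho>') k \<and> ball_weight n q \<rho>' k \<le> ball_weight n q (max \<rho> \<rho>') k"
      unfolding ball_weight_def using radii_pos[OF r(1)] radii_pos[OF r(2)]
      by (intro conjI mult_left_mono power_mono) auto
  qed
qed

lemma O_q_B_eq:
  fixes n :: nat
  assumes "0 < r" "q \<noteq> 0"
  defines "M \<equiv> graded_l1 (multi_indices n) (mi_deg n) (ball_weight n q)"
  shows "O_q_B q n r = quantum_alg n q (graded_seminorms.S (multi_indices n) (radii r) M) (graded_seminorms.P (radii r) M)"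
proof -
  interpret weighted_l1 "multi_indices n" "mi_deg n" "radii r" "ball_weight n q"
    by (rule weighted_l1_ball[OF assms(1,2)])
  \<comment> \<open>The two weights are identified only on multi-indices, hence the congruence rules
    below in place of an equation between functions.\<close>
  have t: "q_ball_term n q \<rho> f k = cmod (f k) * ball_weight n q \<rho> k" if "k \<in> multi_indices n" for \<rho> f k
    unfolding q_ball_term_def ball_weight_def ball_weight_eq[OF assms(2) that, symmetric] by (simp only: mult.assoc)
  have sm: "q_ball_term n q \<rho> f summable_on multi_indices n \<longleftrightarrow> (\<lambda>k. cmod (f k) * ball_weight n q \<rho> k) summable_on multi_indices n" for \<rho> f
    by (rule summable_on_cong) (rule t)
  have inf: "infsum (q_ball_term n q \<rho> f) (multi_indices n) = infsum (\<lambda>k. cmod (f k) * ball_weight n q \<rho> k) (multi_indices n)" for \<rho> f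
    by (rule infsum_cong) (rule t)
  have "{f \<in> quantum_series n. \<forall>\<rho>\<in>radii r. q_ball_term n q \<rho> f summable_on multi_indices n} = S"
    unfolding S_eq sm by (auto simp: quantum_series_def)
  then show ?thesis
    unfolding O_q_B_def inf M_def using quantum_alg_cong[OF T_eq, of n q] by simp
qed

section \<open>Comparison of l1 and l2 norms on the ball\<close>

lemma card_mi_deg: "card {k \<in> multi_indices n. mi_deg n k = d} \<le> (d + 1) ^ n"
proof -
  let ?K = "{k \<in> multi_indices n. mi_deg n k = d}"
  have "inj_on (\<lambda>k. restrict k {1..n}) ?K"
  proof (rule inj_onI)
    fix k l assume kl: "k \<in> ?K" "l \<in> ?K" "restrict k {1..n} = restrict l {1..n}"
    show "k = l"
    proof
      fix i
      show "k i = l i"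
        using fun_cong[OF kl(3), of i] kl(1,2) by (cases "i \<in> {1..n}") (auto simp: multi_indices_def)
    qed
  qed
  moreover have "(\<lambda>k. restrict k {1..n}) ` ?K \<subseteq> {1..n} \<rightarrow>\<^sub>E {..d}"
  proof clarify
    fix k assume "k \<in> multi_indices n" "d = mi_deg n k"
    then show "restrict k {1..n} \<in> {1..n} \<rightarrow>\<^sub>E {..mi_deg n k}"
      using member_le_sum[of _ "{1..n}" k] by (auto simp: mi_deg_def)
  qed
  ultimately have "card ?K \<le> card ({1..n} \<rightarrow>\<^sub>E {..d})"
    by (rule card_inj_on_le) (simp add: finite_PiE)
  then show ?thesis by (simp add: card_PiE)
qed

text \<open>A polynomial factor is absorbed by a larger radius. Bernoulli's inequality for the
  \<open>n\<close>-th root \<open>t\<close> of \<open>\<rho>' / \<rho>\<close> bounds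
  \<open>d + 1\<close> by a multiple of \<open>t ^ d\<close>, and the \<open>n\<close>-th power of
  this is the claim.\<close>

lemma polynomial_geometric_bound:
  fixes \<rho> \<rho>' :: real
  assumes "0 < \<rho>" "\<rho> < \<rho>'" "1 \<le> n"
  shows "\<exists>C. \<forall>d. real ((d + 1) ^ n) * \<rho> ^ d \<le> C * \<rho>' ^ d"
proof -
  define t where "t = root n (\<rho>' / \<rho>)"
  have t1: "1 < t" unfolding t_def using assms by (simp add: real_root_gt_1_iff)
  have tn: "t ^ n = \<rho>' / \<rho>" unfolding t_def using assms by (simp add: real_root_pow_pos2)
  \<comment> \<open>Chosen so that \<open>e * (real d + 1)\<close> is at most
    \<open>1 + real d * (t - 1)\<close>: the bound \<open>e \<le> 1\<close> takes care of the
    constant term and \<open>e \<le> t - 1\<close> of the linear one.\<close>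
  define e where "e = min 1 (t - 1)"
  have e: "0 < e" "e \<le> 1" "e \<le> t - 1" using t1 by (auto simp: e_def)
  have "real ((d + 1) ^ n) * \<rho> ^ d \<le> (1 / e) ^ n * \<rho>' ^ d" for d
  proof -
    have "e * (real d + 1) \<le> 1 + real d * (t - 1)"
      using e mult_left_mono[OF e(3), of "real d"] by (simp add: algebra_simps)
    also have "\<dots> \<le> t ^ d" using Bernoulli_inequality[of "t - 1" d] t1 by simp
    finally have "real (d + 1) \<le> 1 / e * t ^ d" using e(1) by (simp add: field_simps)
    then have "real (d + 1) ^ n \<le> (1 / e * t ^ d) ^ n" by (intro power_mono) auto
    also have "\<dots> = (1 / e) ^ n * (\<rho>' / \<rho>) ^ d"
      by (simp add: power_mult_distrib tn[symmetric] power_mult[symmetric] mult.commute power_divide)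
    finally have "real (d + 1) ^ n * \<rho> ^ d \<le> (1 / e) ^ n * (\<rho>' / \<rho>) ^ d * \<rho> ^ d"
      using assms(1) by (intro mult_right_mono) auto
    also have "\<dots> = (1 / e) ^ n * \<rho>' ^ d" using assms(1) by (simp add: power_divide)
    finally show ?thesis by simp
  qed
  then show ?thesis by blast
qed

text \<open>The equality case of Cauchy-Schwarz: weights proportional to the conjugates of the
  reordering factors, scaled so that the preimage maps exactly to \<open>x^k\<close>.\<close>

definition ball_sec :: "nat \<Rightarrow> complex \<Rightarrow> nat list \<Rightarrow> complex" where
  "ball_sec n q \<alpha> = cnj (inverse q ^ inversions \<alpha>) / of_real (inv_square_sum n q (count_list \<alpha>))"

lemma sum_ball_sec:
  assumes "q \<noteq> 0" "k \<in> multi_indices n"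
  shows "(\<Sum>\<alpha>\<in>words_of n k. inverse q ^ inversions \<alpha> * ball_sec n q \<alpha>) = 1"
    and "(\<Sum>\<alpha>\<in>words_of n k. (cmod (ball_sec n q \<alpha>))\<^sup>2) = 1 / inv_square_sum n q k"
proof -
  let ?s = "inv_square_sum n q k"
  have s: "0 < ?s" by (rule inv_square_sum_pos[OF assms])
  have "(\<Sum>\<alpha>\<in>words_of n k. inverse q ^ inversions \<alpha> * ball_sec n q \<alpha>)
      = (\<Sum>\<alpha>\<in>words_of n k. of_real ((cmod (inverse q ^ inversions \<alpha>))\<^sup>2)) / of_real ?s"
    unfolding sum_divide_distrib
    by (rule sum.cong[OF refl]) (auto simp: words_of_def ball_sec_def complex_norm_square simp del: of_real_power complex_cnj_power)
  also have "\<dots> = of_real ?s / of_real ?s" by (simp only: inv_square_sum_def of_real_sum)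
  finally show "(\<Sum>\<alpha>\<in>words_of n k. inverse q ^ inversions \<alpha> * ball_sec n q \<alpha>) = 1" using s by simp
  have "(\<Sum>\<alpha>\<in>words_of n k. (cmod (ball_sec n q \<alpha>))\<^sup>2) = (\<Sum>\<alpha>\<in>words_of n k. (cmod (inverse q ^ inversions \<alpha>))\<^sup>2) / ?s\<^sup>2"
    unfolding sum_divide_distrib
    by (rule sum.cong[OF refl]) (auto simp: words_of_def ball_sec_def norm_divide power_divide simp del: complex_cnj_power)
  also have "\<dots> = ?s / ?s\<^sup>2" by (simp only: inv_square_sum_def)
  also have "\<dots> = 1 / ?s" using s by (simp add: power2_eq_square)
  finally show "(\<Sum>\<alpha>\<in>words_of n k. (cmod (ball_sec n q \<alpha>))\<^sup>2) = 1 / ?s" .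
qed

lemma qpi_Cauchy_Schwarz:
  assumes "q \<noteq> 0" "k \<in> multi_indices n"
  shows "cmod (qpi n q a k) * (1 / sqrt (inv_square_sum n q k)) \<le> L2_set (\<lambda>\<alpha>. cmod (a \<alpha>)) (words_len n (mi_deg n k))"
proof -
  have s: "0 < inv_square_sum n q k" by (rule inv_square_sum_pos[OF assms])
  have "cmod (qpi n q a k) \<le> (\<Sum>\<alpha>\<in>words_of n k. \<bar>cmod (inverse q ^ inversions \<alpha>)\<bar> * \<bar>cmod (a \<alpha>)\<bar>)"
    unfolding qpi_def by (rule order.trans[OF norm_sum]) (simp add: norm_mult)
  also have "\<dots> \<le> L2_set (\<lambda>\<alpha>. cmod (inverse q ^ inversions \<alpha>)) (words_of n k) * L2_set (\<lambda>\<alpha>. cmod (a \<alpha>)) (words_of n k)"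
    by (rule L2_set_mult_ineq)
  also have "L2_set (\<lambda>\<alpha>. cmod (inverse q ^ inversions \<alpha>)) (words_of n k) = sqrt (inv_square_sum n q k)"
    by (simp add: L2_set_def inv_square_sum_def)
  also have "L2_set (\<lambda>\<alpha>. cmod (a \<alpha>)) (words_of n k) \<le> L2_set (\<lambda>\<alpha>. cmod (a \<alpha>)) (words_len n (mi_deg n k))"
    unfolding L2_set_def by (intro real_sqrt_le_mono sum_mono2 finite_words_len words_of_subset) auto
  finally show ?thesis using s by (simp add: field_simps)
qed

text \<open>Reordering loses a factor for the number of multi-indices of degree \<open>d\<close>,
  since the quantum norm adds over \<open>k\<close>. The section loses nothing, because the classes
  of words are disjoint and an l2 norm is at most the l1 norm.\<close>

lemma ball_deformation_fiber:
  assumes n: "1 \<le> n" and r: "0 < r" and q: "q \<in> Cx"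
  shows "deformation_fiber n (radii r) (ball_norm n) (radii r)
    (graded_l1 (multi_indices n) (mi_deg n) (ball_weight n q)) q (ball_sec n q)"
proof -
  have q0: "q \<noteq> 0" using q by (simp add: Cx_def)
  let ?K = "\<lambda>d. {k \<in> multi_indices n. mi_deg n k = d}"
  let ?M = "graded_l1 (multi_indices n) (mi_deg n) (ball_weight n q)"
  interpret A: graded_free_alg n "radii r" "ball_norm n" by (rule graded_free_alg_ball[OF r])
  interpret B: weighted_l1 "multi_indices n" "mi_deg n" "radii r" "ball_weight n q"
    by (rule weighted_l1_ball[OF r q0])
  show ?thesis
  proof unfold_locales
    show "q \<in> Cx" by (rule q)
  next
    fix \<rho> assume \<rho>: "\<rho> \<in> radii r"
    \<comment> \<open>Makes room for the factor \<open>(d + 1) ^ n\<close>; a strictly larger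
      admissible radius exists because \<open>radii r\<close> has no largest element.\<close>
    obtain \<rho>' where \<rho>': "\<rho>' \<in> radii r" "\<rho> < \<rho>'" using radii_greater[OF \<rho>] by blast
    obtain C where C: "\<And>d. real ((d + 1) ^ n) * \<rho> ^ d \<le> C * \<rho>' ^ d"
      using polynomial_geometric_bound[OF radii_pos[OF \<rho>] \<rho>'(2) n] by blast
    have "?M \<rho> d (qpi n q a) \<le> C * ball_norm n \<rho>' d a" for d a
    proof -
      let ?L = "L2_set (\<lambda>\<alpha>. cmod (a \<alpha>)) (words_len n d)"
      have "?M \<rho> d (qpi n q a) \<le> (\<Sum>k\<in>?K d. ?L * \<rho> ^ d)"
        unfolding graded_l1_def
      proof (rule sum_mono, clarify)
        fix k assume k: "k \<in> multi_indices n" "d = mi_deg n k"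
        have "cmod (qpi n q a k) * (1 / sqrt (inv_square_sum n q k)) * \<rho> ^ mi_deg n k
            \<le> L2_set (\<lambda>\<alpha>. cmod (a \<alpha>)) (words_len n (mi_deg n k)) * \<rho> ^ mi_deg n k"
          by (rule mult_right_mono[OF qpi_Cauchy_Schwarz[OF q0 k(1)]]) (use radii_pos[OF \<rho>] in simp)
        then show "cmod (qpi n q a k) * ball_weight n q \<rho> k \<le> L2_set (\<lambda>\<alpha>. cmod (a \<alpha>)) (words_len n (mi_deg n k)) * \<rho> ^ mi_deg n k"
          by (simp only: ball_weight_def mult.assoc)
      qed
      also have "\<dots> = real (card (?K d)) * (?L * \<rho> ^ d)" by simp
      also have "\<dots> \<le> real ((d + 1) ^ n) * (?L * \<rho> ^ d)"
        by (rule mult_right_mono[OF of_nat_mono[OF card_mi_deg]]) (use radii_pos[OF \<rho>] in simp)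
      also have "\<dots> = ?L * (real ((d + 1) ^ n) * \<rho> ^ d)" by (simp only: mult_ac)
      also have "\<dots> \<le> ?L * (C * \<rho>' ^ d)" by (rule mult_left_mono[OF C]) simp
      finally show ?thesis by (simp only: ball_norm_def mult_ac)
    qed
    then show "\<exists>i\<in>radii r. \<exists>C. \<forall>d. \<forall>a\<in>A.S. ?M \<rho> d (qpi n q a) \<le> C * ball_norm n i d a"
      using \<rho>'(1) by blast
  next
    fix \<rho> assume \<rho>: "\<rho> \<in> radii r"
    have "ball_norm n \<rho> d (qsec n (ball_sec n q) f) \<le> 1 * ?M \<rho> d f" for d f
    proof -
      have "(\<Sum>\<alpha>\<in>words_len n d. (cmod (qsec n (ball_sec n q) f \<alpha>))\<^sup>2)
          = (\<Sum>k\<in>?K d. \<Sum>\<alpha>\<in>words_of n k. (cmod (ball_sec n q \<alpha>))\<^sup>2 * (cmod (f k))\<^sup>2)"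
        unfolding sum_words_of[symmetric]
        by (intro sum.cong refl) (auto simp: words_of_def qsec_def norm_mult power_mult_distrib)
      also have "\<dots> = (\<Sum>k\<in>?K d. (cmod (f k) * (1 / sqrt (inv_square_sum n q k)))\<^sup>2)"
      proof (rule sum.cong[OF refl])
        fix k assume "k \<in> ?K d"
        then have k: "k \<in> multi_indices n" by simp
        show "(\<Sum>\<alpha>\<in>words_of n k. (cmod (ball_sec n q \<alpha>))\<^sup>2 * (cmod (f k))\<^sup>2) = (cmod (f k) * (1 / sqrt (inv_square_sum n q k)))\<^sup>2"
          unfolding sum_distrib_right[symmetric] sum_ball_sec(2)[OF q0 k]
          using inv_square_sum_pos[OF q0 k] by (simp add: power_mult_distrib power_divide)
      qed
      finally have "ball_norm n \<rho> d (qsec n (ball_sec n q) f) = L2_set (\<lambda>k. cmod (f k) * (1 / sqrt (inv_square_sum n q k))) (?K d) * \<rho> ^ d"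
        by (simp add: ball_norm_def L2_set_def)
      also have "\<dots> \<le> (\<Sum>k\<in>?K d. cmod (f k) * (1 / sqrt (inv_square_sum n q k))) * \<rho> ^ d"
        by (intro mult_right_mono L2_set_le_sum)
          (use radii_pos[OF \<rho>] inv_square_sum_pos[OF q0] in \<open>auto simp: less_imp_le\<close>)
      also have "\<dots> = ?M \<rho> d f"
        unfolding graded_l1_def sum_distrib_right by (rule sum.cong) (auto simp: ball_weight_def)
      finally show ?thesis by simp
    qed
    then show "\<exists>j\<in>radii r. \<exists>C. \<forall>d. \<forall>f\<in>B.S. ball_norm n \<rho> d (qsec n (ball_sec n q) f) \<le> C * ?M j d f"
      using \<rho> by blast
  next
    fix k assume "k \<in> multi_indices n"
    then show "(\<Sum>\<alpha>\<in>words_of n k. inverse q ^ inversions \<alpha> * ball_sec n q \<alpha>) = 1"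
      by (rule sum_ball_sec(1)[OF q0])
  qed
qed

lemma ball_isos:
  assumes "1 \<le> n" "0 < r" "q \<in> Cx"
  shows "fiber (O_def_B n r) q \<cong>\<^sub>t\<^sub>a bundle_fiber (O_def_B n r) q"
    "bundle_fiber (O_def_B n r) q \<cong>\<^sub>t\<^sub>a O_q_B q n r"
proof -
  have q0: "q \<noteq> 0" using assms(3) by (simp add: Cx_def)
  interpret D: deformation_fiber n "radii r" "ball_norm n" "radii r"
    "graded_l1 (multi_indices n) (mi_deg n) (ball_weight n q)" q "ball_sec n q"
    by (rule ball_deformation_fiber[OF assms])
  have F: "D.F = F_B n r" unfolding D.F_def by (rule F_B_eq[OF assms(2), symmetric])
  have B: "O_q_B q n r = quantum_alg n q D.B.S D.B.P" by (rule O_q_B_eq[OF assms(2) q0])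
  show "fiber (O_def_B n r) q \<cong>\<^sub>t\<^sub>a bundle_fiber (O_def_B n r) q"
    using D.fiber_iso_bundle_fiber unfolding F O_def_B_def .
  show "bundle_fiber (O_def_B n r) q \<cong>\<^sub>t\<^sub>a O_q_B q n r"
    using D.bundle_fiber_iso_quantum unfolding F B O_def_B_def .
qed

theorem theorem5p3:
  fixes n :: nat and r :: ereal and q :: complex
  assumes "n \<ge> 1" and "0 < r" and "q \<in> Cx"
  shows "fiber (O_def_D n r) q \<cong>\<^sub>t\<^sub>a bundle_fiber (O_def_D n r) q
       \<and> bundle_fiber (O_def_D n r) q \<cong>\<^sub>t\<^sub>a O_q_D q n r
       \<and> fiber (OT_def_D n r) q \<cong>\<^sub>t\<^sub>a bundle_fiber (OT_def_D n r) q
       \<and> bundle_fiber (OT_def_D n r) q \<cong>\<^sub>t\<^sub>a O_q_D q n r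
       \<and> fiber (O_def_B n r) q \<cong>\<^sub>t\<^sub>a bundle_fiber (O_def_B n r) q
       \<and> bundle_fiber (O_def_B n r) q \<cong>\<^sub>t\<^sub>a O_q_B q n r"
  using polydisk_isos[OF assms(2,3)] taylor_isos[OF assms(2,3)] ball_isos[OF assms] by blast

end
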